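(* For every essentially ${\mathbb S}^1$-gapped $J$-unitary operator $T$ on ${\cal K}$, $\mathrm{Sig}(T)=-\mathrm{SF}(\Gamma_T)$.
   Context: ${\cal H}$ is a separable complex Hilbert space, ${\cal K}={\cal H}\oplus{\cal H}$, $J=\begin{pmatrix}{\bf 1}&0\\0&-{\bf 1}\end{pmatrix}$, ${\mathbb S}^1$ the unit circle. A bounded invertible $T=\begin{pmatrix}a&b\\c&d\end{pmatrix}$ is $J$-unitary if $T^*JT=J$ ($a,d$ invertible); it is essentially ${\mathbb S}^1$-gapped if its spectrum on ${\mathbb S}^1$ consists only of isolated eigenvalues of finite algebraic multiplicity. Signature: choose $h>0$ such that the closed annulus $\{e^{-h}\le|z|\le e^h\}$ contains only discrete spectrum of $T$ and none on its boundary; let ${\cal E}_=$ be the span of the generalized eigenspaces of all eigenvalues of $T$ in the annulus, $\Phi_=$ an isometry onto ${\cal E}_=$, and $\mathrm{Sig}(T)=\nu_+-\nu_-$ with $\nu_\pm$ the numbers of positive/negative eigenvalues of $\Phi_=^*J\Phi_=$. Spectral flow: $\Gamma_T=(V(e^{-\imath t}T))_{t\in[0,2\pi)}$ with $V(e^{-\imath t}T)=\begin{pmatrix}e^{-\imath t}(a^* )^{-1}&bd^{-1}\\-d^{-1}c&e^{\imath t}d^{-1}\end{pmatrix}$, a real-analytic path of unitaries with $1$ never in their essential spectrum and $1$ an eigenvalue only for finitely many $t$; $\mathrm{SF}(\Gamma_T)$ is the number of eigenvalues (with multiplicity) crossing $1$ counterclockwise minus those crossing clockwise as $t$ runs through $[0,2\pi)$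 (net signature at each crossing, crossing at $t=0$ included). *)

theory Defs
  imports "HOL-Complex_Analysis.Complex_Analysis" "Jordan_Normal_Form.Char_Poly"
begin

class chilbert = banach +
  fixes scaleC :: "complex \<Rightarrow> 'a \<Rightarrow> 'a"
    and cinner :: "'a \<Rightarrow> 'a \<Rightarrow> complex"
  assumes scaleC_add_right: "scaleC c (x + y) = scaleC c x + scaleC c y"
    and scaleC_add_left: "scaleC (c + d) x = scaleC c x + scaleC d x"
    and scaleC_scaleC: "scaleC c (scaleC d x) = scaleC (c * d) x"
    and scaleC_one: "scaleC 1 x = x"
    and scaleR_scaleC: "scaleR r x = scaleC (complex_of_real r) x"
    and cinner_add_right: "cinner x (y + z) = cinner x y + cinner x z"
    and cinner_scaleC_right: "cinner x (scaleC c y) = c * cinner x y"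
    and cinner_commute: "cinner y x = cnj (cinner x y)"
    and cinner_self_real: "cinner x x \<in> \<real>"
    and cinner_self_nonneg: "0 \<le> Re (cinner x x)"
    and cinner_self_zero: "cinner x x = 0 \<Longrightarrow> x = 0"
    and norm_cinner: "norm x = sqrt (Re (cinner x x))"

definition separable_H :: "'a::topological_space itself \<Rightarrow> bool" where
  "separable_H _ \<longleftrightarrow> (\<exists>D::'a set. countable D \<and> closure D = UNIV)"

definition kscale :: "complex \<Rightarrow> 'h::chilbert \<times> 'h \<Rightarrow> 'h \<times> 'h" where
  "kscale c p = (scaleC c (fst p), scaleC c (snd p))"

definition kinner :: "'h::chilbert \<times> 'h \<Rightarrow> 'h \<times> 'h \<Rightarrow> complex" where
  "kinner p q = cinner (fst p) (fst q) + cinner (snd p) (snd q)"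

definition Jop :: "'h::chilbert \<times> 'h \<Rightarrow> 'h \<times> 'h" where
  "Jop p = (fst p, - snd p)"

definition kbounded :: "('h::chilbert \<times> 'h \<Rightarrow> 'h \<times> 'h) \<Rightarrow> bool" where
  "kbounded T \<longleftrightarrow> (\<forall>x y. T (x + y) = T x + T y) \<and> (\<forall>c x. T (kscale c x) = kscale c (T x))
     \<and> (\<exists>C. \<forall>x. norm (T x) \<le> C * norm x)"

definition kinvertible :: "('h::chilbert \<times> 'h \<Rightarrow> 'h \<times> 'h) \<Rightarrow> bool" where
  "kinvertible T \<longleftrightarrow> kbounded T \<and>
     (\<exists>S. kbounded S \<and> (\<forall>x. S (T x) = x) \<and> (\<forall>x. T (S x) = x))"

text \<open>J-unitarity T^* J T = J, written out weakly: <x, T^* J T y> = <T x, J T y>.\<close>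
definition J_unitary :: "('h::chilbert \<times> 'h \<Rightarrow> 'h \<times> 'h) \<Rightarrow> bool" where
  "J_unitary T \<longleftrightarrow> kinvertible T \<and> (\<forall>x y. kinner (T x) (Jop (T y)) = kinner x (Jop y))"

definition kspec :: "('h::chilbert \<times> 'h \<Rightarrow> 'h \<times> 'h) \<Rightarrow> complex set" where
  "kspec T = {z. \<not> kinvertible (\<lambda>x. T x - kscale z x)}"

definition kres :: "('h::chilbert \<times> 'h \<Rightarrow> 'h \<times> 'h) \<Rightarrow> complex \<Rightarrow> 'h \<times> 'h \<Rightarrow> 'h \<times> 'h" where
  "kres T \<zeta> = inv_into UNIV (\<lambda>x. kscale \<zeta> x - T x)"

definition kspan :: "('h::chilbert \<times> 'h) set \<Rightarrow> ('h \<times> 'h) set" where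
  "kspan S = {x. \<exists>(vs::('h \<times> 'h) list) (cs::complex list). length cs = length vs \<and> set vs \<subseteq> S \<and>
                  x = (\<Sum>i<length vs. kscale (cs ! i) (vs ! i))}"

definition kfinite_dim :: "('h::chilbert \<times> 'h) set \<Rightarrow> bool" where
  "kfinite_dim V \<longleftrightarrow> (\<exists>vs. set vs \<subseteq> V \<and> V \<subseteq> kspan (set vs))"

definition kdim :: "('h::chilbert \<times> 'h) set \<Rightarrow> nat" where
  "kdim V = (LEAST n. \<exists>vs. length vs = n \<and> set vs \<subseteq> V \<and> V \<subseteq> kspan (set vs))"

definition gen_eigenspace :: "('h::chilbert \<times> 'h \<Rightarrow> 'h \<times> 'h) \<Rightarrow> complex \<Rightarrow> ('h \<times> 'h) set" where
  "gen_eigenspace T z = {x. \<exists>n. ((\<lambda>v. T v - kscale z v) ^^ n) x = 0}"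

text \<open>z is an isolated point of the spectrum whose Riesz projection
  P = (2 pi i)^{-1} \<ointegral>_{|\<zeta>-z|=r} (\<zeta> - T)^{-1} d\<zeta> (defined weakly) has finite rank.\<close>
definition riesz_finite :: "('h::chilbert \<times> 'h \<Rightarrow> 'h \<times> 'h) \<Rightarrow> complex \<Rightarrow> bool" where
  "riesz_finite T z \<longleftrightarrow> (\<exists>r>0. cball z r \<inter> kspec T = {z} \<and>
     (\<exists>P. kbounded P \<and>
        (\<forall>x y. kinner x (P y) =
           contour_integral (circlepath z r) (\<lambda>\<zeta>. kinner x (kres T \<zeta> y)) / (2 * of_real pi * \<i>))
        \<and> kfinite_dim (range P)))"

definition discrete_eigenvalue :: "('h::chilbert \<times> 'h \<Rightarrow> 'h \<times> 'h) \<Rightarrow> complex \<Rightarrow> bool" where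
  "discrete_eigenvalue T z \<longleftrightarrow> z \<in> kspec T \<and> (\<exists>x. x \<noteq> 0 \<and> T x = kscale z x) \<and> riesz_finite T z"

definition ess_S1_gapped :: "('h::chilbert \<times> 'h \<Rightarrow> 'h \<times> 'h) \<Rightarrow> bool" where
  "ess_S1_gapped T \<longleftrightarrow> (\<forall>z\<in>kspec T. cmod z = 1 \<longrightarrow> discrete_eigenvalue T z)"

definition annulus :: "real \<Rightarrow> complex set" where
  "annulus h = {z. exp (- h) \<le> cmod z \<and> cmod z \<le> exp h}"

definition sig_radius :: "('h::chilbert \<times> 'h \<Rightarrow> 'h \<times> 'h) \<Rightarrow> real \<Rightarrow> bool" where
  "sig_radius T h \<longleftrightarrow> h > 0 \<and> (\<forall>z \<in> kspec T \<inter> annulus h. discrete_eigenvalue T z)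
     \<and> (\<forall>z \<in> kspec T. cmod z \<noteq> exp h \<and> cmod z \<noteq> exp (- h))"

definition E_eq :: "('h::chilbert \<times> 'h \<Rightarrow> 'h \<times> 'h) \<Rightarrow> real \<Rightarrow> ('h \<times> 'h) set" where
  "E_eq T h = kspan (\<Union>z \<in> kspec T \<inter> annulus h. gen_eigenspace T z)"

text \<open>An isometry \<Phi> : C^n \<rightarrow> K onto E is given by the orthonormal basis es = (\<Phi> e_1, ..., \<Phi> e_n).\<close>
definition orthonormal_basis_of :: "('h::chilbert \<times> 'h) set \<Rightarrow> ('h \<times> 'h) list \<Rightarrow> bool" where
  "orthonormal_basis_of E es \<longleftrightarrow>
     (\<forall>i<length es. \<forall>j<length es. kinner (es ! i) (es ! j) = (if i = j then 1 else 0))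
     \<and> set es \<subseteq> E \<and> E \<subseteq> kspan (set es)"

definition gram_J :: "('h::chilbert \<times> 'h) list \<Rightarrow> complex mat" where
  "gram_J es = mat (length es) (length es) (\<lambda>(i, j). kinner (es ! i) (Jop (es ! j)))"

definition nu_pos :: "complex mat \<Rightarrow> nat" where
  "nu_pos M = (\<Sum>r \<in> {r. poly (char_poly M) r = 0 \<and> r \<in> \<real> \<and> Re r > 0}. order r (char_poly M))"

definition nu_neg :: "complex mat \<Rightarrow> nat" where
  "nu_neg M = (\<Sum>r \<in> {r. poly (char_poly M) r = 0 \<and> r \<in> \<real> \<and> Re r < 0}. order r (char_poly M))"

definition Sig_of :: "('h::chilbert \<times> 'h) list \<Rightarrow> int" where
  "Sig_of es = int (nu_pos (gram_J es)) - int (nu_neg (gram_J es))"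

definition blk_a :: "('h::chilbert \<times> 'h \<Rightarrow> 'h \<times> 'h) \<Rightarrow> 'h \<Rightarrow> 'h" where
  "blk_a T x = fst (T (x, 0))"
definition blk_b :: "('h::chilbert \<times> 'h \<Rightarrow> 'h \<times> 'h) \<Rightarrow> 'h \<Rightarrow> 'h" where
  "blk_b T y = fst (T (0, y))"
definition blk_c :: "('h::chilbert \<times> 'h \<Rightarrow> 'h \<times> 'h) \<Rightarrow> 'h \<Rightarrow> 'h" where
  "blk_c T x = snd (T (x, 0))"
definition blk_d :: "('h::chilbert \<times> 'h \<Rightarrow> 'h \<times> 'h) \<Rightarrow> 'h \<Rightarrow> 'h" where
  "blk_d T y = snd (T (0, y))"

definition hadj :: "('h::chilbert \<Rightarrow> 'h) \<Rightarrow> 'h \<Rightarrow> 'h" where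
  "hadj a = (THE s. \<forall>x y. cinner (s x) y = cinner x (a y))"

text \<open>V(e^{-it}T) = [[e^{-it}(a^*)^{-1}, b d^{-1}], [-d^{-1} c, e^{it} d^{-1}]].\<close>
definition Vpath :: "('h::chilbert \<times> 'h \<Rightarrow> 'h \<times> 'h) \<Rightarrow> real \<Rightarrow> 'h \<times> 'h \<Rightarrow> 'h \<times> 'h" where
  "Vpath T t p =
     (scaleC (exp (- \<i> * of_real t)) (inv_into UNIV (hadj (blk_a T)) (fst p)) + blk_b T (inv_into UNIV (blk_d T) (snd p)),
      - inv_into UNIV (blk_d T) (blk_c T (fst p)) + scaleC (exp (\<i> * of_real t)) (inv_into UNIV (blk_d T) (snd p)))"

definition arc_count :: "('h::chilbert \<times> 'h \<Rightarrow> 'h \<times> 'h) \<Rightarrow> real \<Rightarrow> real \<Rightarrow> nat" where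
  "arc_count T t \<epsilon> = kdim (kspan (\<Union>\<theta> \<in> {0<..<\<epsilon>}. gen_eigenspace (Vpath T t) (exp (\<i> * of_real \<theta>))))"

text \<open>Net number of eigenvalues crossing 1 counterclockwise at time t0
  (counterclockwise minus clockwise crossings).\<close>
definition crossing_index :: "('h::chilbert \<times> 'h \<Rightarrow> 'h \<times> 'h) \<Rightarrow> real \<Rightarrow> int" where
  "crossing_index T t0 = (THE k. eventually (\<lambda>\<epsilon>. eventually (\<lambda>\<delta>.
       int (arc_count T (t0 + \<delta>) \<epsilon>) - int (arc_count T (t0 - \<delta>) \<epsilon>) = k) (at_right 0)) (at_right 0))"

definition SF :: "('h::chilbert \<times> 'h \<Rightarrow> 'h \<times> 'h) \<Rightarrow> int" where
  "SF T = (\<Sum>t \<in> {t. 0 \<le> t \<and> t < 2 * pi \<and> (\<exists>x. x \<noteq> 0 \<and> Vpath T t x = x)}. crossing_index T t)"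

end

theory Submission
  imports Defs
begin

text \<open>Put $T_t = e^{-it}T$ and $V_t = V(T_t)$. If $T_t(x, y) = (x', y')$ then $V_t(x, y') = (x', y)$.
  Hence, with $v = (x, y')$ and $u = (x, y)$,
  $2(\cos\eta\,|v|^2 - \mathrm{Re}(e^{-i\eta}\langle v, V_t v\rangle)) = \cos\eta\,|T_t u - u|^2 + 2\sin\eta\; q_t(u)$
  where $q_t(u) = \mathrm{Im}\langle T_t u, J u\rangle$, and the negative index of the left-hand form is the number of
  eigenvalues of the unitary $V_t$ on the open arc from $1$ to $e^{2i\eta}$.

  Near an eigenvalue $e^{it_0}$ of $T$, the Riesz projection splits the space $J$-orthogonally into the generalized
  eigenspace $E$ and a complement on which $T_{t_0} - 1$ is bounded below; for small $\eta$ only $E$ contributes to the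
  index. On $E$, simultaneous diagonalization of $q_t$ and $|T_t u - u|^2$ shows that adding a large multiple of
  $|T_t u - u|^2$ to $q_t$ lowers its negative index by a number $n_0$ independent of $t \ne t_0$. Since $T_{t_0}$ is
  unipotent on $E$, the form $q_t$ deforms through nondegenerate forms to $J$ for $t > t_0$ and to $-J$ for $t < t_0$.
  The net crossing at $t_0$ is therefore the negative minus the positive index of $J$ on $E$.

  Generalized eigenspaces for $\lambda$ and $\mu$ are $J$-orthogonal unless $\bar\lambda\mu = 1$. The eigenvalues off
  the circle span a sum of two $J$-isotropic subspaces, which has signature $0$, so the signature is the sum of the
  signatures of the generalized eigenspaces on the circle.\<close>

text \<open>No eigenvalue branch of V_t is followed: counts on one short arc are compared on the two
  sides of t_0. Up to the factor 2 sin \<eta>, the counting form is q_t(u) + C |T_t u - u|^2 with C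
  = cos \<eta> / (2 sin \<eta>), so short arcs mean large C, and the arc is fixed before the time
  interval around t_0. The obstacle is that this form degenerates at t_0: the eigenvectors lie in
  its radical, so its index near t_0 cannot be read off at t_0. What does not degenerate is the
  companion q_t(u) + |G u|^2 / C on E, where G compresses J (1 + T_t) / (2i) to E. The identity
  q_t(u) = <T_t u - u, G u> binds the two forms, and at t_0 the map G is injective on E because
  T_{t_0} has only the eigenvalue 1 there. For large C the index of the companion at t_0 is that of
  q_{t_0}; this is n_0, which is stable on both sides of t_0 and cancels in the net crossing. The
  eigenvectors behind the indices come from a minimization argument for Hermitian forms, in place of
  a functional calculus for V_t.\<close>

instantiation prod :: (chilbert, chilbert) chilbert
begin

definition scaleC_prod :: "complex \<Rightarrow> 'a \<times> 'b \<Rightarrow> 'a \<times> 'b" where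
  "scaleC_prod c p = (scaleC c (fst p), scaleC c (snd p))"

definition cinner_prod :: "'a \<times> 'b \<Rightarrow> 'a \<times> 'b \<Rightarrow> complex" where
  "cinner_prod p q = cinner (fst p) (fst q) + cinner (snd p) (snd q)"

instance
proof
  fix x y z :: "'a \<times> 'b" and c d :: complex and r :: real
  show "scaleC c (x + y) = scaleC c x + scaleC c y"
    by (simp add: scaleC_prod_def scaleC_add_right)
  show "scaleC (c + d) x = scaleC c x + scaleC d x"
    by (simp add: scaleC_prod_def scaleC_add_left)
  show "scaleC c (scaleC d x) = scaleC (c * d) x"
    by (simp add: scaleC_prod_def scaleC_scaleC)
  show "scaleC 1 x = x" by (simp add: scaleC_prod_def scaleC_one)
  show "scaleR r x = scaleC (complex_of_real r) x"
    by (simp add: scaleC_prod_def scaleR_prod_def scaleR_scaleC)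
  show "cinner x (y + z) = cinner x y + cinner x z"
    by (simp add: cinner_prod_def cinner_add_right)
  show "cinner x (scaleC c y) = c * cinner x y"
    by (simp add: cinner_prod_def scaleC_prod_def cinner_scaleC_right algebra_simps)
  show "cinner y x = cnj (cinner x y)"
    by (simp add: cinner_prod_def cinner_commute[of "fst x"] cinner_commute[of "snd x"])
  show "cinner x x \<in> \<real>" by (simp add: cinner_prod_def cinner_self_real)
  show "0 \<le> Re (cinner x x)" by (simp add: cinner_prod_def cinner_self_nonneg)
  show "norm x = sqrt (Re (cinner x x))"
    by (simp add: norm_prod_def cinner_prod_def norm_cinner cinner_self_nonneg)
  show "x = 0" if "cinner x x = 0"
  proof -
    have "Re (cinner (fst x) (fst x)) = 0" "Re (cinner (snd x) (snd x)) = 0"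
      using that cinner_self_nonneg[of "fst x"] cinner_self_nonneg[of "snd x"]
      by (auto simp: cinner_prod_def complex_eq_iff)
    then have "cinner (fst x) (fst x) = 0" "cinner (snd x) (snd x) = 0"
      using cinner_self_real[of "fst x"] cinner_self_real[of "snd x"]
      by (auto simp: complex_is_Real_iff complex_eq_iff)
    then show ?thesis by (simp add: cinner_self_zero prod_eq_iff)
  qed
qed

end

section \<open>Complex-linear calculus of the inner product\<close>

lemma kscale_scaleC: "kscale = scaleC"
  by (intro ext) (simp add: kscale_def scaleC_prod_def)

lemma kinner_cinner: "kinner = cinner"
  by (intro ext) (simp add: kinner_def cinner_prod_def)

text \<open>Span, independence and subspaces have to be taken over the complex scalars; the notions
  that come with \<open>banach\<close> are the real ones and would double dimensions.\<close>

global_interpretation cvs: vector_space "scaleC :: complex \<Rightarrow> 'a::chilbert \<Rightarrow> 'a"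
  by unfold_locales (simp_all add: scaleC_add_right scaleC_add_left scaleC_scaleC scaleC_one)

lemma cinner_add_left: "cinner (x + y) z = cinner x z + cinner y (z::'a::chilbert)"
  by (subst (1 2 3) cinner_commute) (simp add: cinner_add_right)

lemma cinner_scaleC_left: "cinner (scaleC c x) (y::'a::chilbert) = cnj c * cinner x y"
  by (subst (1 2) cinner_commute) (simp add: cinner_scaleC_right)

lemma cinner_zero_right [simp]: "cinner x (0::'a::chilbert) = 0"
  using cinner_scaleC_right[of x 0 0] by simp

lemma cinner_zero_left [simp]: "cinner 0 (x::'a::chilbert) = 0"
  using cinner_scaleC_left[of 0 0 x] by simp

lemma cinner_minus_right: "cinner x (- y::'a::chilbert) = - cinner x y"
  using cinner_add_right[of x y "- y"] by (simp add: eq_neg_iff_add_eq_0 add.commute)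

lemma cinner_minus_left: "cinner (- x) (y::'a::chilbert) = - cinner x y"
  using cinner_add_left[of x "- x" y] by (simp add: eq_neg_iff_add_eq_0 add.commute)

lemma cinner_diff_right: "cinner x (y - z::'a::chilbert) = cinner x y - cinner x z"
  using cinner_add_right[of x y "- z"] by (simp add: cinner_minus_right)

lemma cinner_diff_left: "cinner (x - y) (z::'a::chilbert) = cinner x z - cinner y z"
  using cinner_add_left[of x "- y" z] by (simp add: cinner_minus_left)

lemma cinner_sum_right: "cinner x (\<Sum>i\<in>A. f i) = (\<Sum>i\<in>A. cinner x (f i::'a::chilbert))"
  by (induction A rule: infinite_finite_induct) (auto simp: cinner_add_right)

lemma cinner_sum_left: "cinner (\<Sum>i\<in>A. f i) x = (\<Sum>i\<in>A. cinner (f i::'a::chilbert) x)"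
  by (induction A rule: infinite_finite_induct) (auto simp: cinner_add_left)

lemmas cinner_simps = cinner_add_right cinner_add_left cinner_scaleC_right cinner_scaleC_left
  cinner_minus_right cinner_minus_left cinner_diff_right cinner_diff_left

lemma cinner_self: "cinner x (x::'a::chilbert) = of_real ((norm x)\<^sup>2)"
  using cinner_self_real[of x] cinner_self_nonneg[of x]
  by (simp add: norm_cinner complex_eq_iff complex_is_Real_iff)

lemma Re_cinner_self: "Re (cinner x (x::'a::chilbert)) = (norm x)\<^sup>2"
  by (simp add: cinner_self)

lemma cinner_scaleC_scaleC:
  "cinner (scaleC c x) (scaleC d (y::'a::chilbert)) = cnj c * d * cinner x y"
  by (simp only: cinner_scaleC_left cinner_scaleC_right mult_ac)

lemma norm_scaleC: "norm (scaleC c (x::'a::chilbert)) = cmod c * norm x"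
proof -
  have "cnj c * c = of_real ((cmod c)\<^sup>2)"
    using complex_norm_square[of c] by (simp add: mult.commute)
  then have "cinner (scaleC c x) (scaleC c x) = of_real ((cmod c)\<^sup>2) * of_real ((norm x)\<^sup>2)"
    by (metis cinner_scaleC_scaleC cinner_self)
  then have "Re (cinner (scaleC c x) (scaleC c x)) = (cmod c)\<^sup>2 * (norm x)\<^sup>2"
    by (metis Re_complex_of_real of_real_mult)
  then have "(norm (scaleC c x))\<^sup>2 = (cmod c * norm x)\<^sup>2"
    by (simp only: Re_cinner_self power_mult_distrib)
  then show ?thesis by (rule power2_eq_imp_eq) auto
qed

section \<open>Hermitian forms and orthonormal bases\<close>

text \<open>Relative to a set X because a form transported through the inverse of a map on a
  finite-dimensional space, as in \<open>cayley_index\<close>, is Hermitian only there.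
  Antilinearity in the first argument follows from the symmetry.\<close>

definition herm :: "'a::chilbert set \<Rightarrow> ('a \<Rightarrow> 'a \<Rightarrow> complex) \<Rightarrow> bool" where
  "herm X \<beta> \<longleftrightarrow> (\<forall>x\<in>X. \<forall>y\<in>X. \<forall>z\<in>X. \<beta> x (y + z) = \<beta> x y + \<beta> x z)
     \<and> (\<forall>c. \<forall>x\<in>X. \<forall>y\<in>X. \<beta> x (scaleC c y) = c * \<beta> x y)
     \<and> (\<forall>x\<in>X. \<forall>y\<in>X. \<beta> y x = cnj (\<beta> x y))"

lemma hermI:
  assumes "\<And>x y z. x \<in> X \<Longrightarrow> y \<in> X \<Longrightarrow> z \<in> X \<Longrightarrow> \<beta> x (y + z) = \<beta> x y + \<beta> x z"
    and "\<And>c x y. x \<in> X \<Longrightarrow> y \<in> X \<Longrightarrow> \<beta> x (scaleC c y) = c * \<beta> x y"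
    and "\<And>x y. x \<in> X \<Longrightarrow> y \<in> X \<Longrightarrow> \<beta> y x = cnj (\<beta> x y)"
  shows "herm X \<beta>"
  unfolding herm_def using assms by blast

lemma herm_subset: "herm X \<beta> \<Longrightarrow> Y \<subseteq> X \<Longrightarrow> herm Y \<beta>"
  unfolding herm_def by blast

lemma herm_cinner: "herm X cinner"
  by (rule hermI) (auto simp: cinner_simps intro: cinner_commute)

lemma
  assumes "herm X \<beta>"
  shows herm_add_right: "x \<in> X \<Longrightarrow> y \<in> X \<Longrightarrow> z \<in> X \<Longrightarrow> \<beta> x (y + z) = \<beta> x y + \<beta> x z"
    and herm_scale_right: "x \<in> X \<Longrightarrow> y \<in> X \<Longrightarrow> \<beta> x (scaleC c y) = c * \<beta> x y"
    and herm_sym: "x \<in> X \<Longrightarrow> y \<in> X \<Longrightarrow> \<beta> y x = cnj (\<beta> x y)"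
  using assms unfolding herm_def by blast+

lemma herm_add_left:
  assumes "herm X \<beta>" "cvs.subspace X" "x \<in> X" "y \<in> X" "z \<in> X"
  shows "\<beta> (x + y) z = \<beta> x z + \<beta> y z"
  using herm_sym[OF assms(1), of z "x + y"] herm_sym[OF assms(1), of z x]
    herm_sym[OF assms(1), of z y] herm_add_right[OF assms(1), of z x y] assms
  by (simp add: cvs.subspace_add)

lemma herm_scale_left:
  assumes "herm X \<beta>" "cvs.subspace X" "x \<in> X" "z \<in> X"
  shows "\<beta> (scaleC c x) z = cnj c * \<beta> x z"
  using herm_sym[OF assms(1), of z "scaleC c x"] herm_sym[OF assms(1), of z x]
     herm_scale_right[OF assms(1), of z x c] assms
  by (simp add: cvs.subspace_scale)

lemma herm_zero_right:
  assumes "herm X \<beta>" "cvs.subspace X" "x \<in> X"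
  shows "\<beta> x 0 = 0"
  using herm_scale_right[OF assms(1), of x x 0] assms by simp

lemma herm_minus_right:
  assumes "herm X \<beta>" "x \<in> X" "y \<in> X"
  shows "\<beta> x (- y) = - \<beta> x y"
  using herm_scale_right[OF assms(1), of x y "-1"] assms by simp

lemma herm_diff_right:
  assumes "herm X \<beta>" "cvs.subspace X" "x \<in> X" "y \<in> X" "z \<in> X"
  shows "\<beta> x (y - z) = \<beta> x y - \<beta> x z"
  using herm_add_right[OF assms(1), of x y "- z"] herm_minus_right[OF assms(1), of x z] assms
  by (simp add: cvs.subspace_neg)

lemma herm_diff_left:
  assumes "herm X \<beta>" "cvs.subspace X" "x \<in> X" "y \<in> X" "z \<in> X"
  shows "\<beta> (y - z) x = \<beta> y x - \<beta> z x"
  using herm_diff_right[OF assms] herm_sym[OF assms(1)] assms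
  by (metis (no_types, lifting) complex_cnj_diff cvs.subspace_diff)

lemma herm_sum_right:
  assumes "herm X \<beta>" "cvs.subspace X" "x \<in> X" "\<And>i. i \<in> A \<Longrightarrow> f i \<in> X"
  shows "\<beta> x (\<Sum>i\<in>A. f i) = (\<Sum>i\<in>A. \<beta> x (f i))"
  using assms(4)
proof (induction A rule: infinite_finite_induct)
  case (insert a A)
  have "sum f A \<in> X" using insert.prems assms(2) by (auto intro: cvs.subspace_sum)
  then show ?case using insert herm_add_right[OF assms(1,3), of "f a" "sum f A"] by simp
qed (auto simp: herm_zero_right[OF assms(1,2,3)])

lemma herm_sum_left:
  assumes "herm X \<beta>" "cvs.subspace X" "x \<in> X" "\<And>i. i \<in> A \<Longrightarrow> f i \<in> X"
  shows "\<beta> (\<Sum>i\<in>A. f i) x = (\<Sum>i\<in>A. \<beta> (f i) x)"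
proof -
  have "sum f A \<in> X" using assms by (auto intro: cvs.subspace_sum)
  then have "\<beta> (sum f A) x = cnj (\<beta> x (sum f A))" using herm_sym[OF assms(1,3)] by blast
  also have "\<dots> = (\<Sum>i\<in>A. cnj (\<beta> x (f i)))" by (simp add: herm_sum_right[OF assms])
  also have "\<dots> = (\<Sum>i\<in>A. \<beta> (f i) x)"
    using herm_sym[OF assms(1,3)] assms(4) by (intro sum.cong) auto
  finally show ?thesis .
qed

lemma herm_self_real:
  assumes "herm X \<beta>" "x \<in> X"
  shows "\<beta> x x = of_real (Re (\<beta> x x))"
proof -
  have "\<beta> x x = cnj (\<beta> x x)" using herm_sym[OF assms(1,2,2)] .
  then show ?thesis by (metis Reals_cnj_iff of_real_Re)
qed

lemma herm_quad_scale:
  assumes "herm X \<beta>" "cvs.subspace X" "x \<in> X"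
  shows "Re (\<beta> (scaleC c x) (scaleC c x)) = (cmod c)\<^sup>2 * Re (\<beta> x x)"
proof -
  have "\<beta> (scaleC c x) (scaleC c x) = (c * cnj c) * \<beta> x x"
    using assms by (simp add: herm_scale_left[OF assms(1,2)] herm_scale_right[OF assms(1)] cvs.subspace_scale)
  then show ?thesis by (simp add: complex_norm_square[symmetric] flip: of_real_power)
qed

lemma herm_quad_add:
  assumes "herm X \<beta>" "cvs.subspace X" "x \<in> X" "y \<in> X"
  shows "Re (\<beta> (x + y) (x + y)) = Re (\<beta> x x) + 2 * Re (\<beta> x y) + Re (\<beta> y y)"
proof -
  have "\<beta> (x + y) (x + y) = \<beta> x x + \<beta> x y + (\<beta> y x + \<beta> y y)"
    using assms by (simp add: herm_add_left[OF assms(1,2)] herm_add_right[OF assms(1)] cvs.subspace_add)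
  moreover have "Re (\<beta> y x) = Re (\<beta> x y)" using herm_sym[OF assms(1,3,4)] by simp
  ultimately show ?thesis by simp
qed

lemma herm_quad_expand:
  assumes "herm X \<beta>" "cvs.subspace X" "x \<in> X" "y \<in> X"
  shows "Re (\<beta> (x + scaleC c y) (x + scaleC c y))
     = Re (\<beta> x x) + 2 * Re (c * \<beta> x y) + (cmod c)\<^sup>2 * Re (\<beta> y y)"
  using herm_quad_add[OF assms(1-3) cvs.subspace_scale[OF assms(2,4)], of c]
    herm_quad_scale[OF assms(1,2,4), of c] herm_scale_right[OF assms(1,3,4), of c] by simp

lemma herm_cauchy_schwarz:
  assumes h: "herm X \<beta>" "cvs.subspace X" and pos: "\<And>x. x \<in> X \<Longrightarrow> 0 \<le> Re (\<beta> x x)"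
    and xy: "x \<in> X" "y \<in> X"
  shows "(cmod (\<beta> x y))\<^sup>2 \<le> Re (\<beta> x x) * Re (\<beta> y y)"
proof -
  let ?b = "\<beta> x y"
  \<comment> \<open>The multiplier conj (\<beta> x y) makes the cross term real, so a real parameter
    r suffices. The choice r = 1 / \<beta> y y gives the inequality; when \<beta> y y = 0, a large r
    forces \<beta> x y = 0.\<close>
  have *: "0 \<le> Re (\<beta> x x) - 2 * r * (cmod ?b)\<^sup>2 + r\<^sup>2 * (cmod ?b)\<^sup>2 * Re (\<beta> y y)" for r :: real
  proof -
    have "x + scaleC (of_real (- r) * cnj ?b) y \<in> X"
      by (intro cvs.subspace_add cvs.subspace_scale h xy)
    from pos[OF this] show ?thesis
      unfolding herm_quad_expand[OF h xy]
      by (simp add: norm_mult power_mult_distrib cmod_power2 power2_eq_square[of "Re ?b"]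
          power2_eq_square[of "Im ?b"] algebra_simps)
  qed
  show ?thesis
  proof (cases "Re (\<beta> y y) = 0")
    case True
    have "cmod ?b = 0"
    proof (rule ccontr)
      assume "cmod ?b \<noteq> 0"
      then have "(cmod ?b)\<^sup>2 > 0" by simp
      then show False
        using *[of "(Re (\<beta> x x) + 1) / (2 * (cmod ?b)\<^sup>2)"] True by simp
    qed
    then show ?thesis using True by simp
  next
    case False
    then have "Re (\<beta> y y) > 0" using pos[OF xy(2)] by simp
    then show ?thesis using *[of "1 / Re (\<beta> y y)"]
      by (simp add: field_simps power2_eq_square)
  qed
qed

lemma cinner_cauchy_schwarz: "cmod (cinner x y) \<le> norm x * norm (y::'a::chilbert)"
proof -
  have "(cmod (cinner x y))\<^sup>2 \<le> (norm x * norm y)\<^sup>2"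
    using herm_cauchy_schwarz[OF herm_cinner cvs.subspace_UNIV, of x y]
    by (simp add: Re_cinner_self power_mult_distrib)
  then show ?thesis by (rule power2_le_imp_le) simp
qed

lemma bounded_bilinear_cinner: "bounded_bilinear (cinner :: 'a::chilbert \<Rightarrow> 'a \<Rightarrow> complex)"
  by (rule bounded_bilinear.intro)
    (auto simp: cinner_simps scaleR_scaleC scaleR_conv_of_real cinner_cauchy_schwarz intro!: exI[of _ 1])

lemma bounded_bilinear_scaleC: "bounded_bilinear (scaleC :: complex \<Rightarrow> 'a::chilbert \<Rightarrow> 'a)"
  by (rule bounded_bilinear.intro)
    (auto simp: cvs.scale_right_distrib cvs.scale_left_distrib scaleR_scaleC scaleR_conv_of_real
      mult.commute norm_scaleC intro!: exI[of _ 1])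

lemmas tendsto_scaleC = bounded_bilinear.tendsto[OF bounded_bilinear_scaleC]

section \<open>Orthonormal bases and finite-dimensional subspaces\<close>

definition orthonormal :: "'a::chilbert set \<Rightarrow> bool" where
  "orthonormal B \<longleftrightarrow> (\<forall>x\<in>B. \<forall>y\<in>B. cinner x y = (if x = y then 1 else 0))"

lemma orthonormal_coeff:
  assumes "orthonormal B" "finite B" "b \<in> B"
  shows "cinner b (\<Sum>a\<in>B. scaleC (c a) a) = c b"
proof -
  have "cinner b (\<Sum>a\<in>B. scaleC (c a) a) = (\<Sum>a\<in>B. if a = b then c a else 0)"
    unfolding cinner_sum_right
    using assms by (intro sum.cong) (auto simp: orthonormal_def cinner_simps)
  then show ?thesis using assms by simp
qed

lemma orthonormal_expand:
  assumes "orthonormal B" "finite B" "x \<in> cvs.span B"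
  shows "x = (\<Sum>b\<in>B. scaleC (cinner b x) b)"
proof -
  obtain c where x: "x = (\<Sum>b\<in>B. scaleC (c b) b)"
    using assms(3) by (auto simp: cvs.span_finite[OF assms(2)])
  then show ?thesis
    using orthonormal_coeff[OF assms(1,2)] by (metis (no_types, lifting) sum.cong)
qed

lemma orthonormal_independent:
  assumes "orthonormal B" "finite B"
  shows "cvs.independent B"
  unfolding cvs.independent_explicit_finite_subsets
proof (intro allI impI ballI)
  fix S u v assume "S \<subseteq> B" "finite S" and s: "(\<Sum>v\<in>S. scaleC (u v) v) = 0" and v: "v \<in> S"
  then have "orthonormal S" using assms unfolding orthonormal_def by blast
  from orthonormal_coeff[OF this \<open>finite S\<close> v, of u] s show "u v = 0" by simp
qed

definition onb :: "'a::chilbert set \<Rightarrow> 'a set \<Rightarrow> bool" where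
  "onb B X \<longleftrightarrow> finite B \<and> orthonormal B \<and> cvs.span B = X"

lemma onb_expand: "onb B X \<Longrightarrow> x \<in> X \<Longrightarrow> x = (\<Sum>b\<in>B. scaleC (cinner b x) b)"
  unfolding onb_def using orthonormal_expand by blast

lemma onb_parseval:
  assumes "onb B X" "x \<in> X"
  shows "(norm x)\<^sup>2 = (\<Sum>b\<in>B. (cmod (cinner b x))\<^sup>2)"
proof -
  have "cinner x x = cinner x (\<Sum>b\<in>B. scaleC (cinner b x) b)"
    using onb_expand[OF assms] by simp
  also have "\<dots> = (\<Sum>b\<in>B. cinner b x * cnj (cinner b x))"
    by (simp add: cinner_sum_right cinner_simps flip: cinner_commute)
  also have "\<dots> = of_real (\<Sum>b\<in>B. (cmod (cinner b x))\<^sup>2)"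
    by (simp only: complex_norm_square of_real_sum)
  finally show ?thesis by (metis Re_cinner_self Re_complex_of_real)
qed

definition fin_dim :: "'a::chilbert set \<Rightarrow> bool" where
  "fin_dim X \<longleftrightarrow> (\<exists>S. finite S \<and> X \<subseteq> cvs.span S)"

lemma fin_dim_subset: "fin_dim X \<Longrightarrow> Y \<subseteq> X \<Longrightarrow> fin_dim Y"
  unfolding fin_dim_def by blast

lemma onb_fin_dim: "onb B X \<Longrightarrow> fin_dim X"
  unfolding onb_def fin_dim_def by blast

text \<open>Gram-Schmidt: the residual of the new vector is normalised and added, or dropped when it
  vanishes.\<close>

lemma onb_span_exists:
  assumes "finite S"
  shows "\<exists>B. onb B (cvs.span S)"
  using assms
proof (induction S)
  case empty
  show ?case by (rule exI[of _ "{}"]) (auto simp: onb_def orthonormal_def)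
next
  case (insert a S)
  then obtain B where B: "finite B" "orthonormal B" "cvs.span B = cvs.span S"
    unfolding onb_def by blast
  define p where "p = (\<Sum>b\<in>B. scaleC (cinner b a) b)"
  define r where "r = a - p"
  have p: "p \<in> cvs.span S" unfolding p_def B(3)[symmetric]
    by (auto intro: cvs.span_sum cvs.span_scale cvs.span_base)
  have orth: "cinner b r = 0" if "b \<in> B" for b
    unfolding r_def p_def by (simp add: cinner_simps orthonormal_coeff[OF B(2,1) that])
  show ?case
  proof (cases "r = 0")
    case True
    then have "a \<in> cvs.span S" using p by (simp add: r_def)
    then have "onb B (cvs.span (insert a S))" using B by (simp add: onb_def cvs.span_redundant)
    then show ?thesis by blast
  next
    case False
    define e where "e = scaleC (of_real (1 / norm r)) r"
    have ee: "cinner e e = 1"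
      unfolding e_def cinner_scaleC_scaleC cinner_self[of r]
      using False by (simp add: power2_eq_square)
    have eB: "cinner b e = 0" if "b \<in> B" for b
      using orth[OF that] by (simp add: e_def cinner_simps)
    have eB': "cinner e b = 0" if "b \<in> B" for b
      using eB[OF that] cinner_commute[of e b] by simp
    have "orthonormal (insert e B)"
      using ee eB eB' B(2) unfolding orthonormal_def by auto
    moreover have "cvs.span (insert e B) = cvs.span (insert a S)"
    proof
      have "r \<in> cvs.span (insert a S)" unfolding r_def
        using p by (meson cvs.span_base cvs.span_diff cvs.span_mono insertI1 subset_insertI subsetD)
      then have "e \<in> cvs.span (insert a S)" unfolding e_def by (rule cvs.span_scale)
      moreover have "B \<subseteq> cvs.span (insert a S)"
        using B(3) cvs.span_superset[of B] cvs.span_mono[of S "insert a S"] by blast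
      ultimately show "cvs.span (insert e B) \<subseteq> cvs.span (insert a S)"
        by (intro cvs.span_minimal) auto
      have "scaleC (of_real (norm r)) e = r" using False by (simp add: e_def)
      then have "r \<in> cvs.span (insert e B)"
        by (metis cvs.span_base cvs.span_scale insertI1)
      moreover have pp: "p \<in> cvs.span (insert e B)"
        using p B(3) cvs.span_mono[of B "insert e B"] by blast
      ultimately have "r + p \<in> cvs.span (insert e B)" by (rule cvs.span_add)
      then have "a \<in> cvs.span (insert e B)" by (simp add: r_def)
      moreover have "S \<subseteq> cvs.span (insert e B)"
        using B(3) cvs.span_superset[of S] cvs.span_mono[of B "insert e B"] by blast
      ultimately show "cvs.span (insert a S) \<subseteq> cvs.span (insert e B)"
        by (intro cvs.span_minimal) auto
    qed
    ultimately have "onb (insert e B) (cvs.span (insert a S))" using B(1) by (simp add: onb_def)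
    then show ?thesis by blast
  qed
qed

lemma fin_dim_basis:
  assumes "fin_dim X" "cvs.subspace X"
  obtains B where "finite B" "cvs.independent B" "cvs.span B = X"
proof -
  obtain B where B: "B \<subseteq> X" "cvs.independent B" "X \<subseteq> cvs.span B"
    using cvs.maximal_independent_subset[of X] by blast
  obtain S where S: "finite S" "X \<subseteq> cvs.span S" using assms(1) unfolding fin_dim_def by blast
  have "finite B" using cvs.independent_span_bound[OF S(1) B(2)] B(1) S(2) by blast
  moreover have "cvs.span B = X" by (rule cvs.span_subspace[OF B(1,3) assms(2)])
  ultimately show ?thesis using that B(2) by blast
qed

lemma fin_dim_onb:
  assumes "fin_dim X" "cvs.subspace X"
  obtains B where "onb B X"
  using fin_dim_basis[OF assms] onb_span_exists by metis

lemma common_convergent_subsequence: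
  fixes c :: "nat \<Rightarrow> 'b \<Rightarrow> complex"
  assumes "finite B" "\<And>b n. b \<in> B \<Longrightarrow> cmod (c n b) \<le> M"
  shows "\<exists>l s. strict_mono s \<and> (\<forall>b\<in>B. (\<lambda>n. c (s n) b) \<longlonglongrightarrow> l b)"
  using assms
proof (induction B)
  case empty
  show ?case using strict_mono_id by auto
next
  case (insert a B)
  then obtain l s where s: "strict_mono s" "\<And>b. b \<in> B \<Longrightarrow> (\<lambda>n. c (s n) b) \<longlonglongrightarrow> l b" by (meson insert_iff)
  have "bounded (range (\<lambda>n. c (s n) a))" using insert.prems by (auto simp: bounded_iff)
  then obtain la t where t: "strict_mono t" "((\<lambda>n. c (s n) a) \<circ> t) \<longlonglongrightarrow> la"
    using bounded_imp_convergent_subsequence by blast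
  show ?case
  proof (intro exI conjI ballI)
    show "strict_mono (s \<circ> t)" using s(1) t(1) by (rule strict_mono_o)
    fix b assume "b \<in> insert a B"
    then show "(\<lambda>n. c ((s \<circ> t) n) b) \<longlonglongrightarrow> (if b = a then la else l b)"
      using t(2) LIMSEQ_subseq_LIMSEQ[OF s(2) t(1), of b] insert.hyps by (auto simp: o_def)
  qed
qed

text \<open>Bolzano-Weierstrass for the coefficients in an orthonormal basis; the limit stays in X
  as a combination of the same basis.\<close>

lemma fin_dim_bounded_subsequence:
  assumes "fin_dim X" "cvs.subspace X" "\<And>n. x n \<in> X" "\<And>n. norm (x n) \<le> M"
  obtains l s where "l \<in> X" "strict_mono (s::nat \<Rightarrow> nat)" "(\<lambda>n. x (s n)) \<longlonglongrightarrow> l"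
proof -
  obtain B where B: "onb B X" using fin_dim_onb[OF assms(1,2)] .
  then have "finite B" and on: "orthonormal B" unfolding onb_def by auto
  have "norm b = 1" if "b \<in> B" for b
    using on that cinner_self[of b] unfolding orthonormal_def
    by (metis norm_cinner one_complex.sel(1) real_sqrt_one)
  then have "cmod (cinner b (x n)) \<le> M" if "b \<in> B" for b n
    using cinner_cauchy_schwarz[of b "x n"] assms(4)[of n] that by simp
  from common_convergent_subsequence[OF \<open>finite B\<close>, of "\<lambda>n b. cinner b (x n)", OF this]
  obtain l s where s: "strict_mono s" "\<And>b. b \<in> B \<Longrightarrow> (\<lambda>n. cinner b (x (s n))) \<longlonglongrightarrow> l b" by blast
  have "(\<lambda>n. \<Sum>b\<in>B. scaleC (cinner b (x (s n))) b) \<longlonglongrightarrow> (\<Sum>b\<in>B. scaleC (l b) b)"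
    using s(2) by (intro tendsto_sum tendsto_scaleC) auto
  moreover have "(\<Sum>b\<in>B. scaleC (cinner b (x (s n))) b) = x (s n)" for n
    using onb_expand[OF B assms(3)] by simp
  moreover have "(\<Sum>b\<in>B. scaleC (l b) b) \<in> X"
    using B unfolding onb_def by (auto intro: cvs.span_sum cvs.span_scale cvs.span_base)
  ultimately show ?thesis using that s(1) by simp
qed

lemma fin_dim_closed:
  assumes "fin_dim X" "cvs.subspace X"
  shows "closed X"
  unfolding closed_sequential_limits
proof (intro allI impI, elim conjE)
  fix x l assume x: "\<forall>n. x n \<in> X" and l: "x \<longlonglongrightarrow> l"
  have "Bseq x" using l convergentI convergent_imp_Bseq by blast
  then obtain M where M: "\<And>n. norm (x n) \<le> M" using BseqE by blast
  obtain l' s where l': "l' \<in> X" "strict_mono s" "(\<lambda>n. x (s n)) \<longlonglongrightarrow> l'"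
    using fin_dim_bounded_subsequence[OF assms, of x] x M by metis
  from LIMSEQ_subseq_LIMSEQ[OF l l'(2)] l'(3) have "l = l'"
    using LIMSEQ_unique by (auto simp: o_def)
  then show "l \<in> X" using l' by simp
qed

definition herm_bounded :: "'a::chilbert set \<Rightarrow> ('a \<Rightarrow> 'a \<Rightarrow> complex) \<Rightarrow> real \<Rightarrow> bool" where
  "herm_bounded Y \<beta> M \<longleftrightarrow> (\<forall>x\<in>Y. \<forall>y\<in>Y. cmod (\<beta> x y) \<le> M * norm x * norm y)"

lemma herm_shift:
  assumes "herm Y \<beta>"
  shows "herm Y (\<lambda>x y. \<beta> x y - of_real \<mu> * cinner x y)"
proof (rule hermI)
  fix x y assume "x \<in> Y" "y \<in> Y"
  then show "\<beta> y x - of_real \<mu> * cinner y x = cnj (\<beta> x y - of_real \<mu> * cinner x y)"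
    using herm_sym[OF assms, of x y] cinner_commute[of x y] by simp
qed (simp_all add: herm_add_right[OF assms] herm_scale_right[OF assms] cinner_simps algebra_simps)

lemma herm_bounded_shift:
  assumes "herm_bounded Y \<beta> M"
  shows "herm_bounded Y (\<lambda>x y. \<beta> x y - of_real \<mu> * cinner x y) (M + \<bar>\<mu>\<bar>)"
  unfolding herm_bounded_def
proof (intro ballI)
  fix x y assume xy: "x \<in> Y" "y \<in> Y"
  have "cmod (\<beta> x y - of_real \<mu> * cinner x y) \<le> cmod (\<beta> x y) + \<bar>\<mu>\<bar> * cmod (cinner x y)"
    using norm_triangle_ineq4[of "\<beta> x y" "of_real \<mu> * cinner x y"] by (simp add: norm_mult)
  also have "\<dots> \<le> M * norm x * norm y + \<bar>\<mu>\<bar> * (norm x * norm y)"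
    using assms xy by (intro add_mono mult_left_mono cinner_cauchy_schwarz) (auto simp: herm_bounded_def)
  finally show "cmod (\<beta> x y - of_real \<mu> * cinner x y) \<le> (M + \<bar>\<mu>\<bar>) * norm x * norm y"
    by (simp add: algebra_simps)
qed

section \<open>Spectral decomposition of forms with finite negative part\<close>

text \<open>Nonnegativity on a finite-codimensional subspace makes a minimizing sequence converge: its finite-dimensional
  components have a convergent subsequence, and the form minus its infimum is coercive on the rest.\<close>
lemma minimizer_exists:
  fixes \<beta> :: "'a::chilbert \<Rightarrow> 'a \<Rightarrow> complex"
  assumes h: "herm Y \<beta>" and Y: "cvs.subspace Y" and bd: "herm_bounded Y \<beta> M"
    and X: "cvs.subspace X" "X \<subseteq> Y" "closed X"
    and E: "cvs.subspace E" "E \<subseteq> Y" "fin_dim E"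
    and F: "cvs.subspace F" "F \<subseteq> Y"
    and dec: "\<And>x. x \<in> X \<Longrightarrow> \<exists>e\<in>E. \<exists>f\<in>F. x = e + f \<and> norm e \<le> C * norm x"
    and pos: "\<And>f. f \<in> F \<Longrightarrow> 0 \<le> Re (\<beta> f f)"
    and neg: "x0 \<in> X" "Re (\<beta> x0 x0) < 0"
  shows "\<exists>u\<in>X. \<exists>\<mu><0. norm u = 1 \<and> (\<forall>v\<in>X. \<beta> u v = of_real \<mu> * cinner u v)"
proof -
  define S where "S = {Re (\<beta> x x) |x. x \<in> X \<and> norm x = 1}"
  have lower: "- M \<le> s" if "s \<in> S" for s
  proof -
    from that obtain x where x: "x \<in> X" "norm x = 1" "s = Re (\<beta> x x)" by (auto simp: S_def)
    then have "cmod (\<beta> x x) \<le> M" using bd X unfolding herm_bounded_def by force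
    then show ?thesis using x(3) abs_Re_le_cmod[of "\<beta> x x"] by linarith
  qed
  have bbS: "bdd_below S" using lower by (rule bdd_belowI)
  have x00: "x0 \<noteq> 0" using neg herm_zero_right[OF h Y, of 0] cvs.subspace_0[OF Y] by auto
  define x1 where "x1 = scaleC (of_real (1 / norm x0)) x0"
  have x1: "x1 \<in> X" "norm x1 = 1"
    using x00 neg X by (auto simp: x1_def norm_scaleC norm_divide intro!: cvs.subspace_scale)
  have x1S: "Re (\<beta> x1 x1) \<in> S" using x1 by (auto simp: S_def)
  have "Re (\<beta> x1 x1) < 0"
    using herm_quad_scale[OF h Y subsetD[OF X(2) neg(1)], of "of_real (1 / norm x0)"] neg x00
    by (simp add: x1_def norm_divide mult_pos_neg del: power_divide power_one_over)
  define \<mu> where "\<mu> = Inf S"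
  have "\<mu> \<le> Re (\<beta> x1 x1)" unfolding \<mu>_def by (rule cInf_lower[OF x1S bbS])
  then have mu0: "\<mu> < 0" using \<open>Re (\<beta> x1 x1) < 0\<close> by simp
  have ge: "\<mu> * (norm x)\<^sup>2 \<le> Re (\<beta> x x)" if "x \<in> X" for x
  proof (cases "x = 0")
    case True then show ?thesis using herm_zero_right[OF h Y, of 0] cvs.subspace_0[OF Y] by simp
  next
    case False
    let ?y = "scaleC (of_real (1 / norm x)) x"
    have "?y \<in> X" "norm ?y = 1" using that False X by (auto simp: norm_scaleC norm_divide intro!: cvs.subspace_scale)
    then have "Re (\<beta> ?y ?y) \<in> S" by (auto simp: S_def)
    then have "\<mu> \<le> Re (\<beta> ?y ?y)" unfolding \<mu>_def by (rule cInf_lower[OF _ bbS])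
    also have "\<dots> = Re (\<beta> x x) / (norm x)\<^sup>2"
      using herm_quad_scale[OF h Y, of x "of_real (1 / norm x)"] that X by (auto simp: norm_divide power_divide)
    finally show ?thesis using False by (simp add: pos_le_divide_eq)
  qed
  \<comment> \<open>The form minus its infimum on the unit sphere of X. It is positive semidefinite
    on X, and on F it dominates |\<mu>| times the squared norm because the original form is
    nonnegative there.\<close>
  define \<gamma> where "\<gamma> = (\<lambda>x y. \<beta> x y - of_real \<mu> * cinner x y)"
  define K where "K = M + \<bar>\<mu>\<bar>"
  have g: "herm Y \<gamma>" unfolding \<gamma>_def by (rule herm_shift[OF h])
  have gX: "herm X \<gamma>" using g X(2) by (rule herm_subset)
  have gb: "cmod (\<gamma> x y) \<le> K * norm x * norm y" if "x \<in> Y" "y \<in> Y" for x y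
    using herm_bounded_shift[OF bd, of \<mu>] that unfolding herm_bounded_def \<gamma>_def K_def by blast
  have gself: "Re (\<gamma> x x) = Re (\<beta> x x) - \<mu> * (norm x)\<^sup>2" for x
    unfolding \<gamma>_def by (simp add: cinner_self)
  have gpos: "0 \<le> Re (\<gamma> x x)" if "x \<in> X" for x using ge[OF that] by (simp add: gself)
  have "\<exists>u\<in>X. norm u = 1 \<and> Re (\<gamma> u u) < 1 / real (Suc n)" for n
  proof -
    have "\<exists>s\<in>S. s < \<mu> + 1 / real (Suc n)"
      using x1S bbS cInf_less_iff[of S "\<mu> + 1 / real (Suc n)"] unfolding \<mu>_def by auto
    then show ?thesis by (auto simp: S_def gself)
  qed
  then obtain u where u: "\<And>n. u n \<in> X" "\<And>n. norm (u n) = 1" "\<And>n. Re (\<gamma> (u n) (u n)) < 1 / real (Suc n)"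
    by metis
  have K0: "0 \<le> K"
    using gb[of "u 0" "u 0"] u(1)[of 0] u(2)[of 0] X(2) order_trans[OF norm_ge_zero] by fastforce
  obtain e f where ef: "\<And>n. e n \<in> E" "\<And>n. f n \<in> F" "\<And>n. u n = e n + f n" "\<And>n. norm (e n) \<le> C"
    using dec[OF u(1)] u(2) by (metis mult.right_neutral)
  obtain l s where l: "strict_mono s" "(\<lambda>n. e (s n)) \<longlonglongrightarrow> l"
    using fin_dim_bounded_subsequence[OF E(3,1), of e C] ef by metis
  define a where "a n = 1 / real (Suc (s n))" for n
  have a0: "a \<longlonglongrightarrow> 0"
    using LIMSEQ_subseq_LIMSEQ[OF LIMSEQ_Suc[OF lim_const_over_n[of 1]] l(1)]
    by (simp add: o_def a_def[abs_def])
  \<comment> \<open>With df = du - de, coercivity on F bounds df by \<open>\<gamma>\<close> df df.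
    The part \<open>\<gamma>\<close> du du is small by the parallelogram law along the minimizing
    sequence, and every other term carries the factor de: the cross term gives 2 K 2 |de| since |du|
    is at most 2, the last term K 2C |de|.\<close>
  have est: "\<bar>\<mu>\<bar> * (norm (f (s n) - f (s m)))\<^sup>2 \<le> 2 * (a n + a m) + K * (4 + 2 * C) * norm (e (s n) - e (s m))" for n m
  proof -
    define du where "du = u (s n) - u (s m)"
    define de where "de = e (s n) - e (s m)"
    define df where "df = f (s n) - f (s m)"
    have dfeq: "df = du - de" using ef(3) by (simp add: df_def du_def de_def)
    have mem: "du \<in> X" "de \<in> E" "df \<in> F"
      using u ef X E F by (auto simp: du_def de_def df_def intro: cvs.subspace_diff)
    then have memY: "du \<in> Y" "de \<in> Y" "df \<in> Y" using X E F by auto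
    have memu: "u (s n) \<in> X" "u (s m) \<in> X" using u by auto
    have "Re (\<gamma> df df) = Re (\<gamma> du du) + 2 * Re (\<gamma> du (- de)) + Re (\<gamma> (- de) (- de))"
      unfolding dfeq diff_conv_add_uminus
      by (rule herm_quad_add[OF g Y memY(1)]) (simp add: cvs.subspace_neg[OF Y] memY)
    moreover have "Re (\<gamma> du (- de)) \<le> K * 2 * norm de"
    proof -
      have "norm du \<le> 2" using norm_triangle_ineq4[of "u (s n)" "u (s m)"] u(2) by (simp add: du_def)

      have "cmod (\<gamma> du (- de)) \<le> K * norm du * norm de"
        using gb[of du "- de"] memY by (simp add: cvs.subspace_neg[OF Y])
      also have "\<dots> \<le> K * 2 * norm de"
        using K0 \<open>norm du \<le> 2\<close> by (intro mult_right_mono mult_left_mono) auto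
      finally show ?thesis using complex_Re_le_cmod[of "\<gamma> du (- de)"] by linarith
    qed
    moreover have "Re (\<gamma> (- de) (- de)) \<le> K * (2 * C) * norm de"
    proof -
      have "norm de \<le> 2 * C"
        using norm_triangle_ineq4[of "e (s n)" "e (s m)"] ef(4)[of "s n"] ef(4)[of "s m"] by (simp add: de_def)
      have "cmod (\<gamma> (- de) (- de)) \<le> K * norm de * norm de"
        using gb[of "- de" "- de"] memY by (simp add: cvs.subspace_neg[OF Y])
      also have "\<dots> \<le> K * (2 * C) * norm de"
        using K0 \<open>norm de \<le> 2 * C\<close> by (intro mult_right_mono mult_left_mono) auto
      finally show ?thesis using complex_Re_le_cmod[of "\<gamma> (- de) (- de)"] by linarith
    qed
    moreover have "Re (\<gamma> du du) \<le> 2 * (a n + a m)"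
    proof -
      have memmu: "- u (s m) \<in> X" using memu X by (simp add: cvs.subspace_neg)
      have "0 \<le> Re (\<gamma> (u (s n) + u (s m)) (u (s n) + u (s m)))"
        using gpos memu X by (simp add: cvs.subspace_add)
      moreover have "Re (\<gamma> (u (s n) + u (s m)) (u (s n) + u (s m)))
          = Re (\<gamma> (u (s n)) (u (s n))) + 2 * Re (\<gamma> (u (s n)) (u (s m))) + Re (\<gamma> (u (s m)) (u (s m)))"
        by (rule herm_quad_add[OF gX X(1) memu])
      moreover have "Re (\<gamma> du du) = Re (\<gamma> (u (s n)) (u (s n))) + 2 * Re (\<gamma> (u (s n)) (- u (s m)))
          + Re (\<gamma> (- u (s m)) (- u (s m)))"
        unfolding du_def diff_conv_add_uminus by (rule herm_quad_add[OF gX X(1) memu(1) memmu])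
      moreover have "\<gamma> (u (s n)) (- u (s m)) = - \<gamma> (u (s n)) (u (s m))"
        by (rule herm_minus_right[OF gX memu])
      moreover have "Re (\<gamma> (- u (s m)) (- u (s m))) = Re (\<gamma> (u (s m)) (u (s m)))"
        using herm_quad_scale[OF gX X(1) memu(2), of "- 1"] by simp
      moreover have "Re (\<gamma> (u (s n)) (u (s n))) \<le> a n" "Re (\<gamma> (u (s m)) (u (s m))) \<le> a m"
        using u(3)[of "s n"] u(3)[of "s m"] by (simp_all add: a_def)
      ultimately show ?thesis by simp
    qed
    ultimately have "Re (\<gamma> df df) \<le> 2 * (a n + a m) + K * (4 + 2 * C) * norm de"
      by (simp add: algebra_simps)
    moreover have "\<bar>\<mu>\<bar> * (norm df)\<^sup>2 \<le> Re (\<gamma> df df)"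
      using pos[OF mem(3)] mu0 by (simp add: gself)
    ultimately show ?thesis by (simp add: df_def de_def)
  qed
  have "Cauchy (\<lambda>n. f (s n))"
  proof (rule CauchyI)
    fix \<epsilon> :: real assume "0 < \<epsilon>"
    define \<eta> where "\<eta> = \<bar>\<mu>\<bar> * \<epsilon>\<^sup>2"
    have "0 < \<eta>" unfolding \<eta>_def using mu0 \<open>0 < \<epsilon>\<close> by (intro mult_pos_pos) auto
    define L where "L = \<bar>K * (4 + 2 * C)\<bar> + 1"
    have L0: "0 < L" by (simp add: L_def)
    have "Cauchy (\<lambda>n. e (s n))" using l(2) by (rule LIMSEQ_imp_Cauchy)
    moreover have "0 < \<eta> / (2 * L)" using \<open>0 < \<eta>\<close> by (simp add: L_def)
    ultimately obtain N1 where N1: "\<And>n m. n \<ge> N1 \<Longrightarrow> m \<ge> N1 \<Longrightarrow> norm (e (s n) - e (s m)) < \<eta> / (2 * L)"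
      using CauchyD by blast
    obtain N2 where N2: "\<And>n. n \<ge> N2 \<Longrightarrow> \<bar>a n\<bar> < \<eta> / 8"
      using LIMSEQ_D[OF a0, of "\<eta> / 8"] \<open>0 < \<eta>\<close> by auto
    show "\<exists>N. \<forall>m\<ge>N. \<forall>n\<ge>N. norm (f (s m) - f (s n)) < \<epsilon>"
    proof (intro exI allI impI)
      fix m n assume "m \<ge> max N1 N2" "n \<ge> max N1 N2"
      then have d: "norm (e (s m) - e (s n)) < \<eta> / (2 * L)" "a m < \<eta> / 8" "a n < \<eta> / 8"
        using N1[of m n] N2[of m] N2[of n] by auto
      have "K * (4 + 2 * C) * norm (e (s m) - e (s n)) \<le> L * norm (e (s m) - e (s n))"
        by (rule mult_right_mono) (auto simp: L_def)
      also have "\<dots> \<le> L * (\<eta> / (2 * L))" using d(1) by (intro mult_left_mono) (auto simp: L_def)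
      also have "\<dots> = \<eta> / 2" using L0 by simp
      finally have "\<bar>\<mu>\<bar> * (norm (f (s m) - f (s n)))\<^sup>2 < \<eta>"
        using est[of m n] d by argo
      then have "(norm (f (s m) - f (s n)))\<^sup>2 < \<epsilon>\<^sup>2" using mu0 by (simp add: \<eta>_def)
      then show "norm (f (s m) - f (s n)) < \<epsilon>" using \<open>0 < \<epsilon>\<close> by (simp add: power_less_imp_less_base)
    qed
  qed
  then obtain k where k: "(\<lambda>n. f (s n)) \<longlonglongrightarrow> k" using Cauchy_convergent_iff convergent_def by blast
  define w where "w = l + k"
  have w: "(\<lambda>n. u (s n)) \<longlonglongrightarrow> w"
    unfolding w_def ef(3) by (rule tendsto_add[OF l(2) k])
  have wX: "w \<in> X" using closed_sequentially[OF X(3) _ w] u(1) by blast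
  have "(\<lambda>n. norm (u (s n))) \<longlonglongrightarrow> norm w" using w by (rule tendsto_norm)
  then have w1: "norm w = 1" using u(2) LIMSEQ_unique[OF _ tendsto_const] by fastforce
  \<comment> \<open>Cauchy-Schwarz for the semidefinite form \<open>\<gamma>\<close> turns the
    convergence of \<open>\<gamma>\<close> (u n) (u n) to 0 into vanishing against every v, which is
    the eigenvector equation in weak form.\<close>
  have "\<gamma> w v = 0" if v: "v \<in> X" for v
  proof -
    have "cmod (\<gamma> w v) \<le> K * norm (w - u (s n)) * norm v + sqrt (a n * Re (\<gamma> v v))" for n
    proof -
      have "\<gamma> (w - u (s n)) v = \<gamma> w v - \<gamma> (u (s n)) v"
        using herm_diff_left[OF gX X(1) v wX u(1)] .
      then have "cmod (\<gamma> w v) \<le> cmod (\<gamma> (w - u (s n)) v) + cmod (\<gamma> (u (s n)) v)"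
        by (metis add.commute diff_add_cancel norm_triangle_ineq)
      moreover have "cmod (\<gamma> (w - u (s n)) v) \<le> K * norm (w - u (s n)) * norm v"
        using X wX u(1) v by (intro gb) (auto intro!: cvs.subspace_diff Y)
      moreover have "cmod (\<gamma> (u (s n)) v) \<le> sqrt (a n * Re (\<gamma> v v))"
      proof (rule real_le_rsqrt)
        have "(cmod (\<gamma> (u (s n)) v))\<^sup>2 \<le> Re (\<gamma> (u (s n)) (u (s n))) * Re (\<gamma> v v)"
          by (rule herm_cauchy_schwarz[OF gX X(1) gpos u(1) v])
        also have "\<dots> \<le> a n * Re (\<gamma> v v)"
          using u(3)[of "s n"] gpos[OF v] by (intro mult_right_mono) (auto simp: a_def)
        finally show "(cmod (\<gamma> (u (s n)) v))\<^sup>2 \<le> a n * Re (\<gamma> v v)" .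
      qed
      ultimately show ?thesis by linarith
    qed
    moreover have "(\<lambda>n. K * norm (w - u (s n)) * norm v + sqrt (a n * Re (\<gamma> v v)))
        \<longlonglongrightarrow> K * norm (w - w) * norm v + sqrt (0 * Re (\<gamma> v v))"
      by (intro tendsto_intros w a0)
    ultimately have "cmod (\<gamma> w v) \<le> K * norm (w - w) * norm v + sqrt (0 * Re (\<gamma> v v))"
      by (intro LIMSEQ_le_const[where X = "\<lambda>n. K * norm (w - u (s n)) * norm v + sqrt (a n * Re (\<gamma> v v))"]) auto
    then show ?thesis by simp
  qed
  then show ?thesis using wX mu0 w1 by (auto simp: \<gamma>_def)
qed

section \<open>Independent families and the bound behind the law of inertia\<close>

lemma independent_familyI:
  assumes I: "finite I"
    and key: "\<And>c. (\<Sum>i\<in>I. scaleC (c i) (v i)) = 0 \<Longrightarrow> \<forall>i\<in>I. c i = 0"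
  shows "inj_on v I" "cvs.independent (v ` I)"
proof -
  show inj: "inj_on v I"
  proof (rule inj_onI, rule ccontr)
    fix x y assume xy: "x \<in> I" "y \<in> I" "v x = v y" "x \<noteq> y"
    define c where "c b = (if b = x then 1 else if b = y then -1 else 0::complex)" for b
    have "(\<Sum>b\<in>I. scaleC (c b) (v b)) = (\<Sum>b\<in>{x, y}. scaleC (c b) (v b))"
      using xy I by (intro sum.mono_neutral_right) (auto simp: c_def)
    also have "\<dots> = 0" using xy by (simp add: c_def)
    finally have "c x = 0" using key xy(1) by blast
    then show False by (simp add: c_def)
  qed
  show "cvs.independent (v ` I)"
  proof (rule cvs.independent_if_scalars_zero)
    show "finite (v ` I)" using I by simp
    fix f x assume "(\<Sum>x\<in>v ` I. scaleC (f x) x) = 0" and x: "x \<in> v ` I"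
    then have "(\<Sum>i\<in>I. scaleC (f (v i)) (v i)) = 0" by (simp add: sum.reindex[OF inj])
    from key[OF this] show "f x = 0" using x by auto
  qed
qed

text \<open>Modulo P every b is an element n b of span S. These elements stay independent: a
  relation among them puts the same combination of B into P, so that combination is zero.\<close>

lemma sylvester_bound:
  assumes B: "finite B" "cvs.independent B" and S: "finite S" and P: "cvs.subspace P"
    and dec: "\<And>b. b \<in> B \<Longrightarrow> \<exists>n\<in>cvs.span S. b - n \<in> P"
    and triv: "cvs.span B \<inter> P \<subseteq> {0::'a::chilbert}"
  shows "card B \<le> card S"
proof -
  obtain n where n: "\<And>b. b \<in> B \<Longrightarrow> n b \<in> cvs.span S" "\<And>b. b \<in> B \<Longrightarrow> b - n b \<in> P"
    using dec by metis
  have key: "\<forall>b\<in>B. c b = 0" if s: "(\<Sum>b\<in>B. scaleC (c b) (n b)) = 0" for c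
  proof -
    have "(\<Sum>b\<in>B. scaleC (c b) b) = (\<Sum>b\<in>B. scaleC (c b) (b - n b))"
      using s by (simp add: cvs.scale_right_diff_distrib sum_subtractf)
    also have "\<dots> \<in> P" using n(2) P by (intro cvs.subspace_sum cvs.subspace_scale) auto
    finally have "(\<Sum>b\<in>B. scaleC (c b) b) \<in> P" .
    moreover have "(\<Sum>b\<in>B. scaleC (c b) b) \<in> cvs.span B"
      by (intro cvs.span_sum cvs.span_scale cvs.span_base)
    ultimately have "(\<Sum>b\<in>B. scaleC (c b) b) = 0" using triv by blast
    then show ?thesis using cvs.independentD[OF B(2,1)] by blast
  qed
  have fam: "inj_on n B" "cvs.independent (n ` B)"
    by (rule independent_familyI[OF B(1)], rule key, assumption)+
  have "card (n ` B) \<le> card S"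
    using cvs.independent_span_bound[OF S fam(2)] n(1) by blast
  then show ?thesis using card_image[OF fam(1)] by simp
qed

lemma diag_quad:
  assumes h: "herm Y \<beta>" "cvs.subspace Y" and B: "finite B" "B \<subseteq> Y"
    and diag: "\<And>a b. a \<in> B \<Longrightarrow> b \<in> B \<Longrightarrow> a \<noteq> b \<Longrightarrow> \<beta> a b = 0"
  shows "Re (\<beta> (\<Sum>b\<in>B. scaleC (c b) b) (\<Sum>b\<in>B. scaleC (c b) b)) = (\<Sum>b\<in>B. Re (\<beta> b b) * (cmod (c b))\<^sup>2)"
proof -
  let ?x = "\<Sum>b\<in>B. scaleC (c b) b"
  have sY: "scaleC (c b) b \<in> Y" if "b \<in> B" for b using that B h(2) by (auto intro: cvs.subspace_scale)
  have xY: "?x \<in> Y" using sY h(2) by (auto intro: cvs.subspace_sum)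
  have "\<beta> ?x ?x = (\<Sum>b\<in>B. \<beta> (scaleC (c b) b) ?x)" using herm_sum_left[OF h xY, of B] sY by simp
  also have "\<dots> = (\<Sum>b\<in>B. (c b * cnj (c b)) * \<beta> b b)"
  proof (rule sum.cong[OF refl])
    fix b assume b: "b \<in> B"
    then have bY: "b \<in> Y" using B by auto
    have "\<beta> b ?x = (\<Sum>a\<in>B. \<beta> b (scaleC (c a) a))" using herm_sum_right[OF h bY, of B] sY by simp
    also have "\<dots> = (\<Sum>a\<in>B. if a = b then c b * \<beta> b b else 0)"
      using diag b B by (intro sum.cong) (auto simp: herm_scale_right[OF h(1)] subset_iff)
    also have "\<dots> = c b * \<beta> b b" using b B(1) by simp
    finally show "\<beta> (scaleC (c b) b) ?x = (c b * cnj (c b)) * \<beta> b b"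
      using herm_scale_left[OF h bY xY, of "c b"] by simp
  qed
  also have "Re \<dots> = (\<Sum>b\<in>B. Re (\<beta> b b) * (cmod (c b))\<^sup>2)"
    by (simp only: complex_norm_square[symmetric] Re_sum) (simp add: mult.commute)
  finally show ?thesis .
qed

text \<open>Take an orthonormal set of negative eigenvectors of maximal size;
  \<open>sylvester_bound\<close> caps the size by that of a spanning set of E. If some vector
  orthogonal to it were still negative, \<open>minimizer_exists\<close> on the orthogonal complement
  would supply one more eigenvector.\<close>

lemma negative_spectral_basis:
  fixes \<beta> :: "'a::chilbert \<Rightarrow> 'a \<Rightarrow> complex"
  assumes h: "herm Y \<beta>" and Y: "cvs.subspace Y" and bd: "herm_bounded Y \<beta> M" and clY: "closed Y"
    and E: "cvs.subspace E" "E \<subseteq> Y" "fin_dim E"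
    and F: "cvs.subspace F" "F \<subseteq> Y"
    and dec: "\<And>x. x \<in> Y \<Longrightarrow> \<exists>e\<in>E. \<exists>f\<in>F. x = e + f \<and> norm e \<le> C * norm x"
    and pos: "\<And>f. f \<in> F \<Longrightarrow> 0 \<le> Re (\<beta> f f)"
  shows "\<exists>B. finite B \<and> orthonormal B \<and> B \<subseteq> Y \<and> (\<forall>b\<in>B. Re (\<beta> b b) < 0)
     \<and> (\<forall>b\<in>B. \<forall>v\<in>Y. \<beta> b v = of_real (Re (\<beta> b b)) * cinner b v)
     \<and> (\<forall>x\<in>Y. (\<forall>b\<in>B. cinner b x = 0) \<longrightarrow> 0 \<le> Re (\<beta> x x))"
proof -
  define G where "G B \<longleftrightarrow> finite B \<and> orthonormal B \<and> B \<subseteq> Y \<and> (\<forall>b\<in>B. Re (\<beta> b b) < 0)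
     \<and> (\<forall>b\<in>B. \<forall>v\<in>Y. \<beta> b v = of_real (Re (\<beta> b b)) * cinner b v)" for B
  obtain S where S: "finite S" "E \<subseteq> cvs.span S" using E(3) unfolding fin_dim_def by blast
  have bound: "card B \<le> card S" if "G B" for B
  proof (rule sylvester_bound)
    have B: "finite B" "orthonormal B" "B \<subseteq> Y" "\<And>b. b \<in> B \<Longrightarrow> Re (\<beta> b b) < 0"
      "\<And>b v. b \<in> B \<Longrightarrow> v \<in> Y \<Longrightarrow> \<beta> b v = of_real (Re (\<beta> b b)) * cinner b v"
      using that unfolding G_def by blast+
    show "finite B" "cvs.independent B" "finite S" "cvs.subspace F"
      using B(1) orthonormal_independent[OF B(2,1)] S(1) F(1) .
    show "\<exists>n\<in>cvs.span S. b - n \<in> F" if b: "b \<in> B" for b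
    proof -
      obtain e f where "e \<in> E" "f \<in> F" "b = e + f" using dec[of b] b B(3) by blast
      then show ?thesis using S(2) by (intro bexI[of _ e]) auto
    qed
    show "cvs.span B \<inter> F \<subseteq> {0}"
    proof
      fix x assume x: "x \<in> cvs.span B \<inter> F"
      then obtain c where c: "x = (\<Sum>b\<in>B. scaleC (c b) b)" by (auto simp: cvs.span_finite[OF B(1)])
      have d: "\<beta> a b = 0" if "a \<in> B" "b \<in> B" "a \<noteq> b" for a b
        using B(5)[OF that(1), of b] that B(2,3) by (auto simp: orthonormal_def)
      have q: "Re (\<beta> x x) = (\<Sum>b\<in>B. Re (\<beta> b b) * (cmod (c b))\<^sup>2)"
        unfolding c by (rule diag_quad[OF h Y B(1,3) d])
      have nn: "0 \<le> - (Re (\<beta> b b) * (cmod (c b))\<^sup>2)" if "b \<in> B" for b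
        using B(4)[OF that] by (simp add: mult_nonpos_nonneg)
      have "(\<Sum>b\<in>B. - (Re (\<beta> b b) * (cmod (c b))\<^sup>2)) = 0"
        using q pos[of x] x sum_nonneg[of B "\<lambda>b. - (Re (\<beta> b b) * (cmod (c b))\<^sup>2)", OF nn]
        by (simp add: sum_negf)
      then have "\<forall>b\<in>B. Re (\<beta> b b) * (cmod (c b))\<^sup>2 = 0"
        using sum_nonneg_eq_0_iff[OF B(1), of "\<lambda>b. - (Re (\<beta> b b) * (cmod (c b))\<^sup>2)"] nn by simp
      then have "c b = 0" if "b \<in> B" for b using B(4)[OF that] that by force
      then show "x \<in> {0}" using c by simp
    qed
  qed
  have "G {}" by (simp add: G_def orthonormal_def)
  obtain B where GB: "G B" and max: "\<And>B'. G B' \<Longrightarrow> card B' \<le> card B"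
    using ex_has_greatest_nat[of G "{}" card "Suc (card S)"] \<open>G {}\<close> bound le_imp_less_Suc by blast
  have B: "finite B" "orthonormal B" "B \<subseteq> Y" "\<And>b. b \<in> B \<Longrightarrow> Re (\<beta> b b) < 0"
      "\<And>b v. b \<in> B \<Longrightarrow> v \<in> Y \<Longrightarrow> \<beta> b v = of_real (Re (\<beta> b b)) * cinner b v"
    using GB unfolding G_def by blast+
  have "0 \<le> Re (\<beta> x x)" if x: "x \<in> Y" "\<forall>b\<in>B. cinner b x = 0" for x
  proof (rule ccontr)
    assume "\<not> 0 \<le> Re (\<beta> x x)"
    define X where "X = {x\<in>Y. \<forall>b\<in>B. cinner b x = 0}"
    have Xs: "cvs.subspace X"
      using Y unfolding cvs.subspace_def X_def by (auto simp: cinner_simps)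
    have "X = Y \<inter> (\<Inter>b\<in>B. {x. cinner b x = 0})" by (auto simp: X_def)
    moreover have "closed {x. cinner b x = 0}" for b :: 'a
      by (intro closed_Collect_eq continuous_intros bounded_bilinear.continuous_on[OF bounded_bilinear_cinner])
    ultimately have "closed X" using clY by (simp add: closed_INT closed_Int)
    from minimizer_exists[OF h Y bd Xs _ this E F, of C x] dec pos x \<open>\<not> 0 \<le> Re (\<beta> x x)\<close>
    obtain u \<mu> where u: "u \<in> X" "\<mu> < 0" "norm u = 1" "\<And>v. v \<in> X \<Longrightarrow> \<beta> u v = of_real \<mu> * cinner u v"
      by (auto simp: X_def)
    have uu: "cinner u u = 1" by (simp add: cinner_self u(3))
    then have bu: "\<beta> u u = of_real \<mu>" using u(4)[OF u(1)] by simp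
    have uY: "u \<in> Y" and ub: "\<And>b. b \<in> B \<Longrightarrow> cinner b u = 0" using u(1) by (auto simp: X_def)
    have ub': "\<And>b. b \<in> B \<Longrightarrow> cinner u b = 0" using ub cinner_commute by (metis complex_cnj_zero)
    have "u \<notin> B" using ub uu by auto
    \<comment> \<open>An eigenvector of the form restricted to X is one on all of Y: both \<beta>
      and the inner product vanish between u and the span of B, and v differs from an element of X
      by an element of that span.\<close>
    have ev: "\<beta> u v = of_real (Re (\<beta> u u)) * cinner u v" if v: "v \<in> Y" for v
    proof -
      define p where "p = (\<Sum>b\<in>B. scaleC (cinner b v) b)"
      have pY: "p \<in> Y" unfolding p_def using B(3) by (auto intro!: cvs.subspace_sum cvs.subspace_scale Y)
      have "v - p \<in> X" unfolding X_def
        using pY v Y orthonormal_coeff[OF B(2,1)]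
        by (auto simp: cinner_simps p_def intro!: cvs.subspace_diff)
      then have "\<beta> u (v - p) = of_real \<mu> * cinner u (v - p)" by (rule u(4))
      moreover have "\<beta> u p = 0"
      proof -
        have "\<beta> u p = (\<Sum>b\<in>B. \<beta> u (scaleC (cinner b v) b))" unfolding p_def
          using B(3) by (intro herm_sum_right[OF h Y uY]) (auto intro!: cvs.subspace_scale Y)
        also have "\<dots> = 0"
        proof (intro sum.neutral ballI)
          fix b assume b: "b \<in> B"
          have "\<beta> b u = 0" using B(5)[OF b uY] ub[OF b] by simp
          then have "\<beta> u b = 0" using herm_sym[OF h, of b u] b B(3) uY by auto
          then show "\<beta> u (scaleC (cinner b v) b) = 0"
            using herm_scale_right[OF h uY, of b] b B(3) by auto
        qed
        finally show ?thesis .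
      qed
      moreover have "cinner u p = 0" unfolding p_def by (simp add: cinner_sum_right cinner_simps ub')
      moreover have "\<beta> u (v - p) = \<beta> u v - \<beta> u p" by (rule herm_diff_right[OF h Y uY v pY])
      ultimately show ?thesis using bu by (simp add: cinner_simps)
    qed
    have "orthonormal (insert u B)"
      unfolding orthonormal_def
    proof (intro ballI)
      fix a b assume "a \<in> insert u B" "b \<in> insert u B"
      then consider "a = u" "b = u" | "a = u" "b \<in> B" | "a \<in> B" "b = u" | "a \<in> B" "b \<in> B"
        by blast
      then show "cinner a b = (if a = b then 1 else 0)"
        using uu ub ub' \<open>u \<notin> B\<close> B(2) by cases (auto simp: orthonormal_def)
    qed
    moreover have "\<forall>b\<in>insert u B. \<forall>v\<in>Y. \<beta> b v = of_real (Re (\<beta> b b)) * cinner b v"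
      using ev B(5) by blast
    moreover have "\<forall>b\<in>insert u B. Re (\<beta> b b) < 0" using B(4) u(2) bu by simp
    ultimately have "G (insert u B)"
      unfolding G_def using B(1,3) uY by blast
    from max[OF this] show False using \<open>u \<notin> B\<close> B(1) by simp
  qed
  then show ?thesis using B by blast
qed

lemma fin_dim_herm_bounded:
  assumes h: "herm E \<beta>" and E: "cvs.subspace E" "fin_dim E"
  obtains M where "0 \<le> M" "herm_bounded E \<beta> M"
proof -
  obtain B where B: "onb B E" using fin_dim_onb[OF E(2,1)] .
  have fB: "finite B" and BE: "B \<subseteq> E" and on: "orthonormal B" using B by (auto simp: onb_def intro: cvs.span_base)
  define M where "M = (\<Sum>a\<in>B. \<Sum>b\<in>B. cmod (\<beta> a b))"
  have nb: "norm b = 1" if "b \<in> B" for b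
    using on that cinner_self[of b] unfolding orthonormal_def
    by (metis norm_cinner one_complex.sel(1) real_sqrt_one)
  have "cmod (\<beta> x y) \<le> M * norm x * norm y" if xy: "x \<in> E" "y \<in> E" for x y
  proof -
    have s: "scaleC (cinner b z) b \<in> E" if "b \<in> B" for b z using BE that E by (auto intro: cvs.subspace_scale)
    have "\<beta> x y = \<beta> (\<Sum>a\<in>B. scaleC (cinner a x) a) (\<Sum>b\<in>B. scaleC (cinner b y) b)"
      using onb_expand[OF B] xy by metis
    also have "\<dots> = (\<Sum>a\<in>B. \<beta> (scaleC (cinner a x) a) (\<Sum>b\<in>B. scaleC (cinner b y) b))"
      using s E by (intro herm_sum_left[OF h E(1)] cvs.subspace_sum) auto
    also have "\<dots> = (\<Sum>a\<in>B. \<Sum>b\<in>B. \<beta> (scaleC (cinner a x) a) (scaleC (cinner b y) b))"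
      using s by (intro sum.cong refl herm_sum_right[OF h E(1)]) auto
    also have "\<dots> = (\<Sum>a\<in>B. \<Sum>b\<in>B. cnj (cinner a x) * (cinner b y * \<beta> a b))"
      using s BE by (intro sum.cong refl) (auto simp: herm_scale_left[OF h E(1)] herm_scale_right[OF h] subset_iff)
    finally have "cmod (\<beta> x y) \<le> (\<Sum>a\<in>B. \<Sum>b\<in>B. cmod (cnj (cinner a x) * (cinner b y * \<beta> a b)))"
      by (simp only:) (intro order.trans[OF norm_sum] sum_mono norm_sum)
    also have "\<dots> \<le> (\<Sum>a\<in>B. \<Sum>b\<in>B. norm x * (norm y * cmod (\<beta> a b)))"
    proof (intro sum_mono)
      fix a b assume "a \<in> B" "b \<in> B"
      then have "cmod (cinner a x) \<le> norm x" "cmod (cinner b y) \<le> norm y"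
        using cinner_cauchy_schwarz[of a x] cinner_cauchy_schwarz[of b y] nb by auto
      then show "cmod (cnj (cinner a x) * (cinner b y * \<beta> a b)) \<le> norm x * (norm y * cmod (\<beta> a b))"
        by (simp add: norm_mult mult_mono)
    qed
    also have "\<dots> = M * norm x * norm y"
      by (simp add: M_def sum_distrib_left sum_distrib_right mult_ac)
    finally show ?thesis .
  qed
  moreover have "0 \<le> M" unfolding M_def by (intro sum_nonneg) auto
  ultimately show ?thesis using that unfolding herm_bounded_def by blast
qed

text \<open>Subtracting M + 1 times the inner product makes the form negative definite, so the
  negative eigenvectors exhaust E; orthogonal eigenvectors of the shifted form are also
  \<beta>-orthogonal. The finite-dimensional part in \<open>negative_spectral_basis\<close> is E
  itself, with the zero space as F.\<close>

lemma herm_diagonalization: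
  assumes h: "herm E \<beta>" and E: "cvs.subspace E" "fin_dim E"
  obtains B where "onb B E" "\<And>a b. a \<in> B \<Longrightarrow> b \<in> B \<Longrightarrow> a \<noteq> b \<Longrightarrow> \<beta> a b = 0"
proof -
  obtain M where M: "0 \<le> M" "herm_bounded E \<beta> M" using fin_dim_herm_bounded[OF assms] .
  define \<gamma> where "\<gamma> = (\<lambda>x y. \<beta> x y - of_real (M + 1) * cinner x y)"
  have g: "herm E \<gamma>" unfolding \<gamma>_def by (rule herm_shift[OF h])
  have gneg: "Re (\<gamma> x x) < 0" if "x \<in> E" "x \<noteq> 0" for x
  proof -
    have "Re (\<beta> x x) \<le> M * norm x * norm x"
      using M(2) that complex_Re_le_cmod[of "\<beta> x x"] unfolding herm_bounded_def by (meson order_trans)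
    moreover have "0 < norm x * norm x" using that by simp
    ultimately show ?thesis by (simp add: \<gamma>_def cinner_self power2_eq_square algebra_simps)
  qed
  obtain B where B: "finite B" "orthonormal B" "B \<subseteq> E"
    "\<And>b v. b \<in> B \<Longrightarrow> v \<in> E \<Longrightarrow> \<gamma> b v = of_real (Re (\<gamma> b b)) * cinner b v"
    "\<And>x. x \<in> E \<Longrightarrow> (\<forall>b\<in>B. cinner b x = 0) \<Longrightarrow> 0 \<le> Re (\<gamma> x x)"
    using negative_spectral_basis[OF g E(1) herm_bounded_shift[OF M(2), of "M + 1", folded \<gamma>_def]
        fin_dim_closed[OF E(2,1)] E(1) order_refl E(2) cvs.subspace_single_0, of 1]
      cvs.subspace_0[OF E(1)] herm_zero_right[OF g E(1), of 0] by auto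
  have "E \<subseteq> cvs.span B"
  proof
    fix x assume x: "x \<in> E"
    define p where "p = (\<Sum>b\<in>B. scaleC (cinner b x) b)"
    have pE: "p \<in> E" unfolding p_def using B(3) by (auto intro!: cvs.subspace_sum cvs.subspace_scale E)
    have "x - p \<in> E" using x pE E by (auto intro: cvs.subspace_diff)
    moreover have "\<forall>b\<in>B. cinner b (x - p) = 0"
      using orthonormal_coeff[OF B(2,1)] by (simp add: cinner_simps p_def)
    ultimately have "x - p = 0" using B(5)[of "x - p"] gneg[of "x - p"] by fastforce
    moreover have "p \<in> cvs.span B" unfolding p_def by (auto intro: cvs.span_sum cvs.span_scale cvs.span_base)
    ultimately show "x \<in> cvs.span B" by simp
  qed
  then have "onb B E" using B E cvs.span_minimal[of B E] by (auto simp: onb_def)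
  moreover have "\<beta> a b = 0" if "a \<in> B" "b \<in> B" "a \<noteq> b" for a b
  proof -
    have "cinner a b = 0" using that B(2) by (auto simp: orthonormal_def)
    then show ?thesis using B(4)[OF that(1), of b] that B(3) by (auto simp: \<gamma>_def)
  qed
  ultimately show ?thesis using that by blast
qed

definition clin :: "('a::chilbert \<Rightarrow> 'b::chilbert) \<Rightarrow> bool" where
  "clin f \<longleftrightarrow> (\<forall>x y. f (x + y) = f x + f y) \<and> (\<forall>c x. f (scaleC c x) = scaleC c (f x))"

lemma clin_linear: "clin f \<Longrightarrow> Vector_Spaces.linear scaleC scaleC f"
  by unfold_locales (auto simp: clin_def scaleC_add_right scaleC_add_left scaleC_scaleC scaleC_one)

lemma clin_module_hom: "clin f \<Longrightarrow> module_hom scaleC scaleC f"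
  using clin_linear Vector_Spaces.linear_def by blast

lemma
  assumes "clin f"
  shows clin_add: "f (x + y) = f x + f y"
    and clin_scale: "f (scaleC c x) = scaleC c (f x)"
    and clin_zero: "f 0 = 0"
    and clin_neg: "f (- x) = - f x"
    and clin_diff: "f (x - y) = f x - f y"
    and clin_sum: "f (sum g A) = (\<Sum>a\<in>A. f (g a))"
  using assms module_hom.zero[OF clin_module_hom[OF assms]] module_hom.neg[OF clin_module_hom[OF assms]]
    module_hom.diff[OF clin_module_hom[OF assms]] module_hom.sum[OF clin_module_hom[OF assms]]
  by (auto simp: clin_def)

section \<open>The negative index\<close>

text \<open>The negative index, certified by a splitting into a negative definite part of finite
  dimension and a nonnegative part P. As a relation it also asserts that the index is finite, which
  is what matters on an infinite-dimensional space.\<close>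

definition has_index :: "'a::chilbert set \<Rightarrow> ('a \<Rightarrow> real) \<Rightarrow> nat \<Rightarrow> bool" where
  "has_index X q n \<longleftrightarrow> (\<exists>B P. finite B \<and> cvs.independent B \<and> card B = n \<and> cvs.span B \<subseteq> X
     \<and> cvs.subspace P \<and> P \<subseteq> X \<and> (\<forall>x\<in>X. \<exists>a\<in>cvs.span B. x - a \<in> P)
     \<and> (\<forall>x\<in>cvs.span B. x \<noteq> 0 \<longrightarrow> q x < 0) \<and> (\<forall>x\<in>P. 0 \<le> q x))"

lemma has_indexE:
  assumes "has_index X q n"
  obtains B P where "finite B" "cvs.independent B" "card B = n" "cvs.span B \<subseteq> X"
    "cvs.subspace P" "P \<subseteq> X" "\<And>x. x \<in> X \<Longrightarrow> \<exists>a\<in>cvs.span B. x - a \<in> P"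
    "\<And>x. x \<in> cvs.span B \<Longrightarrow> x \<noteq> 0 \<Longrightarrow> q x < 0" "\<And>x. x \<in> P \<Longrightarrow> 0 \<le> q x"
proof -
  from assms[unfolded has_index_def] show ?thesis
    by (elim exE conjE) (rule that; (assumption | erule (1) bspec | (drule (1) bspec, erule (1) mp)))
qed

lemma has_index_bound:
  assumes "has_index X q n" "finite W" "cvs.independent W" "cvs.span W \<subseteq> X"
    and neg: "\<And>x. x \<in> cvs.span W \<Longrightarrow> x \<noteq> 0 \<Longrightarrow> q x < 0"
  shows "card W \<le> n"
proof -
  obtain B P where "finite B" "cvs.independent B" "card B = n" "cvs.span B \<subseteq> X"
    "cvs.subspace P" "P \<subseteq> X" "\<And>x. x \<in> X \<Longrightarrow> \<exists>a\<in>cvs.span B. x - a \<in> P"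
    "\<And>x. x \<in> cvs.span B \<Longrightarrow> x \<noteq> 0 \<Longrightarrow> q x < 0" "\<And>x. x \<in> P \<Longrightarrow> 0 \<le> q x"
    by (rule has_indexE[OF assms(1)]) (rule that)
  note B = this(1,3,5,7,9)
  have "card W \<le> card B"
  proof (rule sylvester_bound[OF assms(2,3) B(1,3)])
    show "\<exists>n\<in>cvs.span B. b - n \<in> P" if "b \<in> W" for b
      using B(4) that assms(4) cvs.span_base by blast
    show "cvs.span W \<inter> P \<subseteq> {0}" using neg B(5) by fastforce
  qed
  then show ?thesis using B by simp
qed

text \<open>Enlarging the space or lowering the form can only add negative directions. With equal
  data, used in both directions, this is the law of inertia \<open>has_index_unique\<close>.\<close>

lemma has_index_mono:
  assumes "has_index X q m" "has_index Y q' n" "X \<subseteq> Y" "\<And>x. x \<in> X \<Longrightarrow> q' x \<le> q x"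
  shows "m \<le> n"
proof -
  obtain B P where "finite B" "cvs.independent B" "card B = m" "cvs.span B \<subseteq> X"
    "cvs.subspace P" "P \<subseteq> X" "\<And>x. x \<in> X \<Longrightarrow> \<exists>a\<in>cvs.span B. x - a \<in> P"
    "\<And>x. x \<in> cvs.span B \<Longrightarrow> x \<noteq> 0 \<Longrightarrow> q x < 0" "\<And>x. x \<in> P \<Longrightarrow> 0 \<le> q x"
    by (rule has_indexE[OF assms(1)]) (rule that)
  note B = this(1-4,8)
  have "card B \<le> n"
  proof (rule has_index_bound[OF assms(2) B(1,2)])
    show "cvs.span B \<subseteq> Y" using B(4) assms(3) by blast
    show "q' x < 0" if "x \<in> cvs.span B" "x \<noteq> 0" for x
      using B(5)[OF that] assms(4)[of x] that(1) B(4) by auto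
  qed
  then show ?thesis using B by simp
qed

lemma has_index_unique: "has_index X q m \<Longrightarrow> has_index X q n \<Longrightarrow> m = n"
  using has_index_mono[of X q m X q n] has_index_mono[of X q n X q m] by simp

lemma has_index_scale:
  assumes "has_index X q n" "0 < r"
  shows "has_index X (\<lambda>x. r * q x) n"
  using assms by (simp add: has_index_def mult_less_0_iff zero_le_mult_iff)

lemma has_index_image:
  assumes L: "clin L" and inj: "inj_on L X" and idx: "has_index X (\<lambda>x. q (L x)) n"
  shows "has_index (L ` X) q n"
proof -
  obtain B P where B: "finite B" "cvs.independent B" "card B = n" "cvs.span B \<subseteq> X"
    "cvs.subspace P" "P \<subseteq> X" "\<And>x. x \<in> X \<Longrightarrow> \<exists>a\<in>cvs.span B. x - a \<in> P"
    "\<And>x. x \<in> cvs.span B \<Longrightarrow> x \<noteq> 0 \<Longrightarrow> q (L x) < 0" "\<And>x. x \<in> P \<Longrightarrow> 0 \<le> q (L x)"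
    by (rule has_indexE[OF idx]) (rule that)
  note hom = clin_module_hom[OF L]
  have inj': "inj_on L (cvs.span B)" using inj B(4) inj_on_subset by blast
  have sp: "cvs.span (L ` B) = L ` cvs.span B" by (rule module_hom.span_image[OF hom])
  show ?thesis unfolding has_index_def
  proof (rule exI[of _ "L ` B"], rule exI[of _ "L ` P"], intro conjI ballI impI)
    show "finite (L ` B)" using B by simp
    show "cvs.independent (L ` B)" by (rule module_hom.independent_injective_image[OF hom B(2) inj'])
    show "card (L ` B) = n" using B(3) inj_on_subset[OF inj' cvs.span_superset] by (simp add: card_image)
    show "cvs.span (L ` B) \<subseteq> L ` X" using sp B(4) by auto
    show "cvs.subspace (L ` P)" by (rule module_hom.subspace_image[OF hom B(5)])
    show "L ` P \<subseteq> L ` X" using B(6) by auto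
    show "\<exists>a\<in>cvs.span (L ` B). x - a \<in> L ` P" if "x \<in> L ` X" for x
    proof -
      from that obtain y where y: "y \<in> X" "x = L y" by blast
      obtain a where a: "a \<in> cvs.span B" "y - a \<in> P" using B(7)[OF y(1)] by blast
      then have "x - L a \<in> L ` P" using y(2) clin_diff[OF L, of y a] by (metis imageI)
      then show ?thesis using a(1) sp by blast
    qed
    show "q x < 0" if "x \<in> cvs.span (L ` B)" "x \<noteq> 0" for x
      using that sp B(8) clin_zero[OF L] by auto
    show "0 \<le> q x" if "x \<in> L ` P" for x using that B(9) by auto
  qed
qed

text \<open>Any basis that diagonalises q will do, orthonormal or not: \<open>cayley_index\<close>
  applies it to vectors that are orthonormal only after W.\<close>

lemma has_index_diag:
  assumes I: "finite I" "inj_on v I" and ind: "cvs.independent (v ` I)" and X: "cvs.span (v ` I) = X"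
    and q: "\<And>c. q (\<Sum>i\<in>I. scaleC (c i) (v i)) = (\<Sum>i\<in>I. r i * (cmod (c i))\<^sup>2)"
  shows "has_index X q (card {i\<in>I. r i < 0})"
proof -
  have rep: "\<exists>c. x = (\<Sum>i\<in>I. scaleC (c i) (v i)) \<and> (\<forall>i. i \<notin> J \<longrightarrow> c i = 0)"
    if J: "J \<subseteq> I" and x: "x \<in> cvs.span (v ` J)" for x J
  proof -
    have "finite J" using J I(1) finite_subset by blast
    then obtain u where u: "x = (\<Sum>b\<in>v ` J. scaleC (u b) b)" using x by (auto simp: cvs.span_finite)
    have "x = (\<Sum>i\<in>J. scaleC (u (v i)) (v i))"
      unfolding u using sum.reindex[OF inj_on_subset[OF I(2) J]] by simp
    also have "\<dots> = (\<Sum>i\<in>I. scaleC (if i \<in> J then u (v i) else 0) (v i))"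
      using J I(1) by (intro sum.mono_neutral_cong_left) auto
    finally show ?thesis by (intro exI[of _ "\<lambda>i. if i \<in> J then u (v i) else 0"]) auto
  qed
  define J where "J = {i\<in>I. r i < 0}"
  show ?thesis unfolding has_index_def J_def[symmetric]
  proof (rule exI[of _ "v ` J"], rule exI[of _ "cvs.span (v ` (I - J))"], intro conjI ballI impI)
    have JI: "J \<subseteq> I" by (auto simp: J_def)
    show "finite (v ` J)" using I JI finite_subset by blast
    show "cvs.independent (v ` J)" using ind JI by (meson cvs.independent_mono image_mono)
    show "card (v ` J) = card J" using inj_on_subset[OF I(2) JI] by (rule card_image)
    show "cvs.span (v ` J) \<subseteq> X" using X JI by (metis cvs.span_mono image_mono)
    show "cvs.subspace (cvs.span (v ` (I - J)))" by simp
    show "cvs.span (v ` (I - J)) \<subseteq> X" unfolding X[symmetric] by (intro cvs.span_mono) auto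
    show "\<exists>a\<in>cvs.span (v ` J). x - a \<in> cvs.span (v ` (I - J))" if "x \<in> X" for x
    proof -
      obtain c where c: "x = (\<Sum>i\<in>I. scaleC (c i) (v i))" using rep[of I x] \<open>x \<in> X\<close> X by blast
      have "x = (\<Sum>i\<in>J. scaleC (c i) (v i)) + (\<Sum>i\<in>I - J. scaleC (c i) (v i))"
        unfolding c using I(1) JI by (metis add.commute sum.subset_diff)
      moreover have "(\<Sum>i\<in>I - J. scaleC (c i) (v i)) \<in> cvs.span (v ` (I - J))"
        "(\<Sum>i\<in>J. scaleC (c i) (v i)) \<in> cvs.span (v ` J)"
        by (auto intro: cvs.span_sum cvs.span_scale cvs.span_base)
      ultimately show ?thesis by (metis add_diff_cancel_left')
    qed
    show "q x < 0" if x: "x \<in> cvs.span (v ` J)" "x \<noteq> 0" for x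
    proof -
      obtain c where c: "x = (\<Sum>i\<in>I. scaleC (c i) (v i))" "\<And>i. i \<notin> J \<Longrightarrow> c i = 0"
        using rep[OF JI x(1)] by blast
      have "\<exists>j\<in>I. c j \<noteq> 0"
      proof (rule ccontr)
        assume "\<not> (\<exists>j\<in>I. c j \<noteq> 0)"
        then have "x = 0" unfolding c(1) by (intro sum.neutral) simp
        then show False using x(2) by simp
      qed
      then obtain j where j: "j \<in> I" "c j \<noteq> 0" by blast
      then have "j \<in> J" using c(2) by blast
      have "(\<Sum>i\<in>I. r i * (cmod (c i))\<^sup>2) < (\<Sum>i\<in>I. 0)"
      proof (rule sum_strict_mono_ex1[OF I(1)])
        show "\<forall>i\<in>I. r i * (cmod (c i))\<^sup>2 \<le> 0"
        proof
          fix i assume "i \<in> I"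
          then show "r i * (cmod (c i))\<^sup>2 \<le> 0"
            using c(2)[of i] by (cases "i \<in> J") (auto simp: J_def mult_nonpos_nonneg)
        qed
        show "\<exists>i\<in>I. r i * (cmod (c i))\<^sup>2 < 0"
          using j \<open>j \<in> J\<close> by (auto simp: J_def intro!: bexI[of _ j] mult_neg_pos)
      qed
      then show ?thesis using q c(1) by simp
    qed
    show "0 \<le> q x" if x: "x \<in> cvs.span (v ` (I - J))" for x
    proof -
      obtain c where c: "x = (\<Sum>i\<in>I. scaleC (c i) (v i))" "\<And>i. i \<notin> I - J \<Longrightarrow> c i = 0"
        using rep[OF _ x] by auto
      have "0 \<le> r i * (cmod (c i))\<^sup>2" if "i \<in> I" for i
        using c(2)[of i] that by (cases "i \<in> J") (auto simp: J_def)
      then show ?thesis using q c(1) by (simp add: sum_nonneg)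
    qed
  qed
qed

lemma has_index_herm:
  assumes h: "herm E \<beta>" and E: "cvs.subspace E" and B: "onb B E"
    and diag: "\<And>a b. a \<in> B \<Longrightarrow> b \<in> B \<Longrightarrow> a \<noteq> b \<Longrightarrow> \<beta> a b = 0"
  shows "has_index E (\<lambda>x. Re (\<beta> x x)) (card {b\<in>B. Re (\<beta> b b) < 0})"
proof -
  have B': "finite B" "orthonormal B" "cvs.span B = E" "B \<subseteq> E"
    using B by (auto simp: onb_def intro: cvs.span_base)
  show ?thesis
    by (rule has_index_diag[where v = id])
      (use B' orthonormal_independent[OF B'(2,1)] diag_quad[OF h E B'(1,4) diag] in auto)
qed

lemma has_index_exists:
  assumes "herm E \<beta>" "cvs.subspace E" "fin_dim E"
  shows "\<exists>n. has_index E (\<lambda>x. Re (\<beta> x x)) n"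
  using herm_diagonalization[OF assms] has_index_herm[OF assms(1,2)] by metis

lemma has_index_trivial: "q 0 = 0 \<Longrightarrow> has_index {0} q 0"
  unfolding has_index_def by (rule exI[of _ "{}"], rule exI[of _ "{0}"]) (auto simp: cvs.independent_empty)

lemma independent_Un:
  assumes B: "finite B" "cvs.independent B" and C: "finite C" "cvs.independent C"
    and triv: "\<And>x. x \<in> cvs.span B \<Longrightarrow> x \<in> cvs.span C \<Longrightarrow> x = (0::'a::chilbert)"
  shows "B \<inter> C = {}" "cvs.independent (B \<union> C)"
proof -
  show disj: "B \<inter> C = {}"
    using triv cvs.dependent_zero B(2) by (metis cvs.span_base disjoint_iff)
  show "cvs.independent (B \<union> C)"
  proof (rule cvs.independent_if_scalars_zero)
    show "finite (B \<union> C)" using B C by simp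
    fix c x assume s0: "(\<Sum>x\<in>B \<union> C. scaleC (c x) x) = 0" and x: "x \<in> B \<union> C"
    define b where "b = (\<Sum>x\<in>B. scaleC (c x) x)"
    define d where "d = (\<Sum>x\<in>C. scaleC (c x) x)"
    have bd: "b + d = 0" using s0 B C disj by (simp add: sum.union_disjoint b_def d_def)
    have "b \<in> cvs.span B" "d \<in> cvs.span C"
      unfolding b_def d_def by (auto intro: cvs.span_sum cvs.span_scale cvs.span_base)
    moreover from bd have "b = - d" by (simp add: eq_neg_iff_add_eq_0)
    ultimately have "b = 0" using triv[of b] cvs.span_neg by blast
    then have "d = 0" using bd by simp
    show "c x = 0"
      using x cvs.independentD[OF B(2,1) order_refl, of c x] cvs.independentD[OF C(2,1) order_refl, of c x]
        \<open>b = 0\<close> \<open>d = 0\<close> unfolding b_def d_def by blast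
  qed
qed

lemma has_index_orthogonal_sum:
  assumes h: "herm Y \<beta>" "cvs.subspace Y" and X: "X1 \<subseteq> Y" "X2 \<subseteq> Y"
    and orth: "\<And>x y. x \<in> X1 \<Longrightarrow> y \<in> X2 \<Longrightarrow> \<beta> x y = 0"
    and i1: "has_index X1 (\<lambda>x. Re (\<beta> x x)) n1" and i2: "has_index X2 (\<lambda>x. Re (\<beta> x x)) n2"
    and s: "cvs.subspace X1" "cvs.subspace X2"
  shows "has_index {x + y |x y. x \<in> X1 \<and> y \<in> X2} (\<lambda>x. Re (\<beta> x x)) (n1 + n2)"
proof -
  define q where "q x = Re (\<beta> x x)" for x
  have qadd: "q (x + y) = q x + q y" if "x \<in> X1" "y \<in> X2" for x y
    using herm_quad_add[OF h, of x y] orth[OF that] that X by (auto simp: q_def)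
  obtain B P where B: "finite B" "cvs.independent B" "card B = n1" "cvs.span B \<subseteq> X1"
    "cvs.subspace P" "P \<subseteq> X1" "\<And>x. x \<in> X1 \<Longrightarrow> \<exists>a\<in>cvs.span B. x - a \<in> P"
    "\<And>x. x \<in> cvs.span B \<Longrightarrow> x \<noteq> 0 \<Longrightarrow> q x < 0" "\<And>x. x \<in> P \<Longrightarrow> 0 \<le> q x"
    by (rule has_indexE[OF i1[folded q_def]]) (rule that)
  obtain C R where C: "finite C" "cvs.independent C" "card C = n2" "cvs.span C \<subseteq> X2"
    "cvs.subspace R" "R \<subseteq> X2" "\<And>x. x \<in> X2 \<Longrightarrow> \<exists>a\<in>cvs.span C. x - a \<in> R"
    "\<And>x. x \<in> cvs.span C \<Longrightarrow> x \<noteq> 0 \<Longrightarrow> q x < 0" "\<And>x. x \<in> R \<Longrightarrow> 0 \<le> q x"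
    by (rule has_indexE[OF i2[folded q_def]]) (rule that)
  \<comment> \<open>A vector common to both negative parts is \<beta>-orthogonal to itself, so its
    value is 0 and it cannot be a nonzero negative vector. This replaces directness of the
    sum.\<close>
  have triv: "x = 0" if "x \<in> cvs.span B" "x \<in> cvs.span C" for x
  proof (rule ccontr)
    assume "x \<noteq> 0"
    then have "q x < 0" by (rule B(8)[OF that(1)])
    moreover have "\<beta> x x = 0" using orth that B(4) C(4) by blast
    ultimately show False by (simp add: q_def)
  qed
  have disj: "B \<inter> C = {}" and ind: "cvs.independent (B \<union> C)"
    by (rule independent_Un[OF B(1,2) C(1,2)], rule triv, assumption+)+
  show ?thesis unfolding has_index_def q_def[symmetric]
  proof (rule exI[of _ "B \<union> C"], rule exI[of _ "{x + y |x y. x \<in> P \<and> y \<in> R}"], intro conjI ballI impI)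
    show "finite (B \<union> C)" "cvs.independent (B \<union> C)" using B C ind by auto
    show "card (B \<union> C) = n1 + n2" using B C disj by (simp add: card_Un_disjoint)
    show "cvs.span (B \<union> C) \<subseteq> {x + y |x y. x \<in> X1 \<and> y \<in> X2}"
      unfolding cvs.span_Un using B(4) C(4) by blast
    show "cvs.subspace {x + y |x y. x \<in> P \<and> y \<in> R}" by (rule cvs.subspace_sums[OF B(5) C(5)])
    show "{x + y |x y. x \<in> P \<and> y \<in> R} \<subseteq> {x + y |x y. x \<in> X1 \<and> y \<in> X2}" using B(6) C(6) by blast
    show "\<exists>a\<in>cvs.span (B \<union> C). z - a \<in> {x + y |x y. x \<in> P \<and> y \<in> R}"
      if z: "z \<in> {x + y |x y. x \<in> X1 \<and> y \<in> X2}" for z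
    proof -
      obtain x y where xy: "z = x + y" "x \<in> X1" "y \<in> X2" using z by blast
      obtain a b where ab: "a \<in> cvs.span B" "x - a \<in> P" "b \<in> cvs.span C" "y - b \<in> R"
        using B(7)[OF xy(2)] C(7)[OF xy(3)] by blast
      have "a + b \<in> cvs.span (B \<union> C)" unfolding cvs.span_Un using ab by blast
      moreover have "z - (a + b) = (x - a) + (y - b)" using xy by simp
      ultimately show ?thesis using ab by blast
    qed
    show "q z < 0" if z: "z \<in> cvs.span (B \<union> C)" "z \<noteq> 0" for z
    proof -
      obtain x y where xy: "z = x + y" "x \<in> cvs.span B" "y \<in> cvs.span C"
        using z(1) unfolding cvs.span_Un by blast
      have "q z = q x + q y" using qadd xy B(4) C(4) by auto
      moreover have "q x \<le> 0" "q y \<le> 0" "q x < 0 \<or> q y < 0"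
        using B(8)[OF xy(2)] C(8)[OF xy(3)] xy(1) z(2) qadd[of 0 0] cvs.subspace_0 s
        by (cases "x = 0"; cases "y = 0"; force)+
      ultimately show ?thesis by linarith
    qed
    show "0 \<le> q z" if z: "z \<in> {x + y |x y. x \<in> P \<and> y \<in> R}" for z
      using z qadd B(6,9) C(6,9) by force
  qed
qed

text \<open>Index m and coindex n of a nondegenerate form with a definite margin \<eta> on both
  parts. The same two parts certify every form that differs by less than \<eta> times the squared
  norm, which makes indices locally constant.\<close>

definition strict_index :: "'a::chilbert set \<Rightarrow> ('a \<Rightarrow> real) \<Rightarrow> nat \<Rightarrow> nat \<Rightarrow> real \<Rightarrow> bool" where
  "strict_index X q m n \<eta> \<longleftrightarrow> (\<exists>B C. finite B \<and> cvs.independent B \<and> card B = m \<and> cvs.span B \<subseteq> X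
     \<and> finite C \<and> cvs.independent C \<and> card C = n \<and> cvs.span C \<subseteq> X
     \<and> (\<forall>x\<in>X. \<exists>a\<in>cvs.span B. x - a \<in> cvs.span C)
     \<and> (\<forall>x\<in>cvs.span B. q x \<le> - \<eta> * (norm x)\<^sup>2) \<and> (\<forall>x\<in>cvs.span C. \<eta> * (norm x)\<^sup>2 \<le> q x))"

lemma strict_indexE:
  assumes "strict_index X q m n \<eta>"
  obtains B C where "finite B" "cvs.independent B" "card B = m" "cvs.span B \<subseteq> X"
     "finite C" "cvs.independent C" "card C = n" "cvs.span C \<subseteq> X"
     "\<And>x. x \<in> X \<Longrightarrow> \<exists>a\<in>cvs.span B. x - a \<in> cvs.span C"
     "\<And>x. x \<in> cvs.span B \<Longrightarrow> q x \<le> - \<eta> * (norm x)\<^sup>2" "\<And>x. x \<in> cvs.span C \<Longrightarrow> \<eta> * (norm x)\<^sup>2 \<le> q x"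
proof -
  from assms[unfolded strict_index_def] show ?thesis
    by (elim exE conjE) (rule that; (assumption | erule (1) bspec))
qed

lemma strict_index_perturb:
  assumes "strict_index X q m n \<eta>" and d: "\<And>x. x \<in> X \<Longrightarrow> \<bar>q' x - q x\<bar> \<le> \<epsilon> * (norm x)\<^sup>2"
  shows "strict_index X q' m n (\<eta> - \<epsilon>)"
proof -
  obtain B C where B: "finite B" "cvs.independent B" "card B = m" "cvs.span B \<subseteq> X"
     "finite C" "cvs.independent C" "card C = n" "cvs.span C \<subseteq> X"
     "\<And>x. x \<in> X \<Longrightarrow> \<exists>a\<in>cvs.span B. x - a \<in> cvs.span C"
     "\<And>x. x \<in> cvs.span B \<Longrightarrow> q x \<le> - \<eta> * (norm x)\<^sup>2" "\<And>x. x \<in> cvs.span C \<Longrightarrow> \<eta> * (norm x)\<^sup>2 \<le> q x"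
    by (rule strict_indexE[OF assms(1)]) (rule that)
  have "q' x \<le> - (\<eta> - \<epsilon>) * (norm x)\<^sup>2" if "x \<in> cvs.span B" for x
    using d[of x] B(10)[of x] B(4) that by (fastforce simp: algebra_simps abs_le_iff)
  moreover have "(\<eta> - \<epsilon>) * (norm x)\<^sup>2 \<le> q' x" if "x \<in> cvs.span C" for x
    using d[of x] B(11)[of x] B(8) that by (fastforce simp: algebra_simps abs_le_iff)
  ultimately show ?thesis using B(1-9) unfolding strict_index_def
    by - (rule exI[of _ B], rule exI[of _ C], simp)
qed

lemma strict_index_imp_has_index:
  assumes "strict_index X q m n \<eta>" "0 < \<eta>" "cvs.subspace X"
  shows "has_index X q m" "has_index X (\<lambda>x. - q x) n"
proof -
  obtain B C where B: "finite B" "cvs.independent B" "card B = m" "cvs.span B \<subseteq> X"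
     "finite C" "cvs.independent C" "card C = n" "cvs.span C \<subseteq> X"
     "\<And>x. x \<in> X \<Longrightarrow> \<exists>a\<in>cvs.span B. x - a \<in> cvs.span C"
     "\<And>x. x \<in> cvs.span B \<Longrightarrow> q x \<le> - \<eta> * (norm x)\<^sup>2" "\<And>x. x \<in> cvs.span C \<Longrightarrow> \<eta> * (norm x)\<^sup>2 \<le> q x"
    by (rule strict_indexE[OF assms(1)]) (rule that)
  have n1: "q x < 0" if "x \<in> cvs.span B" "x \<noteq> 0" for x
  proof -
    have "0 < \<eta> * (norm x)\<^sup>2" using that assms(2) by simp
    then show ?thesis using B(10)[OF that(1)] by simp
  qed
  have n2: "0 < q x" if "x \<in> cvs.span C" "x \<noteq> 0" for x
  proof -
    have "0 < \<eta> * (norm x)\<^sup>2" using that assms(2) by simp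
    then show ?thesis using B(11)[OF that(1)] by simp
  qed
  have q0: "q 0 = 0" using B(10)[of 0] B(11)[of 0] cvs.span_zero by fastforce
  have n3: "0 \<le> - q x" if "x \<in> cvs.span B" for x using n1[OF that] q0 by (cases "x = 0") auto
  have n4: "0 \<le> q x" if "x \<in> cvs.span C" for x using n2[OF that] q0 by (cases "x = 0") auto
  have d2: "\<exists>a\<in>cvs.span C. x - a \<in> cvs.span B" if "x \<in> X" for x
    using B(9)[OF that] by (metis add_diff_cancel_left' diff_add_cancel add.commute)
  show "has_index X q m" unfolding has_index_def
    by (rule exI[of _ B], rule exI[of _ "cvs.span C"])
      (use B(1-9) n1 n4 in auto)
  show "has_index X (\<lambda>x. - q x) n" unfolding has_index_def
    by (rule exI[of _ C], rule exI[of _ "cvs.span B"])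
      (use B(1-8) d2 n2 n3 in auto)
qed

lemma diag_quad_bounds:
  assumes h: "herm E \<beta>" "cvs.subspace E" and S: "finite S" "orthonormal S" "S \<subseteq> E" "x \<in> cvs.span S"
    and diag: "\<And>a b. a \<in> S \<Longrightarrow> b \<in> S \<Longrightarrow> a \<noteq> b \<Longrightarrow> \<beta> a b = 0"
  shows "(\<And>b. b \<in> S \<Longrightarrow> Re (\<beta> b b) \<le> r) \<Longrightarrow> Re (\<beta> x x) \<le> r * (norm x)\<^sup>2"
    and "(\<And>b. b \<in> S \<Longrightarrow> r \<le> Re (\<beta> b b)) \<Longrightarrow> r * (norm x)\<^sup>2 \<le> Re (\<beta> x x)"
proof -
  have x: "x = (\<Sum>b\<in>S. scaleC (cinner b x) b)" by (rule orthonormal_expand[OF S(2,1,4)])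
  have q: "Re (\<beta> x x) = (\<Sum>b\<in>S. Re (\<beta> b b) * (cmod (cinner b x))\<^sup>2)"
    using diag_quad[OF h S(1,3) diag, of "\<lambda>b. cinner b x"] x by simp
  have p: "(norm x)\<^sup>2 = (\<Sum>b\<in>S. (cmod (cinner b x))\<^sup>2)"
    using onb_parseval[of S "cvs.span S"] S by (simp add: onb_def)
  show "(\<And>b. b \<in> S \<Longrightarrow> Re (\<beta> b b) \<le> r) \<Longrightarrow> Re (\<beta> x x) \<le> r * (norm x)\<^sup>2"
    unfolding q p sum_distrib_left by (intro sum_mono mult_right_mono) auto
  show "(\<And>b. b \<in> S \<Longrightarrow> r \<le> Re (\<beta> b b)) \<Longrightarrow> r * (norm x)\<^sup>2 \<le> Re (\<beta> x x)"
    unfolding q p sum_distrib_left by (intro sum_mono mult_right_mono) auto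
qed

lemma finite_positive_lower_bound:
  assumes "finite S" "\<And>b. b \<in> S \<Longrightarrow> 0 < (f b::real)"
  obtains \<eta> where "0 < \<eta>" "\<And>b. b \<in> S \<Longrightarrow> \<eta> \<le> f b"
proof (cases "S = {}")
  case True then show ?thesis using that[of 1] by simp
next
  case False
  then have "0 < Min (f ` S)" using assms by simp
  then show ?thesis using that[of "Min (f ` S)"] assms(1) by simp
qed

lemma onb_split:
  assumes B: "onb B E" and S: "S \<subseteq> B"
  shows "\<forall>x\<in>E. \<exists>a\<in>cvs.span S. x - a \<in> cvs.span (B - S)" "cvs.span S \<subseteq> E" "finite S" "orthonormal S"
    "cvs.independent S"
proof -
  show fS: "finite S" using B S finite_subset unfolding onb_def by blast
  show on: "orthonormal S" using B S unfolding onb_def orthonormal_def by blast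
  show sub: "cvs.span S \<subseteq> E" using B cvs.span_mono[OF S] unfolding onb_def by blast
  show "cvs.independent S" by (rule orthonormal_independent[OF on fS])
  show "\<forall>x\<in>E. \<exists>a\<in>cvs.span S. x - a \<in> cvs.span (B - S)"
  proof
    fix x assume "x \<in> E"
    then have "x = (\<Sum>b\<in>B. scaleC (cinner b x) b)" by (rule onb_expand[OF B])
    moreover have "finite B" using B unfolding onb_def by blast
    ultimately have "x = (\<Sum>b\<in>S. scaleC (cinner b x) b) + (\<Sum>b\<in>B - S. scaleC (cinner b x) b)"
      using sum.subset_diff[OF S, of "\<lambda>b. scaleC (cinner b x) b"] by (simp add: add.commute)
    moreover have "(\<Sum>b\<in>S. scaleC (cinner b x) b) \<in> cvs.span S"
       "(\<Sum>b\<in>B - S. scaleC (cinner b x) b) \<in> cvs.span (B - S)"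
      by (auto intro: cvs.span_sum cvs.span_scale cvs.span_base)
    ultimately show "\<exists>a\<in>cvs.span S. x - a \<in> cvs.span (B - S)"
      by (metis add_diff_cancel_left')
  qed
qed

text \<open>A zero entry in a diagonalising basis would put a basis vector into the radical. So all
  entries are nonzero, and finitely many nonzero numbers have a common lower bound in
  modulus.\<close>

lemma nondegenerate_strict_index:
  assumes h: "herm E \<beta>" and E: "cvs.subspace E" "fin_dim E"
    and nd: "\<And>x. x \<in> E \<Longrightarrow> x \<noteq> 0 \<Longrightarrow> \<exists>y\<in>E. \<beta> x y \<noteq> 0"
  obtains m n \<eta> where "0 < \<eta>" "strict_index E (\<lambda>x. Re (\<beta> x x)) m n \<eta>"
proof -
  obtain B where B: "onb B E" and diag: "\<And>a b. a \<in> B \<Longrightarrow> b \<in> B \<Longrightarrow> a \<noteq> b \<Longrightarrow> \<beta> a b = 0"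
    using herm_diagonalization[OF h E] by blast
  have B': "finite B" "orthonormal B" "cvs.span B = E" "B \<subseteq> E"
    using B by (auto simp: onb_def intro: cvs.span_base)
  have "Re (\<beta> b b) \<noteq> 0" if b: "b \<in> B" for b
  proof
    assume "Re (\<beta> b b) = 0"
    then have bb: "\<beta> b b = 0" using herm_self_real[OF h, of b] b B'(4) by auto
    have "b \<noteq> 0" using B'(2) b unfolding orthonormal_def by force
    then obtain y where y: "y \<in> E" "\<beta> b y \<noteq> 0" using nd[of b] b B'(4) by blast
    have "\<beta> b y = (\<Sum>a\<in>B. \<beta> b (scaleC (cinner a y) a))"
      using herm_sum_right[OF h E(1), of b B "\<lambda>a. scaleC (cinner a y) a"] onb_expand[OF B y(1)] b B'(4)
        cvs.subspace_scale[OF E(1)] by auto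
    also have "\<dots> = 0"
      using diag[OF b] bb b B'(4) herm_scale_right[OF h] by (intro sum.neutral ballI) (metis mult_zero_right subsetD)
    finally show False using y by simp
  qed
  then obtain \<eta> where eta: "0 < \<eta>" "\<And>b. b \<in> B \<Longrightarrow> \<eta> \<le> \<bar>Re (\<beta> b b)\<bar>"
    using finite_positive_lower_bound[OF B'(1), of "\<lambda>b. \<bar>Re (\<beta> b b)\<bar>"] by auto
  define S where "S = {b\<in>B. Re (\<beta> b b) < 0}"
  have SB: "S \<subseteq> B" "B - S \<subseteq> B" by (auto simp: S_def)
  note s1 = onb_split[OF B SB(1)] and s2 = onb_split[OF B SB(2)]
  have "strict_index E (\<lambda>x. Re (\<beta> x x)) (card S) (card (B - S)) \<eta>"
    unfolding strict_index_def
  proof (rule exI[of _ S], rule exI[of _ "B - S"], intro conjI)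
    show "\<forall>x\<in>cvs.span S. Re (\<beta> x x) \<le> - \<eta> * (norm x)\<^sup>2"
    proof
      fix x assume "x \<in> cvs.span S"
      then show "Re (\<beta> x x) \<le> - \<eta> * (norm x)\<^sup>2"
        using diag eta(2) SB B' by (intro diag_quad_bounds(1)[OF h E(1) s1(3,4)]) (force simp: S_def)+
    qed
    show "\<forall>x\<in>cvs.span (B - S). \<eta> * (norm x)\<^sup>2 \<le> Re (\<beta> x x)"
    proof
      fix x assume "x \<in> cvs.span (B - S)"
      then show "\<eta> * (norm x)\<^sup>2 \<le> Re (\<beta> x x)"
        using diag eta(2) SB B' by (intro diag_quad_bounds(2)[OF h E(1) s2(3,4)]) (force simp: S_def)+
    qed
  qed (use s1 s2 in auto)
  then show ?thesis using that eta(1) by blast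
qed

text \<open>Diagonalise <L x, L y> on E: its entries are positive by injectivity, and \<kappa> is a
  lower bound for these finitely many numbers.\<close>

lemma injective_coercive:
  assumes L: "clin L" and E: "cvs.subspace E" "fin_dim E"
    and inj: "\<And>x. x \<in> E \<Longrightarrow> L x = 0 \<Longrightarrow> x = 0"
  obtains \<kappa> where "0 < \<kappa>" "\<And>x. x \<in> E \<Longrightarrow> \<kappa> * (norm x)\<^sup>2 \<le> (norm (L x))\<^sup>2"
proof -
  define \<beta> where "\<beta> x y = cinner (L x) (L y)" for x y
  have h: "herm E \<beta>" unfolding \<beta>_def
    by (rule hermI) (auto simp: clin_add[OF L] clin_scale[OF L] cinner_simps intro: cinner_commute)
  obtain B where B: "onb B E" and diag: "\<And>a b. a \<in> B \<Longrightarrow> b \<in> B \<Longrightarrow> a \<noteq> b \<Longrightarrow> \<beta> a b = 0"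
    using herm_diagonalization[OF h E] by blast
  have B': "finite B" "orthonormal B" "cvs.span B = E" "B \<subseteq> E"
    using B by (auto simp: onb_def intro: cvs.span_base)
  have b: "Re (\<beta> x x) = (norm (L x))\<^sup>2" for x by (simp add: \<beta>_def cinner_self)
  have "0 < Re (\<beta> b b)" if "b \<in> B" for b
  proof -
    have "b \<noteq> 0" using B'(2) that unfolding orthonormal_def by force
    then show ?thesis using inj[of b] that B'(4) by (auto simp: b)
  qed
  then obtain \<kappa> where "0 < \<kappa>" "\<And>b. b \<in> B \<Longrightarrow> \<kappa> \<le> Re (\<beta> b b)"
    using finite_positive_lower_bound[OF B'(1), of "\<lambda>b. Re (\<beta> b b)"] by blast
  then show ?thesis using that[of \<kappa>] diag_quad_bounds(2)[OF h E(1) B'(1,2,4) _ diag] B'(3) by (simp add: b)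
qed

lemma span_family:
  assumes "finite I" "x \<in> cvs.span (v ` I)"
  shows "\<exists>c. x = (\<Sum>i\<in>I. scaleC (c i) (v i))"
  using assms(2)
proof (induction rule: cvs.span_induct_alt)
  case base
  show ?case by (rule exI[of _ "\<lambda>_. 0"]) simp
next
  case (step c x y)
  then obtain i d where i: "i \<in> I" "x = v i" "y = (\<Sum>i\<in>I. scaleC (d i) (v i))" by blast
  have "scaleC c x = (\<Sum>j\<in>I. scaleC (if j = i then c else 0) (v j))"
    using i(1,2) assms(1) by (subst sum.remove[of _ i]) (auto intro!: sum.neutral)
  then have "scaleC c x + y = (\<Sum>j\<in>I. scaleC ((if j = i then c else 0) + d j) (v j))"
    by (simp add: i(3) cvs.scale_left_distrib sum.distrib)
  then show ?case by (rule exI[of _ "\<lambda>j. (if j = i then c else 0) + d j"])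
qed

lemma onb_cinner:
  assumes "onb B X"
  shows "cinner (\<Sum>b\<in>B. scaleC (c b) b) (\<Sum>b\<in>B. scaleC (d b) b) = (\<Sum>b\<in>B. cnj (c b) * d b)"
proof -
  have B: "finite B" "orthonormal B" using assms by (auto simp: onb_def)
  show ?thesis unfolding cinner_sum_left
    using orthonormal_coeff[OF B(2,1)] by (intro sum.cong) (auto simp: cinner_scaleC_left)
qed

lemma fin_dim_injective_surjective:
  assumes E: "cvs.subspace E" "fin_dim E" and W: "clin W" "\<And>x. x \<in> E \<Longrightarrow> W x \<in> E"
    and inj: "\<And>x. x \<in> E \<Longrightarrow> W x = 0 \<Longrightarrow> x = 0"
  shows "inj_on W E" "W ` E = E"
proof -
  show injW: "inj_on W E"
    using inj clin_diff[OF W(1)] cvs.subspace_diff[OF E(1)] by (intro inj_onI) (metis eq_iff_diff_eq_0)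
  obtain B where B: "finite B" "cvs.independent B" "cvs.span B = E" using fin_dim_basis[OF E(2,1)] .
  note hom = clin_module_hom[OF W(1)]
  have ind: "cvs.independent (W ` B)"
    using module_hom.independent_injective_image[OF hom B(2)] injW B(3) by blast
  have sp: "cvs.span (W ` B) = W ` E" using module_hom.span_image[OF hom, of B] B(3) by simp
  have sub: "W ` B \<subseteq> E" using W(2) B(3) cvs.span_superset by blast
  show "W ` E = E"
  proof
    show "W ` E \<subseteq> E" using W(2) by blast
    show "E \<subseteq> W ` E"
    proof
      fix y assume y: "y \<in> E"
      show "y \<in> W ` E"
      proof (rule ccontr)
        assume "y \<notin> W ` E"
        then have ny: "y \<notin> cvs.span (W ` B)" using sp by simp
        then have "cvs.independent (insert y (W ` B))" using ind by (intro cvs.independent_insertI)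
        moreover have "insert y (W ` B) \<subseteq> cvs.span B" using sub y B(3) by blast
        ultimately have "card (insert y (W ` B)) \<le> card B" using cvs.independent_span_bound[OF B(1)] by blast
        moreover have "card (W ` B) = card B"
          using inj_on_subset[OF injW, of B] B(3) cvs.span_superset[of B] by (intro card_image) simp
        moreover have "y \<notin> W ` B" using ny cvs.span_superset[of "W ` B"] by blast
        moreover have "finite (W ` B)" using B(1) by simp
        ultimately show False by simp
      qed
    qed
  qed
qed

text \<open>The two definite parts leave no room for null directions; \<open>cayley_index\<close>
  uses this count to rule out vanishing diagonal entries.\<close>

lemma strict_index_dim:
  assumes "strict_index X q m n \<eta>" "0 < \<eta>" "onb B X"
  shows "m + n = card B"
proof -
  obtain S T where ST: "finite S" "cvs.independent S" "card S = m" "cvs.span S \<subseteq> X"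
     "finite T" "cvs.independent T" "card T = n" "cvs.span T \<subseteq> X"
     "\<And>x. x \<in> X \<Longrightarrow> \<exists>a\<in>cvs.span S. x - a \<in> cvs.span T"
     "\<And>x. x \<in> cvs.span S \<Longrightarrow> q x \<le> - \<eta> * (norm x)\<^sup>2" "\<And>x. x \<in> cvs.span T \<Longrightarrow> \<eta> * (norm x)\<^sup>2 \<le> q x"
    by (rule strict_indexE[OF assms(1)]) (rule that)
  have B: "finite B" "orthonormal B" "cvs.span B = X" using assms(3) by (auto simp: onb_def)
  have triv: "x = 0" if "x \<in> cvs.span S" "x \<in> cvs.span T" for x
  proof (rule ccontr)
    assume "x \<noteq> 0"
    then have "0 < \<eta> * (norm x)\<^sup>2" using assms(2) by simp
    then show False using ST(10)[OF that(1)] ST(11)[OF that(2)] by linarith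
  qed
  have disj: "S \<inter> T = {}" and ind: "cvs.independent (S \<union> T)"
    by (rule independent_Un[OF ST(1,2) ST(5,6)], rule triv, assumption+)+
  have "cvs.span (S \<union> T) = X"
  proof
    have "S \<union> T \<subseteq> X" using ST(4,8) cvs.span_superset by blast
    then show "cvs.span (S \<union> T) \<subseteq> X" using B(3) cvs.span_minimal by blast
    show "X \<subseteq> cvs.span (S \<union> T)"
    proof
      fix x assume "x \<in> X"
      then obtain a where "a \<in> cvs.span S" "x - a \<in> cvs.span T" using ST(9) by blast
      then show "x \<in> cvs.span (S \<union> T)" unfolding cvs.span_Un
        by (intro CollectI exI[of _ a] exI[of _ "x - a"]) simp
    qed
  qed
  then have sp: "cvs.span (S \<union> T) = cvs.span B" using B(3) by simp
  have "finite (S \<union> T)" using ST by simp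
  have "S \<union> T \<subseteq> cvs.span B" unfolding sp[symmetric] by (rule cvs.span_superset)
  then have "card (S \<union> T) \<le> card B" using cvs.independent_span_bound[OF B(1) ind] by simp
  moreover have "B \<subseteq> cvs.span (S \<union> T)" unfolding sp by (rule cvs.span_superset)
  then have "card B \<le> card (S \<union> T)"
    using cvs.independent_span_bound[OF \<open>finite (S \<union> T)\<close> orthonormal_independent[OF B(2,1)]] by simp
  ultimately show ?thesis using ST disj by (simp add: card_Un_disjoint)
qed

text \<open>In a basis diagonalizing the form, with $W$-orthonormal vectors, the three forms have entries $a$, $a + C$ and
  $a + a^2/C = a(a + C)/C$. Nondegeneracy of the last excludes $a = -C$, so the negative $a$ are distributed exactly
  between the last two.\<close>
lemma cayley_index:
  fixes W G :: "'a::chilbert \<Rightarrow> 'a"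
  assumes E: "cvs.subspace E" "fin_dim E"
    and W: "clin W" "\<And>x. x \<in> E \<Longrightarrow> W x \<in> E" and inj: "\<And>x. x \<in> E \<Longrightarrow> W x = 0 \<Longrightarrow> x = 0"
    and G: "clin G" "\<And>x. x \<in> E \<Longrightarrow> G x \<in> E"
    and h: "herm E \<beta>" and rel: "\<And>x y. x \<in> E \<Longrightarrow> y \<in> E \<Longrightarrow> \<beta> x y = cinner (W x) (G y)"
    and C: "0 < C"
    and st: "strict_index E (\<lambda>x. Re (\<beta> x x) + (norm (G x))\<^sup>2 / C) n0 m0 \<eta>" "0 < \<eta>"
    and idx: "has_index E (\<lambda>x. Re (\<beta> x x)) i"
  shows "n0 \<le> i" "has_index E (\<lambda>x. Re (\<beta> x x) + C * (norm (W x))\<^sup>2) (i - n0)"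
proof -
  have surj: "inj_on W E" "W ` E = E"
    using fin_dim_injective_surjective[OF E W(1)] W(2) inj by blast+
  \<comment> \<open>Passage to the coordinate W x: the transported form is <x, G (Y y)>, so
    diagonalising it yields eigenvectors d with G (Y d) = a d, and the vectors Y d diagonalise all
    three forms at once.\<close>
  define Y where "Y = inv_into E W"
  have Y: "Y x \<in> E" "W (Y x) = x" if "x \<in> E" for x
    using that surj(2) unfolding Y_def by (metis inv_into_into, metis f_inv_into_f)
  have Yuniq: "Y x = y" if "x \<in> E" "y \<in> E" "W y = x" for x y
    by (rule inj_onD[OF surj(1) _ Y(1)[OF that(1)] that(2)]) (rule trans[OF Y(2)[OF that(1)] that(3)[symmetric]])
  have Yadd: "Y (x + y) = Y x + Y y" if "x \<in> E" "y \<in> E" for x y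
    by (rule Yuniq)
      (simp_all add: clin_add[OF W(1)] Y(2)[OF that(1)] Y(2)[OF that(2)] cvs.subspace_add[OF E(1)] that Y(1)[OF that(1)] Y(1)[OF that(2)])
  have Yscale: "Y (scaleC c x) = scaleC c (Y x)" if "x \<in> E" for x c
    by (rule Yuniq)
      (simp_all add: clin_scale[OF W(1)] Y(2)[OF that] Y(1)[OF that] cvs.subspace_scale[OF E(1)] that)
  define \<gamma> where "\<gamma> x y = \<beta> (Y x) (Y y)" for x y
  have hg: "herm E \<gamma>"
    unfolding \<gamma>_def
  proof (rule hermI)
    fix x y assume xy: "x \<in> E" "y \<in> E"
    show "\<beta> (Y y) (Y x) = cnj (\<beta> (Y x) (Y y))" by (rule herm_sym[OF h Y(1)[OF xy(1)] Y(1)[OF xy(2)]])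
  qed (simp_all add: Yadd Yscale Y herm_add_right[OF h] herm_scale_right[OF h])
  obtain D where D: "onb D E" and diag: "\<And>a b. a \<in> D \<Longrightarrow> b \<in> D \<Longrightarrow> a \<noteq> b \<Longrightarrow> \<gamma> a b = 0"
    using herm_diagonalization[OF hg E] by blast
  have D': "finite D" "orthonormal D" "cvs.span D = E" "D \<subseteq> E"
    using D by (auto simp: onb_def intro: cvs.span_base)
  define a where "a d = Re (\<gamma> d d)" for d
  have gd: "\<gamma> d d = of_real (a d)" if "d \<in> D" for d
    using herm_self_real[OF hg, of d] that D'(4) by (auto simp: a_def)
  have Gd: "G (Y d) = scaleC (of_real (a d)) d" if d: "d \<in> D" for d
  proof -
    have dE: "d \<in> E" using d D' by auto
    have "G (Y d) = (\<Sum>e\<in>D. scaleC (cinner e (G (Y d))) e)"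
      by (rule onb_expand[OF D]) (use G Y dE in auto)
    also have "\<dots> = (\<Sum>e\<in>D. scaleC (if e = d then of_real (a d) else 0) e)"
    proof (rule sum.cong[OF refl])
      fix e assume e: "e \<in> D"
      then have eE: "e \<in> E" using D' by auto
      have "cinner e (G (Y d)) = \<gamma> e d" unfolding \<gamma>_def
        using rel[of "Y e" "Y d"] Y eE dE by simp
      then show "scaleC (cinner e (G (Y d))) e = scaleC (if e = d then of_real (a d) else 0) e"
        using diag[OF e d] gd[OF d] by auto
    qed
    also have "\<dots> = scaleC (of_real (a d)) d" using d D'(1) by (simp add: if_distrib[of "\<lambda>c. scaleC c _"] cong: if_cong)
    finally show ?thesis .
  qed
  define x where "x c = (\<Sum>d\<in>D. scaleC (c d) (Y d))" for c
  have xE: "x c \<in> E" for c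
    unfolding x_def using D'(4) Y E by (intro cvs.subspace_sum cvs.subspace_scale) auto
  have Wx: "W (x c) = (\<Sum>d\<in>D. scaleC (c d) d)" for c
    unfolding x_def clin_sum[OF W(1)] using D'(4) Y by (intro sum.cong) (auto simp: clin_scale[OF W(1)])
  have Gx: "G (x c) = (\<Sum>d\<in>D. scaleC (c d * of_real (a d)) d)" for c
    unfolding x_def clin_sum[OF G(1)] using Gd by (intro sum.cong) (auto simp: clin_scale[OF G(1)])
  have cc: "cnj z * z = of_real ((cmod z)\<^sup>2)" for z by (simp add: complex_norm_square mult.commute del: of_real_power)
  have nW: "(norm (W (x c)))\<^sup>2 = (\<Sum>d\<in>D. (cmod (c d))\<^sup>2)" for c
    unfolding Re_cinner_self[symmetric] Wx onb_cinner[OF D] cc by simp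
  have nG: "(norm (G (x c)))\<^sup>2 = (\<Sum>d\<in>D. (a d)\<^sup>2 * (cmod (c d))\<^sup>2)" for c
    unfolding Re_cinner_self[symmetric] Gx onb_cinner[OF D] cc
    by (simp add: norm_mult power_mult_distrib mult.commute)
  have qx: "Re (\<beta> (x c) (x c)) = (\<Sum>d\<in>D. a d * (cmod (c d))\<^sup>2)" for c
  proof -
    have "\<beta> (x c) (x c) = (\<Sum>d\<in>D. (cnj (c d) * c d) * of_real (a d))"
      unfolding rel[OF xE xE] Wx Gx onb_cinner[OF D] by (simp add: mult.assoc)
    then show ?thesis unfolding cc by (simp add: mult.commute)
  qed
  have key: "\<forall>d\<in>D. c d = 0" if "x c = 0" for c
  proof
    fix d assume "d \<in> D"
    have "(\<Sum>d\<in>D. (cmod (c d))\<^sup>2) = 0" using nW[of c] that clin_zero[OF W(1)] by simp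
    then show "c d = 0" using sum_nonneg_eq_0_iff[OF D'(1), of "\<lambda>d. (cmod (c d))\<^sup>2"] \<open>d \<in> D\<close> by simp
  qed
  have fam: "inj_on Y D" "cvs.independent (Y ` D)"
    by (rule independent_familyI[OF D'(1)], rule key, simp add: x_def)+
  have spY: "cvs.span (Y ` D) = E"
  proof
    show "cvs.span (Y ` D) \<subseteq> E" using D'(4) Y E by (intro cvs.span_minimal) auto
    show "E \<subseteq> cvs.span (Y ` D)"
    proof
      fix y assume y: "y \<in> E"
      define c where "c d = cinner d (W y)" for d
      have "W (x c) = W y" unfolding Wx c_def using onb_expand[OF D W(2)[OF y]] by simp
      then have "x c = y" by (rule inj_onD[OF surj(1) _ xE y])
      then have "y = x c" by (rule sym)
      then show "y \<in> cvs.span (Y ` D)"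
        unfolding x_def by (auto intro: cvs.span_sum cvs.span_scale cvs.span_base)
    qed
  qed
  have ix: "has_index E q (card {d\<in>D. r d < 0})"
    if "\<And>c. q (x c) = (\<Sum>d\<in>D. r d * (cmod (c d))\<^sup>2)" for q r
    by (rule has_index_diag[OF D'(1) fam spY]) (use that x_def in auto)
  have i1: "has_index E (\<lambda>x. Re (\<beta> x x)) (card {d\<in>D. a d < 0})"
    by (rule ix) (rule qx)
  have i2: "has_index E (\<lambda>x. Re (\<beta> x x) + C * (norm (W x))\<^sup>2) (card {d\<in>D. a d + C < 0})"
    by (rule ix) (simp add: qx nW sum_distrib_left sum.distrib distrib_right)
  have i3: "has_index E (\<lambda>x. Re (\<beta> x x) + (norm (G x))\<^sup>2 / C) (card {d\<in>D. a d + (a d)\<^sup>2 / C < 0})"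
    by (rule ix) (simp add: qx nG sum_divide_distrib sum.distrib distrib_right)
  have i4: "has_index E (\<lambda>x. - (Re (\<beta> x x) + (norm (G x))\<^sup>2 / C)) (card {d\<in>D. - (a d + (a d)\<^sup>2 / C) < 0})"
    by (rule ix) (simp add: qx nG sum_divide_distrib sum.distrib left_diff_distrib sum_subtractf sum_negf)
  note si = strict_index_imp_has_index[OF st E(1)]
  have ii: "i = card {d\<in>D. a d < 0}" by (rule has_index_unique[OF idx i1])
  have n0: "n0 = card {d\<in>D. a d + (a d)\<^sup>2 / C < 0}" by (rule has_index_unique[OF si(1) i3])
  have m0: "m0 = card {d\<in>D. - (a d + (a d)\<^sup>2 / C) < 0}" by (rule has_index_unique[OF si(2) i4])
  \<comment> \<open>The strictly negative and strictly positive entries number n0 and m0, which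
    together give dim E; hence no entry a + a^2 / C is zero.\<close>
  have "card {d\<in>D. a d + (a d)\<^sup>2 / C < 0} + card {d\<in>D. - (a d + (a d)\<^sup>2 / C) < 0} = card D"
    using strict_index_dim[OF st D] n0 m0 by simp
  moreover have "{d\<in>D. a d + (a d)\<^sup>2 / C \<noteq> 0}
      = {d\<in>D. a d + (a d)\<^sup>2 / C < 0} \<union> {d\<in>D. - (a d + (a d)\<^sup>2 / C) < 0}"
    by auto
  then have "card {d\<in>D. a d + (a d)\<^sup>2 / C < 0} + card {d\<in>D. - (a d + (a d)\<^sup>2 / C) < 0}
     = card {d\<in>D. a d + (a d)\<^sup>2 / C \<noteq> 0}"
    using D'(1) card_Un_disjoint[of "{d\<in>D. a d + (a d)\<^sup>2 / C < 0}" "{d\<in>D. - (a d + (a d)\<^sup>2 / C) < 0}"]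
    by fastforce
  ultimately have "{d\<in>D. a d + (a d)\<^sup>2 / C \<noteq> 0} = D" using D'(1) by (intro card_subset_eq) auto
  then have nz: "a d + (a d)\<^sup>2 / C \<noteq> 0" if "d \<in> D" for d using that by blast
  have both: "(a d < 0 \<longleftrightarrow> a d + C < 0 \<or> a d + (a d)\<^sup>2 / C < 0)
      \<and> \<not> (a d + C < 0 \<and> a d + (a d)\<^sup>2 / C < 0)" if d: "d \<in> D" for d
  proof -
    have f: "a d + (a d)\<^sup>2 / C = a d * (C + a d) / C" for d using C by (simp add: field_simps power2_eq_square)
    have "a d + C \<noteq> 0" using nz[OF d] unfolding f by (auto simp: add.commute)
    then show ?thesis
      unfolding f using C by (auto simp: divide_less_0_iff mult_less_0_iff)
  qed
  have "{d\<in>D. a d < 0} = {d\<in>D. a d + C < 0} \<union> {d\<in>D. a d + (a d)\<^sup>2 / C < 0}"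
    using both by blast
  moreover have "{d\<in>D. a d + C < 0} \<inter> {d\<in>D. a d + (a d)\<^sup>2 / C < 0} = {}" using both by blast
  ultimately have "i = card {d\<in>D. a d + C < 0} + n0"
    unfolding ii n0 using D'(1) by (simp add: card_Un_disjoint)
  then show "n0 \<le> i" "has_index E (\<lambda>x. Re (\<beta> x x) + C * (norm (W x))\<^sup>2) (i - n0)" using i2 by auto
qed

lemma herm_uminus:
  assumes "herm Y \<beta>"
  shows "herm Y (\<lambda>x y. - \<beta> x y)"
proof (rule hermI)
  fix x y assume "x \<in> Y" "y \<in> Y"
  then show "- \<beta> y x = cnj (- \<beta> x y)" using herm_sym[OF assms, of x y] by simp
qed (simp_all add: herm_add_right[OF assms] herm_scale_right[OF assms])

text \<open>The flip $a + b \mapsto a - b$ changes the sign of the form on a sum of isotropic subspaces.\<close>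
lemma isotropic_index_le:
  assumes h: "herm Y \<beta>" "cvs.subspace Y" and A: "cvs.subspace A" "A \<subseteq> Y" and B: "cvs.subspace B" "B \<subseteq> Y"
    and isoA: "\<And>x y. x \<in> A \<Longrightarrow> y \<in> A \<Longrightarrow> \<beta> x y = 0" and isoB: "\<And>x y. x \<in> B \<Longrightarrow> y \<in> B \<Longrightarrow> \<beta> x y = 0"
    and X: "X = {a + b |a b. a \<in> A \<and> b \<in> B}"
    and i: "has_index X (\<lambda>x. Re (\<beta> x x)) n" "has_index X (\<lambda>x. - Re (\<beta> x x)) m"
  shows "n \<le> m"
proof -
  obtain N P where N: "finite N" "cvs.independent N" "card N = n" "cvs.span N \<subseteq> X"
    "cvs.subspace P" "P \<subseteq> X" "\<And>x. x \<in> X \<Longrightarrow> \<exists>a\<in>cvs.span N. x - a \<in> P"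
    "\<And>x. x \<in> cvs.span N \<Longrightarrow> x \<noteq> 0 \<Longrightarrow> Re (\<beta> x x) < 0" "\<And>x. x \<in> P \<Longrightarrow> 0 \<le> Re (\<beta> x x)"
    by (rule has_indexE[OF i(1)]) (rule that)
  have "\<forall>x\<in>N. \<exists>a\<in>A. \<exists>b\<in>B. x = a + b" using N(4) cvs.span_superset[of N] unfolding X by blast
  then obtain a b where ab: "\<And>x. x \<in> N \<Longrightarrow> a x \<in> A" "\<And>x. x \<in> N \<Longrightarrow> b x \<in> B" "\<And>x. x \<in> N \<Longrightarrow> x = a x + b x"
    by metis
  define v where "v x = a x - b x" for x
  have quad: "Re (\<beta> (p + s) (p + s)) = 2 * Re (\<beta> p s)" if "p \<in> A" "s \<in> B" for p s
    using herm_quad_add[OF h, of p s] isoA[OF that(1,1)] isoB[OF that(2,2)] that A B by auto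
  have main: "(\<Sum>x\<in>N. scaleC (c x) (v x)) \<in> X
      \<and> Re (\<beta> (\<Sum>x\<in>N. scaleC (c x) (v x)) (\<Sum>x\<in>N. scaleC (c x) (v x)))
        = - Re (\<beta> (\<Sum>x\<in>N. scaleC (c x) x) (\<Sum>x\<in>N. scaleC (c x) x))" for c
  proof -
    define p where "p = (\<Sum>x\<in>N. scaleC (c x) (a x))"
    define s where "s = (\<Sum>x\<in>N. scaleC (c x) (b x))"
    have p: "p \<in> A" unfolding p_def using ab A by (intro cvs.subspace_sum cvs.subspace_scale) auto
    have s: "s \<in> B" unfolding s_def using ab B by (intro cvs.subspace_sum cvs.subspace_scale) auto
    have ms: "- s \<in> B" using s B by (simp add: cvs.subspace_neg)
    have 1: "(\<Sum>x\<in>N. scaleC (c x) x) = p + s"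
      unfolding p_def s_def sum.distrib[symmetric] cvs.scale_right_distrib[symmetric]
      using ab(3) by (intro sum.cong) auto
    have 2: "(\<Sum>x\<in>N. scaleC (c x) (v x)) = p + (- s)"
      by (simp add: v_def p_def s_def cvs.scale_right_diff_distrib sum_subtractf)
    have "\<beta> p (- s) = - \<beta> p s" using herm_minus_right[OF h(1), of p s] p s A B by auto
    moreover have "p + (- s) \<in> X" unfolding X using p ms by blast
    ultimately show ?thesis unfolding 1 2 quad[OF p s] quad[OF p ms] by simp
  qed
  \<comment> \<open>If a combination of the flipped vectors vanishes, the unflipped one has form
    value 0 as well, and negative definiteness on span N makes it zero.\<close>
  have fam: "\<forall>x\<in>N. c x = 0" if z: "(\<Sum>x\<in>N. scaleC (c x) (v x)) = 0" for c
  proof -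
    let ?x = "\<Sum>x\<in>N. scaleC (c x) x"
    have "Re (\<beta> ?x ?x) = 0" using main[of c] z herm_zero_right[OF h, of 0] cvs.subspace_0[OF h(2)] by simp
    moreover have "?x \<in> cvs.span N" by (auto intro: cvs.span_sum cvs.span_scale cvs.span_base)
    ultimately have "?x = 0" using N(8) by force
    then show ?thesis using cvs.independentD[OF N(2,1)] by blast
  qed
  have fam': "inj_on v N" "cvs.independent (v ` N)"
    by (rule independent_familyI[OF N(1)], rule fam, assumption)+
  have el: "y \<in> X \<and> (y \<noteq> 0 \<longrightarrow> - Re (\<beta> y y) < 0)" if y: "y \<in> cvs.span (v ` N)" for y
  proof -
    obtain c where c: "y = (\<Sum>x\<in>N. scaleC (c x) (v x))" using span_family[OF N(1) y] by blast
    let ?x = "\<Sum>x\<in>N. scaleC (c x) x"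
    have "?x \<in> cvs.span N" by (auto intro: cvs.span_sum cvs.span_scale cvs.span_base)
    moreover have "?x \<noteq> 0" if "y \<noteq> 0"
    proof
      assume "?x = 0"
      then have "\<forall>x\<in>N. c x = 0" using cvs.independentD[OF N(2,1)] by blast
      then show False using that c by simp
    qed
    ultimately show ?thesis using main[of c] N(8)[of ?x] c by auto
  qed
  have "card (v ` N) \<le> m"
    by (rule has_index_bound[OF i(2) _ fam'(2)]) (use N(1) el in auto)
  then show ?thesis using card_image[OF fam'(1)] N(3) by simp
qed

lemma isotropic_index_eq:
  assumes h: "herm Y \<beta>" "cvs.subspace Y" and A: "cvs.subspace A" "A \<subseteq> Y" and B: "cvs.subspace B" "B \<subseteq> Y"
    and isoA: "\<And>x y. x \<in> A \<Longrightarrow> y \<in> A \<Longrightarrow> \<beta> x y = 0" and isoB: "\<And>x y. x \<in> B \<Longrightarrow> y \<in> B \<Longrightarrow> \<beta> x y = 0"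
    and X: "X = {a + b |a b. a \<in> A \<and> b \<in> B}"
    and i: "has_index X (\<lambda>x. Re (\<beta> x x)) n" "has_index X (\<lambda>x. - Re (\<beta> x x)) m"
  shows "n = m"
proof (rule antisym)
  show "n \<le> m" by (rule isotropic_index_le[OF assms])
  show "m \<le> n"
    by (rule isotropic_index_le[OF herm_uminus[OF h(1)] h(2) A B _ _ X]) (use isoA isoB i in auto)
qed

section \<open>Signature of a Hermitian matrix\<close>

lemma order_prod_linear_factors:
  "order r (\<Prod>a\<leftarrow>ds. [:- a, 1:]) = count_list ds (r::complex)"
proof (induction ds)
  case (Cons a ds)
  have o1: "order r [:- a, 1:] = (if a = r then 1 else 0)"
    using order_power_n_n[of a 1] order_0I[of "[:- a, 1:]" r] by auto
  define p where "p = (\<Prod>a\<leftarrow>ds. [:- a, 1:])"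
  have "p \<noteq> 0" by (auto simp: prod_list_zero_iff p_def)
  then have "[:- a, 1:] * p \<noteq> 0" by (simp del: mult_pCons_left)
  from order_mult[OF this, of r]
  have "order r ([:- a, 1:] * (\<Prod>a\<leftarrow>ds. [:- a, 1:])) = (if a = r then 1 else 0) + count_list ds r"
    unfolding o1 p_def Cons.IH .
  then show ?case by (auto simp del: mult_pCons_left)
qed simp

lemma poly_prod_linear_factors:
  "poly (\<Prod>a\<leftarrow>ds. [:- a, 1:]) r = 0 \<longleftrightarrow> r \<in> set (ds :: complex list)"
  by (induction ds) auto

lemma sum_count_list_filter:
  "(\<Sum>r\<in>{r. r \<in> set ds \<and> Q r}. count_list ds r) = length (filter Q ds)"
proof -
  have "length (filter Q ds) = (\<Sum>r\<in>set (filter Q ds). count_list (filter Q ds) r)"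
    by (rule sum_count_set[symmetric]) auto
  also have "\<dots> = (\<Sum>r\<in>{r. r \<in> set ds \<and> Q r}. count_list ds r)"
    by (rule sum.cong) (auto simp: count_list_eq_length_filter intro!: arg_cong[where f = length] filter_cong)
  finally show ?thesis by simp
qed

text \<open>P and Q are the mutually inverse change-of-basis matrices between es and the
  diagonalising basis fs, so the Gram matrix is similar to a diagonal one.\<close>

lemma hermitian_matrix_char_poly:
  assumes h: "herm E \<beta>" and E: "cvs.subspace E"
    and es: "onb (set es) E" "distinct es" and fs: "onb (set fs) E" "distinct fs"
    and diag: "\<And>a b. a \<in> set fs \<Longrightarrow> b \<in> set fs \<Longrightarrow> a \<noteq> b \<Longrightarrow> \<beta> a b = 0"
  shows "char_poly (mat (length es) (length es) (\<lambda>(i, j). \<beta> (es ! i) (es ! j)))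
     = (\<Prod>a\<leftarrow>map (\<lambda>b. \<beta> b b) fs. [:- a, 1:])"
proof -
  define n where "n = length es"
  have e': "finite (set es)" "orthonormal (set es)" "cvs.span (set es) = E" "set es \<subseteq> E"
    using es(1) by (auto simp: onb_def intro: cvs.span_base)
  have f': "finite (set fs)" "orthonormal (set fs)" "cvs.span (set fs) = E" "set fs \<subseteq> E"
    using fs(1) by (auto simp: onb_def intro: cvs.span_base)
  have "card (set es) = card (set fs)"
    using cvs.independent_span_bound[OF e'(1) orthonormal_independent[OF f'(2,1)]]
      cvs.independent_span_bound[OF f'(1) orthonormal_independent[OF e'(2,1)]] e' f' by auto
  then have nf: "length fs = n" by (simp add: n_def distinct_card es fs)
  have idx: "(\<Sum>k\<in>{0..<n}. g (fs ! k)) = (\<Sum>f\<in>set fs. g f)" for g :: "'a \<Rightarrow> complex"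
    using sum.reindex_bij_betw[OF bij_betw_nth[OF fs(2) refl refl], of g] nf by (simp add: lessThan_atLeast0)
  define P where "P = mat n n (\<lambda>(i, j). cinner (es ! i) (fs ! j))"
  define Q where "Q = mat n n (\<lambda>(i, j). cinner (fs ! i) (es ! j))"
  define D where "D = mat n n (\<lambda>(i, j). if i = j then \<beta> (fs ! i) (fs ! i) else 0)"
  define M where "M = mat n n (\<lambda>(i, j). \<beta> (es ! i) (es ! j))"
  have esE: "es ! i \<in> E" if "i < n" for i using that e'(4) by (auto simp: n_def)
  have carr: "{M, D, P, Q} \<subseteq> carrier_mat n n" by (simp add: M_def D_def P_def Q_def)
  have "P * Q = 1\<^sub>m n"
  proof (rule eq_matI)
    fix i j assume ij: "i < dim_row (1\<^sub>m n :: complex mat)" "j < dim_col (1\<^sub>m n :: complex mat)"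
    then have "(P * Q) $$ (i, j) = (\<Sum>k\<in>{0..<n}. cinner (es ! i) (fs ! k) * cinner (fs ! k) (es ! j))"
      by (simp add: P_def Q_def scalar_prod_def)
    also have "\<dots> = (\<Sum>f\<in>set fs. cinner (es ! i) f * cinner f (es ! j))" by (rule idx)
    also have "\<dots> = cinner (es ! i) (\<Sum>f\<in>set fs. scaleC (cinner f (es ! j)) f)"
      by (simp add: cinner_sum_right cinner_scaleC_right mult.commute)
    also have "\<dots> = cinner (es ! i) (es ! j)" using onb_expand[OF fs(1) esE[of j]] ij by simp
    also have "\<dots> = (1\<^sub>m n :: complex mat) $$ (i, j)"
      using e'(2) ij es(2) by (auto simp: orthonormal_def n_def nth_eq_iff_index_eq)
    finally show "(P * Q) $$ (i, j) = (1\<^sub>m n :: complex mat) $$ (i, j)" .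
  qed (simp_all add: P_def Q_def)
  then have "Q * P = 1\<^sub>m n" using mat_mult_left_right_inverse[of P n Q] carr by auto
  have PD: "P * D = mat n n (\<lambda>(i, j). cinner (es ! i) (fs ! j) * \<beta> (fs ! j) (fs ! j))"
    by (rule eq_matI) (auto simp: P_def D_def scalar_prod_def if_distrib[of "\<lambda>x. _ * x"] cong: if_cong)
  have "M = P * D * Q"
  proof (rule eq_matI)
    fix i j assume "i < dim_row (P * D * Q)" "j < dim_col (P * D * Q)"
    then have ij: "i < n" "j < n" by (auto simp: PD Q_def)
    have fE: "f \<in> E" if "f \<in> set fs" for f using that f' by auto
    have sE: "scaleC c f \<in> E" if "f \<in> set fs" for f c using fE[OF that] E by (rule cvs.subspace_scale[rotated])
    have "\<beta> (es ! i) (es ! j) = \<beta> (es ! i) (\<Sum>f\<in>set fs. scaleC (cinner f (es ! j)) f)"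
      using onb_expand[OF fs(1) esE[OF ij(2)]] by simp
    also have "\<dots> = (\<Sum>f\<in>set fs. cinner f (es ! j) * \<beta> (es ! i) f)"
      using herm_sum_right[OF h E esE[OF ij(1)], of "set fs" "\<lambda>f. scaleC (cinner f (es ! j)) f"] sE
        herm_scale_right[OF h esE[OF ij(1)] fE] by simp
    also have "\<dots> = (\<Sum>f\<in>set fs. cinner (es ! i) f * \<beta> f f * cinner f (es ! j))"
    proof (rule sum.cong[OF refl])
      fix f assume f: "f \<in> set fs"
      have "\<beta> (es ! i) f = \<beta> (\<Sum>g\<in>set fs. scaleC (cinner g (es ! i)) g) f"
        using onb_expand[OF fs(1) esE[OF ij(1)]] by simp
      also have "\<dots> = (\<Sum>g\<in>set fs. \<beta> (scaleC (cinner g (es ! i)) g) f)"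
        using herm_sum_left[OF h E fE[OF f], of "set fs"] sE by simp
      also have "\<dots> = (\<Sum>g\<in>set fs. if g = f then cinner (es ! i) f * \<beta> f f else 0)"
      proof (rule sum.cong[OF refl])
        fix g assume g: "g \<in> set fs"
        show "\<beta> (scaleC (cinner g (es ! i)) g) f = (if g = f then cinner (es ! i) f * \<beta> f f else 0)"
          using herm_scale_left[OF h E fE[OF g] fE[OF f]] diag[OF g f] cinner_commute[of f "es ! i"] by auto
      qed
      also have "\<dots> = cinner (es ! i) f * \<beta> f f" using f by simp
      finally show "cinner f (es ! j) * \<beta> (es ! i) f = cinner (es ! i) f * \<beta> f f * cinner f (es ! j)"
        by (simp add: mult_ac)
    qed
    also have "\<dots> = (\<Sum>k\<in>{0..<n}. cinner (es ! i) (fs ! k) * \<beta> (fs ! k) (fs ! k) * cinner (fs ! k) (es ! j))"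
      by (rule idx[symmetric])
    also have "\<dots> = (P * D * Q) $$ (i, j)"
      using ij by (simp add: PD Q_def scalar_prod_def)
    finally show "M $$ (i, j) = (P * D * Q) $$ (i, j)" using ij by (simp add: M_def)
  qed (simp_all add: PD M_def Q_def)
  then have "similar_mat M D"
    using similar_matI[OF carr \<open>P * Q = 1\<^sub>m n\<close> \<open>Q * P = 1\<^sub>m n\<close>] by simp
  then have "char_poly M = char_poly D" by (rule char_poly_similar)
  also have "\<dots> = (\<Prod>a\<leftarrow>diag_mat D. [:- a, 1:])"
    by (rule char_poly_upper_triangular[of _ n]) (auto simp: D_def upper_triangular_def)
  also have "diag_mat D = map (\<lambda>b. \<beta> b b) fs"
    by (rule nth_equalityI) (auto simp: diag_mat_def D_def nf)
  finally show ?thesis unfolding M_def n_def .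
qed

text \<open>The diagonal values of a Hermitian form are real, so the roots selected by
  \<open>nu_neg\<close> and \<open>nu_pos\<close>, counted with algebraic multiplicity, are exactly
  the negative and positive diagonal entries.\<close>

lemma hermitian_matrix_signature:
  assumes h: "herm E \<beta>" and E: "cvs.subspace E" and es: "onb (set es) E" "distinct es"
  defines "M \<equiv> mat (length es) (length es) (\<lambda>(i, j). \<beta> (es ! i) (es ! j))"
  shows "has_index E (\<lambda>x. Re (\<beta> x x)) (nu_neg M)" "has_index E (\<lambda>x. - Re (\<beta> x x)) (nu_pos M)"
proof -
  obtain B where B: "onb B E" and diag: "\<And>a b. a \<in> B \<Longrightarrow> b \<in> B \<Longrightarrow> a \<noteq> b \<Longrightarrow> \<beta> a b = 0"
    using herm_diagonalization[OF h E onb_fin_dim[OF es(1)]] by blast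
  have B': "finite B" "B \<subseteq> E" using B by (auto simp: onb_def intro: cvs.span_base)
  obtain fs where fs: "set fs = B" "distinct fs" using finite_distinct_list[OF B'(1)] by blast
  define ds where "ds = map (\<lambda>b. \<beta> b b) fs"
  have cp: "char_poly M = (\<Prod>a\<leftarrow>ds. [:- a, 1:])"
    unfolding M_def ds_def using hermitian_matrix_char_poly[OF h E es, of fs] fs B diag by blast
  have "\<beta> b b = of_real (Re (\<beta> b b))" if "b \<in> B" for b
    using herm_self_real[OF h] that B'(2) by blast
  then have "\<beta> b b \<in> \<real>" if "b \<in> B" for b using that by (metis Reals_of_real)
  then have real: "r \<in> \<real>" if "r \<in> set ds" for r using that fs(1) by (auto simp: ds_def)
  have cnt: "length (filter Q ds) = card {b\<in>B. Q (\<beta> b b)}" for Q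
    unfolding ds_def filter_map length_map o_def
    using distinct_card[OF distinct_filter[OF fs(2)]] fs(1) by (simp add: set_filter)
  have "nu_neg M = length (filter (\<lambda>r. Re r < 0) ds)"
    unfolding nu_neg_def cp order_prod_linear_factors poly_prod_linear_factors sum_count_list_filter[symmetric]
    using real by (intro sum.cong) auto
  then have neg: "nu_neg M = card {b\<in>B. Re (\<beta> b b) < 0}" using cnt by simp
  have "nu_pos M = length (filter (\<lambda>r. Re r > 0) ds)"
    unfolding nu_pos_def cp order_prod_linear_factors poly_prod_linear_factors sum_count_list_filter[symmetric]
    using real by (intro sum.cong) auto
  then have pos: "nu_pos M = card {b\<in>B. Re (\<beta> b b) > 0}" using cnt by simp
  show "has_index E (\<lambda>x. Re (\<beta> x x)) (nu_neg M)"
    unfolding neg by (rule has_index_herm[OF h E B diag])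
  show "has_index E (\<lambda>x. - Re (\<beta> x x)) (nu_pos M)"
    using has_index_herm[OF herm_uminus[OF h] E B] diag unfolding pos by simp
qed

section \<open>Operators invertible up to finite rank\<close>

text \<open>R inverts A on both sides up to one and the same finite-rank operator P. This is the
  form in which the Riesz contour integral delivers invertibility at an isolated eigenvalue.\<close>

locale parametrix =
  fixes A R P :: "'k::chilbert \<Rightarrow> 'k" and M L :: real
  assumes A: "clin A" and A_bound: "\<And>x. norm (A x) \<le> M * norm x"
    and R: "clin R" and R_bound: "\<And>x. norm (R x) \<le> L * norm x"
    and P: "clin P" and P_fin: "fin_dim (range P)"
    and RA: "\<And>x. R (A x) = x - P x" and AR: "\<And>x. A (R x) = x - P x"
begin

text \<open>The generalised kernel of A; for A = e^{-i t_0} T - 1 it is the generalised eigenspace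
  of T at e^{i t_0}.\<close>

definition E where "E = {x. \<exists>n. (A ^^ n) x = 0}"

lemma pow_clin: "clin (A ^^ n)"
  by (induction n) (auto simp: clin_def clin_add[OF A] clin_scale[OF A])

lemma pow_zero: "(A ^^ n) 0 = 0"
  by (rule clin_zero[OF pow_clin])

lemma pow_mono: "(A ^^ n) x = 0 \<Longrightarrow> n \<le> m \<Longrightarrow> (A ^^ m) x = 0"
  by (metis funpow_add o_apply le_add_diff_inverse2 pow_zero)

lemma pow_Suc': "(A ^^ Suc n) x = (A ^^ n) (A x)"
  by (simp add: funpow_swap1)

lemma E_subspace: "cvs.subspace E"
proof (rule cvs.subspaceI)
  show "0 \<in> E" using pow_zero by (auto simp: E_def)
  fix x y assume "x \<in> E" "y \<in> E"
  then obtain m n where "(A ^^ m) x = 0" "(A ^^ n) y = 0" by (auto simp: E_def)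
  then have "(A ^^ max m n) x = 0" "(A ^^ max m n) y = 0" using pow_mono by auto
  then have "(A ^^ max m n) (x + y) = 0" by (simp add: clin_add[OF pow_clin])
  then show "x + y \<in> E" by (auto simp: E_def)
next
  fix c x assume "x \<in> E"
  then obtain m where "(A ^^ m) x = 0" by (auto simp: E_def)
  then have "(A ^^ m) (scaleC c x) = 0" by (simp add: clin_scale[OF pow_clin])
  then show "scaleC c x \<in> E" by (auto simp: E_def)
qed

text \<open>Evaluate A R A x by bracketing it in the two possible ways; \<open>R_P\<close> comes
  from R A R x.\<close>

lemma A_P: "A (P x) = P (A x)"
proof -
  have "A (R (A x)) = A x - A (P x)" by (simp add: RA clin_diff[OF A])
  moreover have "A (R (A x)) = A x - P (A x)" by (rule AR)
  ultimately show ?thesis by simp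
qed

lemma R_P: "R (P x) = P (R x)"
proof -
  have "R (A (R x)) = R x - R (P x)" by (simp add: AR clin_diff[OF R])
  moreover have "R (A (R x)) = R x - P (R x)" by (rule RA)
  ultimately show ?thesis by simp
qed

lemma range_P_subspace: "cvs.subspace (range P)"
  using module_hom.subspace_image[OF clin_module_hom[OF P] cvs.subspace_UNIV] .

lemma pow_range_P: "x \<in> range P \<Longrightarrow> (A ^^ n) x \<in> range P"
proof (induction n)
  case (Suc n)
  then obtain y where "(A ^^ n) x = P y" by auto
  then show ?case using A_P by auto
qed simp

text \<open>If A x = P y then x = P x + R (A x) = P (x + R y), so membership in the range of P
  climbs from A x to x. All generalised null vectors thus lie in one finite-dimensional
  space.\<close>

lemma ker_pow_range_P: "(A ^^ n) x = 0 \<Longrightarrow> x \<in> range P"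
proof (induction n arbitrary: x)
  case 0
  then have "x = P 0" using clin_zero[OF P] by simp
  then show ?case by blast
next
  case (Suc n)
  then have "A x \<in> range P" by (simp add: pow_Suc' del: funpow.simps)
  then obtain y where y: "A x = P y" by blast
  have "x = P x + R (A x)" by (simp add: RA)
  also have "\<dots> = P (x + R y)" by (simp add: y R_P clin_add[OF P])
  finally show ?case by blast
qed

lemma E_fin_dim: "fin_dim E"
  by (rule fin_dim_subset[OF P_fin]) (auto simp: E_def intro: ker_pow_range_P)

lemma E_nilpotent: obtains N where "\<And>x. x \<in> E \<Longrightarrow> (A ^^ N) x = 0"
proof -
  obtain B where B: "finite B" "cvs.independent B" "cvs.span B = E"
    using fin_dim_basis[OF E_fin_dim E_subspace] .
  have "\<forall>b\<in>B. \<exists>n. (A ^^ n) b = 0" using cvs.span_superset[of B] unfolding B(3) by (auto simp: E_def)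
  then obtain n where n: "\<And>b. b \<in> B \<Longrightarrow> (A ^^ n b) b = 0" by metis
  define N where "N = Max (insert 0 (n ` B))"
  have N: "(A ^^ N) b = 0" if "b \<in> B" for b
    using n[OF that] by (rule pow_mono) (use B(1) that in \<open>auto simp: N_def\<close>)
  have "(A ^^ N) x = 0" if "x \<in> E" for x
    by (rule module_hom.eq_0_on_span[OF clin_module_hom[OF pow_clin], of B]) (use N that B(3) in simp_all)
  then show ?thesis using that by blast
qed

text \<open>The Fitting decomposition. Since A R = 1 - P, every vector reduces modulo the range of
  A^N to the range of P. On the finite-dimensional space A^N (range P) the map A^N is injective,
  because A^{2N} r = 0 already gives A^N r = 0, and therefore onto.\<close>

lemma E_plus_range:
  assumes N: "\<And>x. x \<in> E \<Longrightarrow> (A ^^ N) x = 0"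
  shows "\<exists>e\<in>E. \<exists>y. x = e + (A ^^ N) y"
proof -
  have dec: "\<exists>y. \<exists>p\<in>range P. x = (A ^^ n) y + p" for n
  proof (induction n)
    case 0
    have "x = (A ^^ 0) x + P 0" by (simp add: clin_zero[OF P])
    then show ?case by blast
  next
    case (Suc n)
    then obtain y p where y: "p \<in> range P" "x = (A ^^ n) y + p" by blast
    have "(A ^^ n) y = (A ^^ n) (A (R y)) + (A ^^ n) (P y)"
      unfolding clin_add[OF pow_clin, symmetric] by (simp add: AR)
    then have "x = (A ^^ Suc n) (R y) + ((A ^^ n) (P y) + p)"
      unfolding pow_Suc' using y(2) by (simp add: add.assoc)
    moreover have "(A ^^ n) (P y) + p \<in> range P"
      by (rule cvs.subspace_add[OF range_P_subspace pow_range_P[OF rangeI] y(1)])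
    ultimately show ?case by blast
  qed
  define R' where "R' = (A ^^ N) ` range P"
  have R's: "cvs.subspace R'" unfolding R'_def
    by (rule module_hom.subspace_image[OF clin_module_hom[OF pow_clin] range_P_subspace])
  have R'P: "R' \<subseteq> range P" unfolding R'_def using pow_range_P by blast
  have "(A ^^ N) ` R' = R'"
  proof (rule fin_dim_injective_surjective(2)[OF R's _ pow_clin])
    show "fin_dim R'" by (rule fin_dim_subset[OF P_fin R'P])
    show "(A ^^ N) x \<in> R'" if "x \<in> R'" for x using that R'P unfolding R'_def by blast
    show "x = 0" if x: "x \<in> R'" "(A ^^ N) x = 0" for x
    proof -
      obtain r where r: "x = (A ^^ N) r" using x(1) by (auto simp: R'_def)
      then have "(A ^^ (N + N)) r = 0" using x(2) by (simp add: funpow_add)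
      then have "r \<in> E" by (auto simp: E_def)
      then show "x = 0" using N r by simp
    qed
  qed
  then have fit: "\<exists>r. (A ^^ N) p = (A ^^ N) ((A ^^ N) r)" if "p \<in> range P" for p
    using that unfolding R'_def by (metis (no_types, lifting) imageE imageI)
  obtain y p where y: "p \<in> range P" "x = (A ^^ N) y + p" using dec by blast
  obtain r where r: "(A ^^ N) p = (A ^^ N) ((A ^^ N) r)" using fit[OF y(1)] by blast
  then have "(A ^^ N) (p - (A ^^ N) r) = 0" by (simp add: clin_diff[OF pow_clin])
  then have "p - (A ^^ N) r \<in> E" by (auto simp: E_def)
  moreover have "x = (p - (A ^^ N) r) + (A ^^ N) (y + r)" using y(2) by (simp add: clin_add[OF pow_clin])
  ultimately show ?thesis by blast
qed

text \<open>Otherwise there are unit vectors f_n in F with A f_n tending to 0. Then P f_n = f_n - R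
  A f_n is bounded in a finite-dimensional space, so a subsequence of f_n converges to a unit vector
  of F in the kernel of A, hence in E.\<close>

lemma bounded_below:
  assumes F: "cvs.subspace F" "closed F" and EF: "\<And>x. x \<in> E \<Longrightarrow> x \<in> F \<Longrightarrow> x = 0"
  obtains \<gamma> where "0 < \<gamma>" "\<And>f. f \<in> F \<Longrightarrow> \<gamma> * norm f \<le> norm (A f)"
proof (rule ccontr)
  assume "\<not> thesis"
  then have no: "\<not> (0 < \<gamma> \<and> (\<forall>f\<in>F. \<gamma> * norm f \<le> norm (A f)))" for \<gamma> using that by blast
  have "\<exists>f\<in>F. norm f = 1 \<and> norm (A f) < 1 / real (Suc n)" for n
  proof -
    obtain f where f: "f \<in> F" "norm (A f) < 1 / real (Suc n) * norm f"
      using no[of "1 / real (Suc n)"] by fastforce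
    then have "f \<noteq> 0" using norm_ge_zero[of "A f"] by (auto simp del: norm_ge_zero)
    let ?g = "scaleC (of_real (1 / norm f)) f"
    have "?g \<in> F" using f(1) F(1) by (auto intro: cvs.subspace_scale)
    moreover have "norm ?g = 1" using \<open>f \<noteq> 0\<close> by (simp add: norm_scaleC norm_divide)
    moreover have "norm (A ?g) < 1 / real (Suc n)"
      using f(2) \<open>f \<noteq> 0\<close> by (simp add: clin_scale[OF A] norm_scaleC norm_divide divide_less_eq)
    ultimately show ?thesis by blast
  qed
  then obtain f where f: "\<And>n. f n \<in> F" "\<And>n. norm (f n) = 1" "\<And>n. norm (A (f n)) < 1 / real (Suc n)"
    by metis
  have Af: "(\<lambda>n. A (f n)) \<longlonglongrightarrow> 0"
    by (rule Lim_null_comparison[OF _ LIMSEQ_Suc[OF lim_const_over_n[of 1]]])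
      (use f(3) in \<open>auto intro!: always_eventually less_imp_le\<close>)
  have RAf: "(\<lambda>n. R (A (f n))) \<longlonglongrightarrow> 0"
  proof (rule Lim_null_comparison)
    show "\<forall>\<^sub>F n in sequentially. norm (R (A (f n))) \<le> L * norm (A (f n))" using R_bound by simp
    show "(\<lambda>n. L * norm (A (f n))) \<longlonglongrightarrow> 0" using tendsto_mult[OF tendsto_const tendsto_norm[OF Af], of L] by simp
  qed
  have Pf: "P (f n) = f n - R (A (f n))" for n by (simp add: RA)
  have "norm (P (f n)) \<le> 1 + \<bar>L\<bar>" for n
  proof -
    have "norm (R (A (f n))) \<le> L * norm (A (f n))" by (rule R_bound)
    also have "\<dots> \<le> \<bar>L\<bar> * 1"
    proof (rule mult_mono)
      have "1 / real (Suc n) \<le> 1" by simp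
      then show "norm (A (f n)) \<le> 1" using f(3)[of n] by linarith
    qed auto
    finally show ?thesis unfolding Pf using norm_triangle_ineq4[of "f n" "R (A (f n))"] f(2)[of n] by simp
  qed
  then obtain l s where l: "strict_mono s" "(\<lambda>n. P (f (s n))) \<longlonglongrightarrow> l"
    using fin_dim_bounded_subsequence[OF P_fin range_P_subspace, of "\<lambda>n. P (f n)"] by blast
  have "(\<lambda>n. R (A (f (s n)))) \<longlonglongrightarrow> 0" using LIMSEQ_subseq_LIMSEQ[OF RAf l(1)] by (simp add: o_def)
  from tendsto_add[OF l(2) this] have fl: "(\<lambda>n. f (s n)) \<longlonglongrightarrow> l" by (simp add: RA)
  have "l \<in> F" using closed_sequentially[OF F(2) _ fl] f(1) by blast
  have "(\<lambda>n. norm (f (s n))) \<longlonglongrightarrow> norm l" using fl by (rule tendsto_norm)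
  then have "norm l = 1" using f(2) LIMSEQ_unique[OF _ tendsto_const] by fastforce
  have "(\<lambda>n. A (f (s n)) - A l) \<longlonglongrightarrow> 0"
  proof (rule Lim_null_comparison)
    show "\<forall>\<^sub>F n in sequentially. norm (A (f (s n)) - A l) \<le> M * norm (f (s n) - l)"
      using A_bound[of "f (s _) - l"] by (simp add: clin_diff[OF A])
    show "(\<lambda>n. M * norm (f (s n) - l)) \<longlonglongrightarrow> 0"
      using tendsto_mult[OF tendsto_const tendsto_norm[OF tendsto_diff[OF fl tendsto_const]], of M l] by simp
  qed
  moreover have "(\<lambda>n. A (f (s n)) - A l) \<longlonglongrightarrow> 0 - A l"
    using LIMSEQ_subseq_LIMSEQ[OF Af l(1)] by (intro tendsto_diff tendsto_const) (simp add: o_def)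
  ultimately have "0 = 0 - A l" by (rule LIMSEQ_unique)
  then have "(A ^^ 1) l = 0" by simp
  then have "l \<in> E" unfolding E_def by blast
  then have "l = 0" using EF \<open>l \<in> F\<close> by blast
  then show False using \<open>norm l = 1\<close> by simp
qed

end

section \<open>The J-orthogonal splitting at an eigenvalue on the circle\<close>

locale krein_unitary =
  fixes J U S :: "'k::chilbert \<Rightarrow> 'k" and M :: real
  assumes J: "clin J" and JJ: "\<And>x. J (J x) = x" and J_self: "\<And>x y. cinner (J x) y = cinner x (J y)"
    and U: "clin U" and U_bound: "\<And>x. norm (U x) \<le> M * norm x" and M_pos: "0 < M"
    and S: "clin S" and SU: "\<And>x. S (U x) = x" and US: "\<And>x. U (S x) = x"
    and JU: "\<And>x y. cinner (U x) (J (U y)) = cinner x (J y)"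
begin

lemma J_norm: "norm (J x) = norm x"
proof -
  have "(norm (J x))\<^sup>2 = (norm x)\<^sup>2" unfolding Re_cinner_self[symmetric] by (simp add: J_self JJ)
  then show ?thesis by (simp add: power2_eq_imp_eq)
qed

text \<open>Writing x = U (S x) shows that the inverse S is the J-adjoint of U; the Hilbert adjoint
  of U is never formed.\<close>

lemma J_adjoint: "cinner x (J (U y)) = cinner (S x) (J y)"
  using JU[of "S x" y] by (simp add: US)

lemma J_cnj: "cinner y (J x) = cnj (cinner x (J y))"
  by (metis J_self cinner_commute)

lemma herm_J: "herm X (\<lambda>x y. cinner x (J y))"
  by (rule hermI) (simp_all add: clin_add[OF J] clin_scale[OF J] cinner_add_right cinner_scaleC_right J_cnj[symmetric])

end

locale krein_fredholm = krein_unitary J U S M + parametrix "\<lambda>x. U x - x" R P M' L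
  for J U S :: "'k::chilbert \<Rightarrow> 'k" and M and R P M' L
begin

abbreviation A where "A \<equiv> \<lambda>x. U x - x"

definition F where "F = {f. \<forall>e\<in>E. cinner e (J f) = 0}"

lemma A_S: "A (S x) = S (A x)"
  by (simp add: US SU clin_diff[OF S])

lemma pow_A_S: "(A ^^ n) (S x) = S ((A ^^ n) x)"
proof (induction n)
  case (Suc n)
  then show ?case using A_S[of "(A ^^ n) x"] by simp
qed simp

lemma pow_A_U: "(A ^^ n) (U x) = U ((A ^^ n) x)"
proof (induction n)
  case (Suc n)
  then show ?case using clin_diff[OF U] by simp
qed simp

lemma E_U: "x \<in> E \<Longrightarrow> U x \<in> E"
  unfolding E_def mem_Collect_eq pow_A_U using clin_zero[OF U] by metis

lemma E_S: "x \<in> E \<Longrightarrow> S x \<in> E"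
  unfolding E_def mem_Collect_eq pow_A_S using clin_zero[OF S] by metis

text \<open>Since S - 1 = - S (U - 1), moving A to the other side of the J-product gives - S A, and
  S commutes with the powers of A. Each such move consumes one power that annihilates x.\<close>

lemma pow_J_orthogonal: "(A ^^ n) x = 0 \<Longrightarrow> cinner x (J ((A ^^ n) y)) = 0"
proof (induction n arbitrary: x)
  case 0 then show ?case by simp
next
  case (Suc n)
  have eq: "cinner x (J (A z)) = - cinner (S (A x)) (J z)" for z
    by (simp add: clin_diff[OF J] clin_diff[OF S] cinner_diff_right cinner_diff_left J_adjoint SU)
  have "(A ^^ n) (S (A x)) = S ((A ^^ n) (A x))" by (rule pow_A_S)
  also have "\<dots> = S ((A ^^ Suc n) x)" by (simp only: pow_Suc')
  also have "\<dots> = 0" using Suc.prems clin_zero[OF S] by simp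
  finally have "cinner (S (A x)) (J ((A ^^ n) y)) = 0" by (rule Suc.IH)
  then have "cinner x (J (A ((A ^^ n) y))) = 0" unfolding eq by simp
  then show ?case by simp
qed

text \<open>Split J x = e + A^N y with e in E. Then x is J-orthogonal to both summands, so <x, J (J
  x)> = <x, x> vanishes.\<close>

lemma J_nondegenerate:
  assumes "x \<in> E" "\<And>y. y \<in> E \<Longrightarrow> cinner x (J y) = 0"
  shows "x = 0"
proof -
  obtain N where N: "\<And>x. x \<in> E \<Longrightarrow> (A ^^ N) x = 0" using E_nilpotent by blast
  obtain e y where ey: "e \<in> E" "J x = e + (A ^^ N) y" using E_plus_range[OF N, of "J x"] by blast
  have "cinner x (J (J x)) = cinner x (J e) + cinner x (J ((A ^^ N) y))"
    by (simp add: ey(2) clin_add[OF J] cinner_add_right)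
  also have "\<dots> = 0" using assms ey(1) pow_J_orthogonal[OF N[OF assms(1)]] by simp
  finally show ?thesis using cinner_self_zero by (simp add: JJ)
qed

text \<open>The last nonzero vector in the chain x, A x, A^2 x, ... Since U and S commute with A,
  applying A^k to a linear relation between x, U x and S x reduces it to a scalar one on this
  eigenvector.\<close>

lemma E_eigenvector:
  assumes "x \<in> E" "x \<noteq> 0"
  obtains k where "(A ^^ k) x \<noteq> 0" "U ((A ^^ k) x) = (A ^^ k) x"
proof -
  have "\<exists>n. (A ^^ n) x = 0" using assms(1) by (auto simp: E_def)
  define n where "n = (LEAST n. (A ^^ n) x = 0)"
  have n: "(A ^^ n) x = 0" unfolding n_def by (rule LeastI_ex) fact
  have "n \<noteq> 0" using n assms(2) by (cases n) auto
  then obtain k where k: "n = Suc k" by (cases n) auto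
  have "(A ^^ k) x \<noteq> 0" using not_less_Least[of k "\<lambda>n. (A ^^ n) x = 0"] k by (simp add: n_def[symmetric])
  moreover have "U ((A ^^ k) x) = (A ^^ k) x" using n k by simp
  ultimately show ?thesis using that by blast
qed

lemma F_subspace: "cvs.subspace F"
  unfolding F_def by (rule cvs.subspaceI)
    (simp_all add: clin_zero[OF J] clin_add[OF J] clin_scale[OF J] cinner_add_right cinner_scaleC_right)

lemma J_continuous: "continuous_on X J"
proof -
  have "bounded_linear J"
    by (rule bounded_linear_intro[where K = 1])
      (simp_all add: clin_add[OF J] scaleR_scaleC clin_scale[OF J] J_norm)
  then show ?thesis by (rule linear_continuous_on)
qed

lemma F_closed: "closed F"
proof -
  have "F = (\<Inter>e\<in>E. {f. cinner e (J f) = 0})" by (auto simp: F_def)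
  moreover have "closed {f. cinner e (J f) = 0}" for e
    by (intro closed_Collect_eq continuous_on_const J_continuous
        bounded_bilinear.continuous_on[OF bounded_bilinear_cinner])
  ultimately show ?thesis by (simp add: closed_INT)
qed

lemma F_U: "f \<in> F \<Longrightarrow> U f \<in> F"
  using E_S by (auto simp: F_def J_adjoint)

lemma E_F_trivial: "x \<in> E \<Longrightarrow> x \<in> F \<Longrightarrow> x = 0"
proof -
  assume x: "x \<in> E" "x \<in> F"
  show "x = 0"
  proof (rule J_nondegenerate[OF x(1)])
    fix y assume "y \<in> E"
    then have "cinner y (J x) = 0" using x(2) by (auto simp: F_def)
    then show "cinner x (J y) = 0" using J_cnj[of x y] by simp
  qed
qed

text \<open>The J-orthogonal projection onto E. In an orthonormal basis of E that diagonalises J the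
  entries <b, J b> are nonzero by \<open>J_nondegenerate\<close>, so the coefficients are <b, J x> /
  <b, J b>, and Cauchy-Schwarz gives the bound C.\<close>

lemma projection_exists:
  obtains pr C where "clin pr" "\<And>x. pr x \<in> E" "\<And>x. x - pr x \<in> F" "\<And>x. norm (pr x) \<le> C * norm x" "0 \<le> C"
proof -
  define \<beta> where "\<beta> x y = cinner x (J y)" for x y
  have h: "herm E \<beta>" unfolding \<beta>_def by (rule herm_J)
  obtain B where B: "onb B E" and diag: "\<And>a b. a \<in> B \<Longrightarrow> b \<in> B \<Longrightarrow> a \<noteq> b \<Longrightarrow> \<beta> a b = 0"
    using herm_diagonalization[OF h E_subspace E_fin_dim] by blast
  have B': "finite B" "orthonormal B" "cvs.span B = E" "B \<subseteq> E"
    using B by (auto simp: onb_def intro: cvs.span_base)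
  have ext: "\<beta> y x = 0" if "\<And>b. b \<in> B \<Longrightarrow> \<beta> b x = 0" "y \<in> E" for x y
  proof -
    have "\<beta> y x = \<beta> (\<Sum>b\<in>B. scaleC (cinner b y) b) x" using onb_expand[OF B that(2)] by simp
    also have "\<dots> = (\<Sum>b\<in>B. cnj (cinner b y) * \<beta> b x)"
      unfolding \<beta>_def by (simp add: cinner_sum_left cinner_scaleC_left)
    finally show ?thesis using that(1) by simp
  qed
  have nz: "\<beta> b b \<noteq> 0" if b: "b \<in> B" for b
  proof
    assume z: "\<beta> b b = 0"
    have "\<beta> a b = 0" if "a \<in> B" for a using diag[OF that b] z by (cases "a = b") auto
    then have "\<beta> y b = 0" if "y \<in> E" for y using ext that by blast
    then have "cinner b (J y) = 0" if "y \<in> E" for y using J_cnj[of b y] that by (simp add: \<beta>_def)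
    then have "b = 0" using J_nondegenerate b B'(4) by blast
    then show False using B'(2) b unfolding orthonormal_def by force
  qed
  define pr where "pr x = (\<Sum>b\<in>B. scaleC (\<beta> b x / \<beta> b b) b)" for x
  have lin: "clin pr"
    unfolding clin_def pr_def \<beta>_def
    by (simp add: clin_add[OF J] clin_scale[OF J] cinner_add_right cinner_scaleC_right add_divide_distrib
        cvs.scale_left_distrib sum.distrib cvs.scale_sum_right)
  have E: "pr x \<in> E" for x
    unfolding pr_def using B'(4) E_subspace by (intro cvs.subspace_sum cvs.subspace_scale) auto
  have F: "x - pr x \<in> F" for x
  proof -
    have "\<beta> b (x - pr x) = 0" if b: "b \<in> B" for b
    proof -
      have "\<beta> b (pr x) = (\<Sum>a\<in>B. (\<beta> a x / \<beta> a a) * \<beta> b a)"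
        unfolding \<beta>_def pr_def by (simp add: clin_sum[OF J] clin_scale[OF J] cinner_sum_right cinner_scaleC_right)
      also have "\<dots> = (\<Sum>a\<in>B. if a = b then \<beta> b x else 0)"
        using diag[OF b] nz by (intro sum.cong) auto
      also have "\<dots> = \<beta> b x" using b B'(1) by simp
      finally show ?thesis by (simp add: \<beta>_def clin_diff[OF J] cinner_diff_right)
    qed
    then have "\<beta> y (x - pr x) = 0" if "y \<in> E" for y using ext that by blast
    then show ?thesis by (auto simp: F_def \<beta>_def)
  qed
  define C where "C = (\<Sum>b\<in>B. norm b * norm b / cmod (\<beta> b b))"
  have bd: "norm (pr x) \<le> C * norm x" for x
  proof -
    have "norm (pr x) \<le> (\<Sum>b\<in>B. cmod (\<beta> b x) / cmod (\<beta> b b) * norm b)"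
      unfolding pr_def by (rule order.trans[OF norm_sum]) (simp add: norm_scaleC norm_divide)
    also have "\<dots> \<le> (\<Sum>b\<in>B. norm b * norm x / cmod (\<beta> b b) * norm b)"
      unfolding \<beta>_def using cinner_cauchy_schwarz[of _ "J x"]
      by (intro sum_mono mult_right_mono divide_right_mono) (auto simp: J_norm)
    also have "\<dots> = norm x * C" by (simp add: C_def sum_distrib_left mult_ac)
    also have "\<dots> = C * norm x" by (rule mult.commute)
    finally show ?thesis .
  qed
  have "0 \<le> C" unfolding C_def by (intro sum_nonneg) simp
  then show ?thesis using that[OF lin E F bd] by blast
qed

lemma F_bounded_below:
  obtains \<gamma> where "0 < \<gamma>" "\<And>f. f \<in> F \<Longrightarrow> \<gamma> * norm f \<le> norm (A f)"
  using bounded_below[OF F_subspace F_closed E_F_trivial] by blast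

end

section \<open>Homotopy invariance of the index\<close>

lemma herm_combination:
  assumes "herm E \<beta>" "herm E \<gamma>"
  shows "herm E (\<lambda>x y. of_real s * \<beta> x y + of_real t * \<gamma> x y)"
proof (rule hermI)
  fix x y assume "x \<in> E" "y \<in> E"
  then show "of_real s * \<beta> y x + of_real t * \<gamma> y x = cnj (of_real s * \<beta> x y + of_real t * \<gamma> x y)"
    using herm_sym[OF assms(1), of x y] herm_sym[OF assms(2), of x y] by simp
qed (simp_all add: herm_add_right[OF assms(1)] herm_add_right[OF assms(2)]
    herm_scale_right[OF assms(1)] herm_scale_right[OF assms(2)] algebra_simps)

text \<open>All forms on the segment from \<beta> to \<gamma> are nondegenerate, so each has a
  strict index with some margin, and a small change of t stays within that margin. The index is
  locally constant on a connected interval.\<close>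

lemma index_homotopy:
  assumes E: "cvs.subspace E" "fin_dim E" and h0: "herm E \<beta>" and h1: "herm E \<gamma>"
    and nd: "\<And>t x. 0 \<le> t \<Longrightarrow> t \<le> 1 \<Longrightarrow> x \<in> E \<Longrightarrow> x \<noteq> 0 \<Longrightarrow>
      \<exists>y\<in>E. of_real (1 - t) * \<beta> x y + of_real t * \<gamma> x y \<noteq> 0"
    and i0: "has_index E (\<lambda>x. Re (\<beta> x x)) m"
  shows "has_index E (\<lambda>x. Re (\<gamma> x x)) m"
proof -
  define b where "b t x y = of_real (1 - t) * \<beta> x y + of_real t * \<gamma> x y" for t x y
  define q where "q t x = Re (b t x x)" for t x
  have hb: "herm E (b t)" for t unfolding b_def by (rule herm_combination[OF h0 h1])
  obtain M0 where M0: "0 \<le> M0" "herm_bounded E \<beta> M0" using fin_dim_herm_bounded[OF h0 E] .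
  obtain M1 where M1: "0 \<le> M1" "herm_bounded E \<gamma> M1" using fin_dim_herm_bounded[OF h1 E] .
  \<comment> \<open>A Lipschitz constant for the form in t, relative to the squared norm; the
    summand 1 keeps it positive for the radius \<eta> / K.\<close>
  define K where "K = M0 + M1 + 1"
  have K: "0 < K" using M0 M1 by (simp add: K_def)
  have diff: "\<bar>q t' x - q t x\<bar> \<le> (\<bar>t' - t\<bar> * K) * (norm x)\<^sup>2" if x: "x \<in> E" for t t' x
  proof -
    have "q t' x - q t x = (t' - t) * (Re (\<gamma> x x) - Re (\<beta> x x))"
      by (simp add: q_def b_def algebra_simps)
    moreover have "\<bar>Re (\<beta> x x)\<bar> \<le> M0 * norm x * norm x" "\<bar>Re (\<gamma> x x)\<bar> \<le> M1 * norm x * norm x"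
      using M0(2) M1(2) x abs_Re_le_cmod order_trans unfolding herm_bounded_def by blast+
    then have "\<bar>Re (\<gamma> x x) - Re (\<beta> x x)\<bar> \<le> K * (norm x)\<^sup>2"
      using zero_le_power2[of "norm x"] unfolding K_def power2_eq_square distrib_right mult.assoc by linarith
    ultimately show ?thesis by (simp add: abs_mult mult.assoc mult_left_mono)
  qed
  define f where "f t = (THE n. has_index E (q t) n)" for t
  have f: "f t = n" if "has_index E (q t) n" for t n
    unfolding f_def using that has_index_unique by blast
  have "f 0 = f 1"
  proof (rule connected_local_const[of "{0..1::real}"])
    show "\<forall>t\<in>{0..1}. \<forall>\<^sub>F t' in at t within {0..1}. f t = f t'"
    proof
      fix t :: real assume t: "t \<in> {0..1}"
      obtain m' n' \<eta> where s: "0 < \<eta>" "strict_index E (\<lambda>x. Re (b t x x)) m' n' \<eta>"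
        by (rule nondegenerate_strict_index[OF hb E, of t]) (use nd t in \<open>auto simp: b_def\<close>)
      have ev: "f t' = m'" if "\<bar>t' - t\<bar> < \<eta> / K" for t'
      proof -
        have "strict_index E (q t') m' n' (\<eta> - \<bar>t' - t\<bar> * K)"
          by (rule strict_index_perturb[OF s(2)[folded q_def] diff])
        moreover have "0 < \<eta> - \<bar>t' - t\<bar> * K" using that K by (simp add: pos_less_divide_eq)
        ultimately show ?thesis using f strict_index_imp_has_index(1) E(1) by metis
      qed
      have "0 < \<eta> / K" using s(1) K by simp
      then have "f t = m'" using ev[of t] by simp
      have "\<forall>\<^sub>F t' in at t within {0..1}. dist t' t < \<eta> / K"
        using \<open>0 < \<eta> / K\<close> eventually_at by blast
      then show "\<forall>\<^sub>F t' in at t within {0..1}. f t = f t'"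
        by eventually_elim (use ev \<open>f t = m'\<close> in \<open>simp add: dist_real_def\<close>)
    qed
  qed auto
  moreover have "f 0 = m" by (rule f) (use i0 in \<open>simp add: q_def[abs_def] b_def\<close>)
  moreover obtain n where n: "has_index E (\<lambda>x. Re (\<gamma> x x)) n" using has_index_exists[OF h1 E] by blast
  moreover have "f 1 = n" by (rule f) (use n in \<open>simp add: q_def[abs_def] b_def\<close>)
  ultimately show ?thesis by simp
qed

lemma orthogonal_projection_exists:
  assumes "onb B X"
  obtains Q where "clin Q" "\<And>z. Q z \<in> X" "\<And>e z. e \<in> X \<Longrightarrow> cinner e (Q z) = cinner e z" "\<And>z. norm (Q z) \<le> norm z"
proof -
  have B: "finite B" "orthonormal B" "cvs.span B = X" using assms by (auto simp: onb_def)
  define Q where "Q z = (\<Sum>b\<in>B. scaleC (cinner b z) b)" for z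
  have lin: "clin Q" unfolding clin_def Q_def
    by (simp add: cinner_add_right cinner_scaleC_right cvs.scale_left_distrib sum.distrib cvs.scale_sum_right)
  have X: "Q z \<in> X" for z unfolding Q_def B(3)[symmetric]
    by (auto intro: cvs.span_sum cvs.span_scale cvs.span_base)
  have e: "cinner e (Q z) = cinner e z" if "e \<in> X" for e z
  proof -
    have "cinner e z = cinner (\<Sum>b\<in>B. scaleC (cinner b e) b) z" using onb_expand[OF assms that] by simp
    also have "\<dots> = (\<Sum>b\<in>B. cnj (cinner b e) * cinner b z)" by (simp add: cinner_sum_left cinner_scaleC_left)
    also have "\<dots> = cinner (\<Sum>b\<in>B. scaleC (cinner b e) b) (Q z)"
      unfolding Q_def by (rule onb_cinner[OF assms, symmetric])
    also have "\<dots> = cinner e (Q z)" using onb_expand[OF assms that] by simp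
    finally show ?thesis by simp
  qed
  have n: "norm (Q z) \<le> norm z" for z
  proof -
    have "(norm (Q z))\<^sup>2 = Re (cinner (Q z) z)" using e[OF X, of z z] by (simp add: Re_cinner_self[symmetric])
    also have "\<dots> \<le> norm (Q z) * norm z"
      using cinner_cauchy_schwarz complex_Re_le_cmod order_trans by blast
    finally have "norm (Q z) * norm (Q z) \<le> norm (Q z) * norm z" by (simp add: power2_eq_square)
    then show ?thesis by (cases "norm (Q z) = 0") (auto simp: mult_le_cancel_left)
  qed
  show ?thesis by (rule that[OF lin X e n])
qed

lemma clin_scaled: "clin f \<Longrightarrow> clin (\<lambda>x. scaleC c (f x))"
  by (simp add: clin_def scaleC_add_right mult.commute)

lemma cis_near_one: "cmod (cis a - 1) \<le> \<bar>a\<bar>"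
proof -
  have "cmod (cis a - 1) = 2 * \<bar>sin (a / 2)\<bar>" using dist_exp_i_1[of a] by (simp add: cis_conv_exp)
  also have "\<dots> \<le> 2 * \<bar>a / 2\<bar>" using abs_sin_x_le_abs_x[of "a / 2"] by simp
  finally show ?thesis by simp
qed

section \<open>The forms q near the crossing, on the eigenspace E\<close>

context krein_fredholm
begin

text \<open>The time parameter relative to the crossing: for U = e^{-i t_0} T this is e^{-i (t_0 +
  \<delta>)} T.\<close>

definition rot :: "real \<Rightarrow> 'k \<Rightarrow> 'k" where "rot \<delta> x = scaleC (cis (- \<delta>)) (U x)"

text \<open>The sesquilinear form with diagonal \<open>q\<close>; as an operator it is the imaginary
  part of K = rot^* J.\<close>

definition twist :: "real \<Rightarrow> 'k \<Rightarrow> 'k \<Rightarrow> complex" where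
  "twist \<delta> x y = (cinner (rot \<delta> x) (J y) - cinner x (J (rot \<delta> y))) / (2 * \<i>)"

definition q :: "real \<Rightarrow> 'k \<Rightarrow> real" where "q \<delta> x = Im (cinner (rot \<delta> x) (J x))"

lemma rot_clin: "clin (rot \<delta>)"
  unfolding clin_def rot_def
  by (simp add: clin_add[OF U] clin_scale[OF U] scaleC_add_right scaleC_scaleC mult.commute)

lemma rot_J: "cinner (rot \<delta> x) (J (rot \<delta> y)) = cinner x (J y)"
proof -
  have "cnj (cis (- \<delta>)) * cis (- \<delta>) = 1" by (simp add: cis_cnj cis_mult)
  then show ?thesis by (simp add: rot_def clin_scale[OF J] cinner_scaleC_scaleC JU)
qed

lemma norm_rot: "norm (rot \<delta> x) \<le> M * norm x"
  using U_bound[of x] by (simp add: rot_def norm_scaleC)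

lemma twist_self: "twist \<delta> x x = of_real (q \<delta> x)"
proof -
  have "cinner x (J (rot \<delta> x)) = cnj (cinner (rot \<delta> x) (J x))" by (rule J_cnj)
  then show ?thesis by (simp add: twist_def q_def complex_diff_cnj) (simp add: complex_eq_iff)
qed

lemma herm_twist: "herm X (twist \<delta>)"
proof (rule hermI)
  fix x y
  have "cinner (rot \<delta> y) (J x) = cnj (cinner x (J (rot \<delta> y)))"
    "cinner y (J (rot \<delta> x)) = cnj (cinner (rot \<delta> x) (J y))"
    by (rule J_cnj)+
  then show "twist \<delta> y x = cnj (twist \<delta> x y)" by (simp add: twist_def field_simps)
qed (simp_all add: twist_def clin_add[OF J] clin_scale[OF J] clin_add[OF rot_clin] clin_scale[OF rot_clin]
    cinner_add_right cinner_scaleC_right field_simps)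

lemma q_bound: "\<bar>q \<delta> x\<bar> \<le> M * (norm x)\<^sup>2"
proof -
  have "\<bar>q \<delta> x\<bar> \<le> norm (rot \<delta> x) * norm (J x)"
    unfolding q_def using abs_Im_le_cmod cinner_cauchy_schwarz order_trans by blast
  also have "\<dots> \<le> M * norm x * norm x" using norm_rot by (simp add: J_norm mult_right_mono)
  finally show ?thesis by (simp add: power2_eq_square mult.assoc)
qed

text \<open>The terms <x, J y> and <rot x, J (rot y)> cancel by J-unitarity. This is the
  factorisation <W x, G y> with W = rot - 1 that \<open>cayley_index\<close> asks for.\<close>

lemma twist_cayley: "cinner (rot \<delta> x - x) (J (y + rot \<delta> y)) = 2 * \<i> * twist \<delta> x y"
  by (simp add: twist_def clin_add[OF J] cinner_add_right cinner_diff_left rot_J)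

lemma pow_A_scale: "(A ^^ n) (scaleC c x) = scaleC c ((A ^^ n) x)"
  by (rule clin_scale[OF pow_clin])

text \<open>The form is $\langle L x, J y\rangle$ with $L = s + t\,(T_\delta^{-1} - T_\delta)/(2i)$, whose only eigenvalue on $E$
  is $s + t\sin\delta$.\<close>
lemma twist_nondegenerate:
  assumes x: "x \<in> E" "x \<noteq> 0" and a: "s + t * sin \<delta> \<noteq> 0"
  shows "\<exists>y\<in>E. of_real s * cinner x (J y) + of_real t * twist \<delta> x y \<noteq> 0"
proof (rule ccontr)
  assume no: "\<not> (\<exists>y\<in>E. of_real s * cinner x (J y) + of_real t * twist \<delta> x y \<noteq> 0)"
  define c :: complex where "c = of_real t / (2 * \<i>)"
  define Lx where "Lx = scaleC (of_real s) x + scaleC c (scaleC (cis \<delta>) (S x) - rot \<delta> x)"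
  have "Lx \<in> E" unfolding Lx_def rot_def
    using x E_U E_S E_subspace by (intro cvs.subspace_add cvs.subspace_scale cvs.subspace_diff) auto
  have cc: "cnj c = - c" by (simp add: c_def)
  have "cinner Lx (J y) = of_real s * cinner x (J y) + of_real t * twist \<delta> x y" for y
  proof -
    have "cinner (scaleC (cis \<delta>) (S x)) (J y) = cinner x (J (rot \<delta> y))"
      by (simp add: cinner_scaleC_left rot_def clin_scale[OF J] cinner_scaleC_right J_adjoint cis_cnj)
    then have "cinner Lx (J y) = of_real s * cinner x (J y) - c * (cinner x (J (rot \<delta> y)) - cinner (rot \<delta> x) (J y))"
      by (simp add: Lx_def cinner_add_left cinner_scaleC_left cinner_diff_left cc del: scaleC_scaleC)
    then show ?thesis by (simp add: twist_def c_def field_simps)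
  qed
  then have "Lx = 0" using J_nondegenerate[OF \<open>Lx \<in> E\<close>] no by auto
  obtain k where k: "(A ^^ k) x \<noteq> 0" "U ((A ^^ k) x) = (A ^^ k) x" by (rule E_eigenvector[OF x])
  define z where "z = (A ^^ k) x"
  have z: "U z = z" "z \<noteq> 0" using k by (auto simp: z_def)
  then have "S z = z" using SU[of z] by simp
  have "(A ^^ k) Lx = scaleC (of_real s) z + scaleC c (scaleC (cis \<delta>) z - scaleC (cis (- \<delta>)) z)"
    unfolding Lx_def rot_def clin_add[OF pow_clin] clin_diff[OF pow_clin] pow_A_scale pow_A_U pow_A_S z_def[symmetric]
    by (simp add: z \<open>S z = z\<close>)
  also have "\<dots> = scaleC (of_real s + c * (cis \<delta> - cis (- \<delta>))) z"
    by (simp only: cvs.scale_left_distrib cvs.scale_left_diff_distrib scaleC_scaleC[symmetric])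
  also have "of_real s + c * (cis \<delta> - cis (- \<delta>)) = of_real (s + t * sin \<delta>)"
    by (simp add: c_def complex_eq_iff)
  finally have "scaleC (of_real (s + t * sin \<delta>)) z = 0" using \<open>Lx = 0\<close> pow_zero by simp
  then show False using a z(2) by (metis cvs.scale_eq_0_iff of_real_eq_0_iff)
qed

text \<open>On the segment from \<sigma> J to the twisted form the eigenvalue (1 - t) \<sigma> + t
  sin \<delta> keeps the sign of \<sigma>, so no degenerate form is met. The cases \<sigma> = 1 and
  \<sigma> = -1 serve \<delta> > 0 and \<delta> < 0.\<close>

lemma twist_index:
  assumes sg: "0 < \<sigma> * sin \<delta>" and i: "has_index E (\<lambda>x. \<sigma> * Re (cinner x (J x))) n"
  shows "has_index E (q \<delta>) n"
proof -
  have h: "herm E (\<lambda>x y. of_real \<sigma> * cinner x (J y) + of_real 0 * cinner x (J y))"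
    by (rule herm_combination[OF herm_J herm_J])
  have "has_index E (\<lambda>x. Re (twist \<delta> x x)) n"
  proof (rule index_homotopy[OF E_subspace E_fin_dim h herm_twist])
    fix t :: real and x assume t: "0 \<le> t" "t \<le> 1" and x: "x \<in> E" "x \<noteq> 0"
    have "0 < \<sigma> * ((1 - t) * \<sigma> + t * sin \<delta>)"
    proof -
      have "\<sigma> * ((1 - t) * \<sigma> + t * sin \<delta>) = (1 - t) * (\<sigma> * \<sigma>) + t * (\<sigma> * sin \<delta>)" by (simp add: algebra_simps)
      moreover have "0 < \<sigma> * \<sigma>" using sg by (auto simp: zero_less_mult_iff)
      ultimately show ?thesis using t sg by (cases "t = 0") (auto intro: add_nonneg_pos)
    qed
    then have "(1 - t) * \<sigma> + t * sin \<delta> \<noteq> 0" by auto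
    from twist_nondegenerate[OF x this]
    show "\<exists>y\<in>E. of_real (1 - t) * (of_real \<sigma> * cinner x (J y) + of_real 0 * cinner x (J y)) + of_real t * twist \<delta> x y \<noteq> 0"
      by (simp add: mult.assoc)
  qed (use i in simp)
  then show ?thesis by (simp add: twist_self)
qed

lemma rot_injective:
  assumes "cis \<delta> \<noteq> 1" "x \<in> E" "rot \<delta> x - x = 0"
  shows "x = 0"
proof (rule ccontr)
  assume "x \<noteq> 0"
  obtain k where k: "(A ^^ k) x \<noteq> 0" "U ((A ^^ k) x) = (A ^^ k) x" by (rule E_eigenvector[OF assms(2) \<open>x \<noteq> 0\<close>])
  have "(A ^^ k) (rot \<delta> x) = scaleC (cis (- \<delta>)) ((A ^^ k) x)"
    unfolding rot_def pow_A_scale pow_A_U k(2) ..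
  moreover have "rot \<delta> x = x" using assms(3) by simp
  ultimately have "scaleC (cis (- \<delta>) - 1) ((A ^^ k) x) = 0" by (simp add: cvs.scale_left_diff_distrib)
  then have "cis (- \<delta>) = 1" using k(1) by simp
  then have "cnj (cis (- \<delta>)) = 1" by simp
  then show False using assms(1) by (simp add: cis_cnj)
qed

text \<open>Here n0 is the negative index of q at \<delta> = 0. The form q + |G x|^2 / C has strict
  index n0 at \<delta> = 0, keeps it for small \<delta>, and \<open>cayley_index\<close> then
  subtracts n0 from the index of q, which is jn or jp according to the sign of \<delta>.\<close>

lemma local_index:
  assumes jn: "has_index E (\<lambda>x. Re (cinner x (J x))) jn" and jp: "has_index E (\<lambda>x. - Re (cinner x (J x))) jp"
  shows "\<exists>n0 C0. 0 < C0 \<and> (\<forall>C\<ge>C0. \<exists>\<delta>0>0. \<forall>\<delta>. \<delta> \<noteq> 0 \<and> \<bar>\<delta>\<bar> < \<delta>0 \<longrightarrow>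
      n0 \<le> (if 0 < \<delta> then jn else jp)
      \<and> has_index E (\<lambda>x. q \<delta> x + C * (norm (rot \<delta> x - x))\<^sup>2) ((if 0 < \<delta> then jn else jp) - n0))"
proof -
  obtain B0 where B0: "onb B0 E" using fin_dim_onb[OF E_fin_dim E_subspace] .
  obtain Q where Q: "clin Q" "\<And>z. Q z \<in> E" "\<And>e z. e \<in> E \<Longrightarrow> cinner e (Q z) = cinner e z" "\<And>z. norm (Q z) \<le> norm z"
    by (rule orthogonal_projection_exists[OF B0]) (rule that)
  \<comment> \<open>The orthogonal projection Q brings J (1 + rot) / (2i) back into E without
    changing its inner products with vectors of E, so the factorisation of the twisted form
    survives.\<close>
  define G where "G \<delta> y = scaleC (1 / (2 * \<i>)) (Q (J (y + rot \<delta> y)))" for \<delta> y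
  have G_clin: "clin (G \<delta>)" for \<delta>
    unfolding G_def
    by (rule clin_scaled)
      (simp add: clin_def clin_add[OF Q(1)] clin_add[OF J] clin_add[OF rot_clin] clin_scale[OF Q(1)] clin_scale[OF J]
        clin_scale[OF rot_clin] scaleC_add_right add_ac)
  have G_E: "G \<delta> y \<in> E" for \<delta> y unfolding G_def using Q(2) E_subspace by (rule cvs.subspace_scale[rotated])
  have rot_E: "rot \<delta> x - x \<in> E" if "x \<in> E" for \<delta> x
    unfolding rot_def using that E_U E_subspace by (intro cvs.subspace_diff cvs.subspace_scale) auto
  have rel: "twist \<delta> x y = cinner (rot \<delta> x - x) (G \<delta> y)" if "x \<in> E" for \<delta> x y
    unfolding G_def cinner_scaleC_right Q(3)[OF rot_E[OF that]] twist_cayley by simp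
  have G_bound: "norm (G \<delta> x) \<le> (1 + M) / 2 * norm x" for \<delta> x
  proof -
    have "norm (G \<delta> x) \<le> 1 / 2 * norm (x + rot \<delta> x)"
      unfolding G_def using Q(4)[of "J (x + rot \<delta> x)"] by (simp add: norm_scaleC norm_divide J_norm)
    also have "\<dots> \<le> 1 / 2 * (norm x + M * norm x)"
      using norm_triangle_ineq[of x "rot \<delta> x"] norm_rot[of \<delta> x] by simp
    finally show ?thesis by (simp add: algebra_simps)
  qed
  have rot_diff: "rot \<delta> x - rot 0 x = scaleC (cis (- \<delta>) - 1) (U x)" for \<delta> x
    by (simp add: rot_def cvs.scale_left_diff_distrib)
  have rot_diff_norm: "norm (rot \<delta> x - rot 0 x) \<le> \<bar>\<delta>\<bar> * M * norm x" for \<delta> x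
  proof -
    have "norm (rot \<delta> x - rot 0 x) \<le> \<bar>\<delta>\<bar> * norm (U x)"
      unfolding rot_diff norm_scaleC using cis_near_one[of "- \<delta>"] by (intro mult_right_mono) auto
    also have "\<dots> \<le> \<bar>\<delta>\<bar> * (M * norm x)" by (intro mult_left_mono U_bound) auto
    finally show ?thesis by (simp add: mult.assoc)
  qed
  have G_diff: "norm (G \<delta> x - G 0 x) \<le> 1 / 2 * (\<bar>\<delta>\<bar> * M * norm x)" for \<delta> x
  proof -
    have "G \<delta> x - G 0 x = scaleC (1 / (2 * \<i>)) (Q (J (rot \<delta> x - rot 0 x)))"
      by (simp add: G_def clin_diff[OF Q(1)] clin_diff[OF J] clin_add[OF Q(1)] clin_add[OF J]
          cvs.scale_right_diff_distrib scaleC_add_right)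
    then have "norm (G \<delta> x - G 0 x) \<le> 1 / 2 * norm (rot \<delta> x - rot 0 x)"
      using Q(4)[of "J (rot \<delta> x - rot 0 x)"] by (simp add: norm_scaleC norm_divide J_norm)
    then show ?thesis using rot_diff_norm[of \<delta> x] by linarith
  qed
  have G2_diff: "\<bar>(norm (G \<delta> x))\<^sup>2 - (norm (G 0 x))\<^sup>2\<bar> \<le> \<bar>\<delta>\<bar> * (M * (1 + M) / 2) * (norm x)\<^sup>2" for \<delta> x
  proof -
    have "\<bar>(norm (G \<delta> x))\<^sup>2 - (norm (G 0 x))\<^sup>2\<bar> = \<bar>norm (G \<delta> x) - norm (G 0 x)\<bar> * (norm (G \<delta> x) + norm (G 0 x))"
    proof -
      have "(norm (G \<delta> x))\<^sup>2 - (norm (G 0 x))\<^sup>2 = (norm (G \<delta> x) - norm (G 0 x)) * (norm (G \<delta> x) + norm (G 0 x))"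
        by (simp add: power2_eq_square algebra_simps)
      moreover have "\<bar>norm (G \<delta> x) + norm (G 0 x)\<bar> = norm (G \<delta> x) + norm (G 0 x)" by simp
      ultimately show ?thesis by (simp only: abs_mult)
    qed
    also have "\<dots> \<le> (1 / 2 * (\<bar>\<delta>\<bar> * M * norm x)) * ((1 + M) / 2 * norm x + (1 + M) / 2 * norm x)"
    proof (rule mult_mono)
      show "\<bar>norm (G \<delta> x) - norm (G 0 x)\<bar> \<le> 1 / 2 * (\<bar>\<delta>\<bar> * M * norm x)"
        using norm_triangle_ineq3[of "G \<delta> x" "G 0 x"] G_diff[of \<delta> x] by linarith
      show "norm (G \<delta> x) + norm (G 0 x) \<le> (1 + M) / 2 * norm x + (1 + M) / 2 * norm x"
        using G_bound[of \<delta> x] G_bound[of 0 x] by linarith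
    qed (use M_pos in simp_all)
    also have "\<dots> = \<bar>\<delta>\<bar> * (M * (1 + M) / 2) * (norm x)\<^sup>2" by (simp add: power2_eq_square field_simps)
    finally show ?thesis .
  qed
  have q_diff: "\<bar>q \<delta> x - q 0 x\<bar> \<le> \<bar>\<delta>\<bar> * M * (norm x)\<^sup>2" for \<delta> x
  proof -
    have "q \<delta> x - q 0 x = Im (cinner (rot \<delta> x - rot 0 x) (J x))" by (simp add: q_def cinner_diff_left)
    then have "\<bar>q \<delta> x - q 0 x\<bar> \<le> norm (rot \<delta> x - rot 0 x) * norm (J x)"
      using abs_Im_le_cmod cinner_cauchy_schwarz order_trans by metis
    also have "\<dots> \<le> (\<bar>\<delta>\<bar> * M * norm x) * norm x" using rot_diff_norm by (simp add: J_norm mult_right_mono)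
    finally show ?thesis by (simp add: power2_eq_square mult.assoc)
  qed
  \<comment> \<open>If G 0 x = 0, then x + U x is J-orthogonal to E and lies in E, hence vanishes;
    applying A^k gives an eigenvector for 1 with 2 times it equal to 0.\<close>
  have G0_inj: "x = 0" if x: "x \<in> E" "G 0 x = 0" for x
  proof -
    have "x + U x \<in> E" using x(1) E_U E_subspace by (auto intro: cvs.subspace_add)
    have "Q (J (x + U x)) = 0" using x(2) by (simp add: G_def rot_def)
    then have "cinner e (J (x + U x)) = 0" if "e \<in> E" for e using Q(3)[OF that, of "J (x + U x)"] by simp
    then have "cinner (x + U x) (J e) = 0" if "e \<in> E" for e using J_cnj[of "x + U x" e] that by simp
    then have z: "x + U x = 0" using J_nondegenerate[OF \<open>x + U x \<in> E\<close>] by blast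
    show "x = 0"
    proof (rule ccontr)
      assume "x \<noteq> 0"
      obtain k where k: "(A ^^ k) x \<noteq> 0" "U ((A ^^ k) x) = (A ^^ k) x" by (rule E_eigenvector[OF x(1) \<open>x \<noteq> 0\<close>])
      have "(A ^^ k) (x + U x) = (A ^^ k) x + (A ^^ k) x"
        unfolding clin_add[OF pow_clin] pow_A_U k(2) ..
      then have "scaleC 2 ((A ^^ k) x) = 0" using z pow_zero cvs.scale_left_distrib[of 1 1 "(A ^^ k) x"] by simp
      then show False using k(1) by simp
    qed
  qed
  obtain \<kappa> where kappa: "0 < \<kappa>" "\<And>x. x \<in> E \<Longrightarrow> \<kappa> * (norm x)\<^sup>2 \<le> (norm (G 0 x))\<^sup>2"
    using injective_coercive[OF G_clin E_subspace E_fin_dim G0_inj] by blast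
  obtain B where B: "onb B E" and diag: "\<And>a b. a \<in> B \<Longrightarrow> b \<in> B \<Longrightarrow> a \<noteq> b \<Longrightarrow> twist 0 a b = 0"
    using herm_diagonalization[OF herm_twist E_subspace E_fin_dim, of 0] by blast
  have B': "finite B" "orthonormal B" "cvs.span B = E" "B \<subseteq> E"
    using B by (auto simp: onb_def intro: cvs.span_base)
  define T where "T = {b\<in>B. q 0 b < 0}"
  have TB: "T \<subseteq> B" "B - T \<subseteq> B" by (auto simp: T_def)
  note s1 = onb_split[OF B TB(1)] and s2 = onb_split[OF B TB(2)]
  obtain \<eta> where eta: "0 < \<eta>" "\<And>b. b \<in> T \<Longrightarrow> \<eta> \<le> - q 0 b"
    using finite_positive_lower_bound[OF s1(3), of "\<lambda>b. - q 0 b"] by (auto simp: T_def)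
  have qT: "q 0 x \<le> - \<eta> * (norm x)\<^sup>2" if "x \<in> cvs.span T" for x
  proof -
    have "Re (twist 0 x x) \<le> (- \<eta>) * (norm x)\<^sup>2"
    proof (rule diag_quad_bounds(1)[OF herm_twist E_subspace s1(3,4) _ that])
      show "T \<subseteq> E" using TB B' by blast
      show "twist 0 a b = 0" if "a \<in> T" "b \<in> T" "a \<noteq> b" for a b using that diag TB by blast
      show "Re (twist 0 b b) \<le> - \<eta>" if "b \<in> T" for b using eta(2)[OF that] by (simp add: twist_self)
    qed
    then show ?thesis by (simp add: twist_self)
  qed
  have qP: "0 \<le> q 0 x" if "x \<in> cvs.span (B - T)" for x
  proof -
    have "0 * (norm x)\<^sup>2 \<le> Re (twist 0 x x)"
    proof (rule diag_quad_bounds(2)[OF herm_twist E_subspace s2(3,4) _ that])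
      show "B - T \<subseteq> E" using TB B' by blast
      show "twist 0 a b = 0" if "a \<in> B - T" "b \<in> B - T" "a \<noteq> b" for a b using that diag TB by blast
      show "0 \<le> Re (twist 0 b b)" if "b \<in> B - T" for b using that by (auto simp: twist_self T_def)
    qed
    then show ?thesis by (simp add: twist_self)
  qed
  \<comment> \<open>As |G 0 x| is at most (1 + M) / 2 |x|, any C above this value gives |G 0 x|^2 /
    C at most \<eta> / 2 |x|^2, half of the negativity of q 0 on span T.\<close>
  define C0 where "C0 = (1 + M)\<^sup>2 / (2 * \<eta>)"
  have C0: "0 < C0" using M_pos eta(1) by (simp add: C0_def)
  have main: "\<exists>\<delta>0>0. \<forall>\<delta>. \<delta> \<noteq> 0 \<and> \<bar>\<delta>\<bar> < \<delta>0 \<longrightarrow> card T \<le> (if 0 < \<delta> then jn else jp)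
      \<and> has_index E (\<lambda>x. q \<delta> x + C * (norm (rot \<delta> x - x))\<^sup>2) ((if 0 < \<delta> then jn else jp) - card T)"
    if C: "C0 \<le> C" for C
  proof -
    have Cpos: "0 < C" using C C0 by simp
    \<comment> \<open>On span T the margin \<eta> / 2 remains; on the span of B - T, where q 0 is
      only nonnegative, |G 0 x|^2 / C contributes \<kappa> / C.\<close>
    define \<eta>' where "\<eta>' = min (\<eta> / 2) (\<kappa> / C)"
    have e1: "\<eta>' \<le> \<eta> / 2" "\<eta>' \<le> \<kappa> / C" unfolding \<eta>'_def by (rule min.cobounded1, rule min.cobounded2)
    have eta': "0 < \<eta>'" using eta(1) kappa(1) Cpos by (simp add: \<eta>'_def)
    have st0: "strict_index E (\<lambda>x. q 0 x + (norm (G 0 x))\<^sup>2 / C) (card T) (card (B - T)) \<eta>'"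
      unfolding strict_index_def
    proof (rule exI[of _ T], rule exI[of _ "B - T"], intro conjI)
      show "\<forall>x\<in>cvs.span T. q 0 x + (norm (G 0 x))\<^sup>2 / C \<le> - \<eta>' * (norm x)\<^sup>2"
      proof
        fix x assume x: "x \<in> cvs.span T"
        have "(norm (G 0 x))\<^sup>2 \<le> ((1 + M) / 2 * norm x)\<^sup>2" using G_bound[of 0 x] by (rule power_mono) simp
        then have "(norm (G 0 x))\<^sup>2 / C \<le> ((1 + M) / 2 * norm x)\<^sup>2 / C" using Cpos by (simp add: divide_right_mono)
        also have "\<dots> = ((1 + M)\<^sup>2 / 4 / C) * (norm x)\<^sup>2" by (simp add: power_mult_distrib power_divide)
        also have "\<dots> \<le> (\<eta> / 2) * (norm x)\<^sup>2"
        proof (rule mult_right_mono)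
          have "(1 + M)\<^sup>2 \<le> 2 * \<eta> * C" using C eta(1) by (simp add: C0_def pos_divide_le_eq mult.commute)
          then show "(1 + M)\<^sup>2 / 4 / C \<le> \<eta> / 2" using Cpos by (simp add: field_simps)
        qed simp
        finally have "q 0 x + (norm (G 0 x))\<^sup>2 / C \<le> - (\<eta> / 2) * (norm x)\<^sup>2" using qT[OF x] by (simp add: algebra_simps)
        also have "\<dots> \<le> - \<eta>' * (norm x)\<^sup>2" by (rule mult_right_mono) (use e1(1) in simp_all)
        finally show "q 0 x + (norm (G 0 x))\<^sup>2 / C \<le> - \<eta>' * (norm x)\<^sup>2" .
      qed
      show "\<forall>x\<in>cvs.span (B - T). \<eta>' * (norm x)\<^sup>2 \<le> q 0 x + (norm (G 0 x))\<^sup>2 / C"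
      proof
        fix x assume x: "x \<in> cvs.span (B - T)"
        then have "x \<in> E" using s2(2) by blast
        have "\<eta>' * (norm x)\<^sup>2 \<le> \<kappa> / C * (norm x)\<^sup>2" by (rule mult_right_mono[OF e1(2)]) simp
        also have "\<dots> \<le> (norm (G 0 x))\<^sup>2 / C"
          using kappa(2)[OF \<open>x \<in> E\<close>] Cpos by (simp add: divide_right_mono)
        finally show "\<eta>' * (norm x)\<^sup>2 \<le> q 0 x + (norm (G 0 x))\<^sup>2 / C" using qP[OF x] by simp
      qed
    qed (use s1 s2 in auto)
    \<comment> \<open>Lipschitz constant in \<delta> at 0 of the form q + |G x|^2 / C: M from
      \<open>q_diff\<close>, the rest from \<open>G2_diff\<close>.\<close>
    define D where "D = M + M * (1 + M) / 2 / C"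
    have D: "0 < D" using M_pos Cpos by (simp add: D_def add_pos_nonneg)
    \<comment> \<open>The bound 1 keeps |\<delta>| below pi, so that sin \<delta> has the sign of
      \<delta> and e^{i \<delta>} differs from 1.\<close>
    define \<delta>0 where "\<delta>0 = min (\<eta>' / D) 1"
    have "0 < \<delta>0" using eta' D by (simp add: \<delta>0_def)
    moreover have "card T \<le> (if 0 < \<delta> then jn else jp)
      \<and> has_index E (\<lambda>x. q \<delta> x + C * (norm (rot \<delta> x - x))\<^sup>2) ((if 0 < \<delta> then jn else jp) - card T)"
      if d: "\<delta> \<noteq> 0" "\<bar>\<delta>\<bar> < \<delta>0" for \<delta>
    proof -
      have d1: "\<bar>\<delta>\<bar> < 1" "\<bar>\<delta>\<bar> * D < \<eta>'" using d D by (auto simp: \<delta>0_def pos_less_divide_eq)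
      have dpi: "\<bar>\<delta>\<bar> < pi" using d1(1) pi_gt3 by linarith
      have "strict_index E (\<lambda>x. q \<delta> x + (norm (G \<delta> x))\<^sup>2 / C) (card T) (card (B - T)) (\<eta>' - \<bar>\<delta>\<bar> * D)"
      proof (rule strict_index_perturb[OF st0])
        fix x
        define K2 where "K2 = M * (1 + M) / 2"
        define g where "g = (norm (G \<delta> x))\<^sup>2 - (norm (G 0 x))\<^sup>2"
        have "\<bar>g\<bar> / C \<le> \<bar>\<delta>\<bar> * K2 * (norm x)\<^sup>2 / C"
          unfolding g_def K2_def using Cpos by (intro divide_right_mono G2_diff) simp
        moreover have "\<bar>g / C\<bar> = \<bar>g\<bar> / C" using Cpos by (simp add: abs_divide)
        ultimately have "\<bar>(q \<delta> x - q 0 x) + g / C\<bar> \<le> \<bar>\<delta>\<bar> * M * (norm x)\<^sup>2 + \<bar>\<delta>\<bar> * K2 * (norm x)\<^sup>2 / C"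
          using q_diff[of \<delta> x] abs_triangle_ineq[of "q \<delta> x - q 0 x" "g / C"] by linarith
        moreover have "q \<delta> x + (norm (G \<delta> x))\<^sup>2 / C - (q 0 x + (norm (G 0 x))\<^sup>2 / C) = (q \<delta> x - q 0 x) + g / C"
          by (simp add: g_def diff_divide_distrib)
        moreover have "\<bar>\<delta>\<bar> * M * (norm x)\<^sup>2 + \<bar>\<delta>\<bar> * K2 * (norm x)\<^sup>2 / C = \<bar>\<delta>\<bar> * D * (norm x)\<^sup>2"
        proof -
          have "D = M + K2 / C" by (simp add: D_def K2_def)
          then show ?thesis by (simp add: distrib_left distrib_right)
        qed
        ultimately show "\<bar>q \<delta> x + (norm (G \<delta> x))\<^sup>2 / C - (q 0 x + (norm (G 0 x))\<^sup>2 / C)\<bar> \<le> \<bar>\<delta>\<bar> * D * (norm x)\<^sup>2"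
          by (simp only:)
      qed
      then have st: "strict_index E (\<lambda>x. Re (twist \<delta> x x) + (norm (G \<delta> x))\<^sup>2 / C) (card T) (card (B - T)) (\<eta>' - \<bar>\<delta>\<bar> * D)"
        by (simp add: twist_self)
      have pos: "0 < \<eta>' - \<bar>\<delta>\<bar> * D" using d1 by simp
      have idx: "has_index E (q \<delta>) (if 0 < \<delta> then jn else jp)"
      proof (cases "0 < \<delta>")
        case True
        then have "0 < sin \<delta>" using dpi by (intro sin_gt_zero) auto
        then show ?thesis using True twist_index[of 1 \<delta> jn] jn by simp
      next
        case False
        then have "0 < sin (- \<delta>)" using dpi d(1) by (intro sin_gt_zero) auto
        then show ?thesis using False twist_index[of "- 1" \<delta> jp] jp by simp
      qed
      have cis1: "cis \<delta> \<noteq> 1"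
      proof
        assume "cis \<delta> = 1"
        then have "sin \<delta> = 0" by (simp add: complex_eq_iff)
        then show False using sin_zero_iff_int2[of \<delta>] d(1) dpi sin_gt_zero[of \<delta>] sin_gt_zero[of "- \<delta>"]
          by (cases "0 < \<delta>") auto
      qed
      note ci = cayley_index[OF E_subspace E_fin_dim, of "\<lambda>x. rot \<delta> x - x" "G \<delta>" "twist \<delta>" C "card T" "card (B - T)"
          "\<eta>' - \<bar>\<delta>\<bar> * D" "if 0 < \<delta> then jn else jp"]
      have W_clin: "clin (\<lambda>x. rot \<delta> x - x)"
        by (simp add: clin_def clin_add[OF rot_clin] clin_scale[OF rot_clin] cvs.scale_right_diff_distrib)
      show ?thesis
        using ci[OF W_clin rot_E rot_injective[OF cis1] G_clin G_E herm_twist rel Cpos st pos] idx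
        by (simp add: twist_self)
    qed
    ultimately show ?thesis by blast
  qed
  show ?thesis using main C0 by blast
qed

end

section \<open>From the eigenspace E to the whole space\<close>

context krein_fredholm
begin

lemma twist_orthogonal:
  assumes "e \<in> E" "f \<in> F"
  shows "twist \<delta> e f = 0"
proof -
  have "rot \<delta> e \<in> E" unfolding rot_def using assms(1) E_U E_subspace by (auto intro: cvs.subspace_scale)
  then have "cinner (rot \<delta> e) (J f) = 0" using assms(2) by (simp add: F_def)
  moreover have "rot \<delta> f \<in> F" unfolding rot_def using assms(2) F_U F_subspace by (auto intro: cvs.subspace_scale)
  then have "cinner e (J (rot \<delta> f)) = 0" using assms(1) by (simp add: F_def)
  ultimately show ?thesis by (simp add: twist_def)
qed

lemma q_add: "e \<in> E \<Longrightarrow> f \<in> F \<Longrightarrow> q \<delta> (e + f) = q \<delta> e + q \<delta> f"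
  using herm_quad_add[OF herm_twist cvs.subspace_UNIV, of e f \<delta>] twist_orthogonal[of e f \<delta>]
  by (simp add: twist_self)

text \<open>On F the operator rot - 1 stays bounded below for small \<delta>, while q is at most M
  times the squared norm; the square wins once s is a small multiple of c. Later c = cos \<eta> and
  s = sin \<eta>, so this means a short arc.\<close>

lemma F_nonnegative:
  shows "\<exists>r>0. \<forall>c s. 0 < c \<and> 0 < s \<and> s \<le> r * c \<longrightarrow> (\<exists>\<delta>0>0. \<forall>\<delta> f. \<bar>\<delta>\<bar> < \<delta>0 \<and> f \<in> F
      \<longrightarrow> 0 \<le> c * (norm (rot \<delta> f - f))\<^sup>2 + 2 * s * q \<delta> f)"
proof -
  obtain \<gamma> where gam: "0 < \<gamma>" "\<And>f. f \<in> F \<Longrightarrow> \<gamma> * norm f \<le> norm (U f - f)"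
    by (rule F_bounded_below) (rule that)
  \<comment> \<open>The bound on \<delta> costs |\<delta>| M < \<gamma> / 2, which leaves half of
    the lower bound \<gamma>; the bound on s then says exactly 2 s M \<le> c (\<gamma> /
    2)^2.\<close>
  have main: "0 \<le> c * (norm (rot \<delta> f - f))\<^sup>2 + 2 * s * q \<delta> f"
    if c: "0 < c" and s: "0 < s" and sr: "s \<le> \<gamma>\<^sup>2 / (8 * M) * c" and dd: "\<bar>\<delta>\<bar> < \<gamma> / (2 * M)" and f: "f \<in> F"
    for c s \<delta> f
  proof -
    define w where "w = rot \<delta> f - f"
    have sF: "2 * s * M \<le> c * (\<gamma> / 2)\<^sup>2" using sr M_pos by (simp add: field_simps power2_eq_square)
    have "U f - f = w - (rot \<delta> f - U f)" by (simp add: w_def)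
    moreover have "rot \<delta> f - U f = scaleC (cis (- \<delta>) - 1) (U f)" by (simp add: rot_def cvs.scale_left_diff_distrib)
    moreover have "norm (scaleC (cis (- \<delta>) - 1) (U f)) \<le> \<bar>\<delta>\<bar> * (M * norm f)"
      unfolding norm_scaleC using cis_near_one[of "- \<delta>"] U_bound[of f] by (intro mult_mono) auto
    ultimately have "norm (U f - f) \<le> norm w + \<bar>\<delta>\<bar> * (M * norm f)"
      using norm_triangle_ineq4[of w "rot \<delta> f - U f"] by (metis add_left_mono order_trans)
    moreover have "\<bar>\<delta>\<bar> * (M * norm f) \<le> \<gamma> / (2 * M) * (M * norm f)"
      using dd M_pos by (intro mult_right_mono) auto
    moreover have "\<gamma> / (2 * M) * (M * norm f) = \<gamma> / 2 * norm f" using M_pos by simp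
    ultimately have "\<gamma> / 2 * norm f \<le> norm w" using gam(2)[OF f] by (simp add: field_simps)
    then have "(\<gamma> / 2 * norm f)\<^sup>2 \<le> (norm w)\<^sup>2" using gam(1) by (intro power_mono) auto
    then have "(\<gamma> / 2)\<^sup>2 * (norm f)\<^sup>2 \<le> (norm w)\<^sup>2" by (simp only: power_mult_distrib)
    then have "c * ((\<gamma> / 2)\<^sup>2 * (norm f)\<^sup>2) \<le> c * (norm w)\<^sup>2"
      by (rule mult_left_mono) (use c in simp)
    moreover have "2 * s * M * (norm f)\<^sup>2 \<le> c * (\<gamma> / 2)\<^sup>2 * (norm f)\<^sup>2" using sF by (rule mult_right_mono) simp
    moreover have "- (2 * s * M * (norm f)\<^sup>2) \<le> 2 * s * q \<delta> f"
    proof -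
      have "- (M * (norm f)\<^sup>2) \<le> q \<delta> f" using q_bound[of \<delta> f] by (simp add: abs_le_iff)
      then have "2 * s * (- (M * (norm f)\<^sup>2)) \<le> 2 * s * q \<delta> f" using s by (intro mult_left_mono) auto
      then show ?thesis by (simp only: mult_minus_right mult.assoc)
    qed
    moreover have "c * ((\<gamma> / 2)\<^sup>2 * (norm f)\<^sup>2) = c * (\<gamma> / 2)\<^sup>2 * (norm f)\<^sup>2"
      by (simp only: mult.assoc)
    ultimately show ?thesis unfolding w_def[symmetric] by linarith
  qed
  show ?thesis
  proof (rule exI[of _ "\<gamma>\<^sup>2 / (8 * M)"], rule conjI, goal_cases)
    case 1
    then show ?case using gam(1) M_pos by simp
  next
    case 2
    have "0 < \<gamma> / (2 * M)" using gam(1) M_pos by simp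
    then show ?case using main by (intro allI impI exI[of _ "\<gamma> / (2 * M)"] conjI) auto
  qed
qed

text \<open>N is squeezed between two indices equal to i - n0. Restriction to E gives the lower
  bound. For the upper one, |W u|^2 is replaced by the smaller \<kappa> (|W e|^2 + |W f|^2) for the
  components e, f of u, so that E and F decouple and F is nonnegative. Both use
  \<open>local_index\<close>, whose n0 is the same for all large C.\<close>

lemma global_index:
  assumes jn: "has_index E (\<lambda>x. Re (cinner x (J x))) jn" and jp: "has_index E (\<lambda>x. - Re (cinner x (J x))) jp"
  shows "\<exists>n0 r. 0 < r \<and> (\<forall>c s. 0 < c \<and> 0 < s \<and> s \<le> r * c \<longrightarrow> (\<exists>\<delta>0>0. \<forall>\<delta> N. \<delta> \<noteq> 0 \<and> \<bar>\<delta>\<bar> < \<delta>0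
      \<and> has_index UNIV (\<lambda>u. c * (norm (rot \<delta> u - u))\<^sup>2 + 2 * s * q \<delta> u) N
      \<longrightarrow> N + n0 = (if 0 < \<delta> then jn else jp)))"
proof -
  from local_index[OF jn jp] obtain n0 C0 where nC: "0 < C0 \<and> (\<forall>C\<ge>C0. \<exists>\<delta>0>0. \<forall>\<delta>. \<delta> \<noteq> 0 \<and> \<bar>\<delta>\<bar> < \<delta>0 \<longrightarrow>
      n0 \<le> (if 0 < \<delta> then jn else jp)
      \<and> has_index E (\<lambda>x. q \<delta> x + C * (norm (rot \<delta> x - x))\<^sup>2) ((if 0 < \<delta> then jn else jp) - n0))"
    by (elim exE) (rule that)
  note C0 = nC[THEN conjunct1] and loc = nC[THEN conjunct2, THEN spec, THEN mp]
  obtain pr C1 where pr: "clin pr" "\<And>x. pr x \<in> E" "\<And>x. x - pr x \<in> F" "\<And>x. norm (pr x) \<le> C1 * norm x" and C1: "0 \<le> C1"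
    by (rule projection_exists) (rule that)
  from F_nonnegative obtain \<rho> where rho: "0 < \<rho> \<and> (\<forall>c s. 0 < c \<and> 0 < s \<and> s \<le> \<rho> * c \<longrightarrow> (\<exists>\<delta>0>0. \<forall>\<delta> f. \<bar>\<delta>\<bar> < \<delta>0 \<and> f \<in> F
      \<longrightarrow> 0 \<le> c * (norm (rot \<delta> f - f))\<^sup>2 + 2 * s * q \<delta> f))" by (elim exE) (rule that)
  have pr_E: "pr e = e" if "e \<in> E" for e
  proof -
    have "e - pr e \<in> E" using that pr(2) E_subspace by (rule cvs.subspace_diff[rotated])
    then have "e - pr e = 0" using pr(3) by (rule E_F_trivial)
    then show ?thesis by simp
  qed
  have pr_F: "pr f = 0" if "f \<in> F" for f
  proof -
    have "f - (f - pr f) \<in> F" using that pr(3) F_subspace by (rule cvs.subspace_diff[rotated])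
    then have "pr f \<in> F" by simp
    then show ?thesis by (rule E_F_trivial[OF pr(2)])
  qed
  \<comment> \<open>The components of a vector w in E and F have norms at most C1 |w| and (1 + C1)
    |w|, so k |w|^2 bounds the sum of their squares; w will be W u, since W preserves E and
    F.\<close>
  define k where "k = C1\<^sup>2 + (1 + C1)\<^sup>2"
  define \<kappa> where "\<kappa> = 1 / k"
  have k1: "1 \<le> k" using C1 by (simp add: k_def power2_eq_square algebra_simps)
  have kap: "0 < \<kappa>" "\<kappa> \<le> 1" using k1 by (auto simp: \<kappa>_def)
  define W where "W \<delta> x = rot \<delta> x - x" for \<delta> x
  have W_clin: "clin (W \<delta>)" for \<delta>
    by (simp add: clin_def W_def clin_add[OF rot_clin] clin_scale[OF rot_clin] cvs.scale_right_diff_distrib)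
  have W_E: "W \<delta> e \<in> E" if "e \<in> E" for \<delta> e
    unfolding W_def rot_def using that E_U E_subspace by (intro cvs.subspace_diff cvs.subspace_scale) auto
  have W_F: "W \<delta> f \<in> F" if "f \<in> F" for \<delta> f
    unfolding W_def rot_def using that F_U F_subspace by (intro cvs.subspace_diff cvs.subspace_scale) auto
  have W_split: "\<kappa> * ((norm (W \<delta> (pr u)))\<^sup>2 + (norm (W \<delta> (u - pr u)))\<^sup>2) \<le> (norm (W \<delta> u))\<^sup>2" for \<delta> u
  proof -
    have s: "W \<delta> u = W \<delta> (pr u) + W \<delta> (u - pr u)" by (simp add: clin_diff[OF W_clin])
    have "pr (W \<delta> u) = W \<delta> (pr u)"
      unfolding s clin_add[OF pr(1)] pr_E[OF W_E[OF pr(2)]] pr_F[OF W_F[OF pr(3)]] by simp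
    then have a: "norm (W \<delta> (pr u)) \<le> C1 * norm (W \<delta> u)" using pr(4)[of "W \<delta> u"] by simp
    have "W \<delta> (u - pr u) = W \<delta> u - W \<delta> (pr u)" by (rule clin_diff[OF W_clin])
    then have "norm (W \<delta> (u - pr u)) = norm (W \<delta> u - W \<delta> (pr u))" by (rule arg_cong)
    then have b: "norm (W \<delta> (u - pr u)) \<le> (1 + C1) * norm (W \<delta> u)"
      using norm_triangle_ineq4[of "W \<delta> u" "W \<delta> (pr u)"] a unfolding distrib_right by linarith
    have "(norm (W \<delta> (pr u)))\<^sup>2 + (norm (W \<delta> (u - pr u)))\<^sup>2 \<le> (C1 * norm (W \<delta> u))\<^sup>2 + ((1 + C1) * norm (W \<delta> u))\<^sup>2"
      using a b by (intro add_mono power_mono) auto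
    also have "\<dots> = k * (norm (W \<delta> u))\<^sup>2" unfolding k_def power_mult_distrib by (rule distrib_right[symmetric])
    finally show ?thesis using k1 by (simp add: \<kappa>_def divide_le_eq mult.commute)
  qed
  \<comment> \<open>Below this ratio s / c both constants c / (2 s) and \<kappa> c / (2 s) are at
    least C0, and \<open>F_nonnegative\<close> applies with \<kappa> c in place of c.\<close>
  define r where "r = min (\<kappa> / (2 * C0)) (\<rho> * \<kappa>)"
  have r0: "0 < r" using kap C0 rho[THEN conjunct1] by (simp add: r_def)
  have r1: "r \<le> \<kappa> / (2 * C0)" "r \<le> \<rho> * \<kappa>" unfolding r_def by (rule min.cobounded1, rule min.cobounded2)
  have main: "\<exists>\<delta>0>0. \<forall>\<delta> N. \<delta> \<noteq> 0 \<and> \<bar>\<delta>\<bar> < \<delta>0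
      \<and> has_index UNIV (\<lambda>u. c * (norm (W \<delta> u))\<^sup>2 + 2 * s * q \<delta> u) N \<longrightarrow> N + n0 = (if 0 < \<delta> then jn else jp)"
    if c: "0 < c" and s: "0 < s" and sr: "s \<le> r * c" for c s
  proof -
    have "s \<le> \<kappa> / (2 * C0) * c" using sr mult_right_mono[OF r1(1), of c] c by linarith
    then have Ck: "C0 \<le> \<kappa> * c / (2 * s)" using s C0 by (simp add: field_simps)
    have "\<kappa> * c / (2 * s) \<le> c / (2 * s)" using kap c s by (intro divide_right_mono) auto
    then have Cc: "C0 \<le> c / (2 * s)" using Ck by simp
    have "s \<le> \<rho> * \<kappa> * c" using sr mult_right_mono[OF r1(2), of c] c by linarith
    then have "0 < \<kappa> * c \<and> 0 < s \<and> s \<le> \<rho> * (\<kappa> * c)" using c s kap by (simp add: mult.assoc)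
    from rho[THEN conjunct2, THEN spec, THEN spec, THEN mp, OF this]
    obtain d3 where d3: "0 < d3" "\<And>\<delta> f. \<bar>\<delta>\<bar> < d3 \<Longrightarrow> f \<in> F \<Longrightarrow>
      0 \<le> \<kappa> * c * (norm (rot \<delta> f - f))\<^sup>2 + 2 * s * q \<delta> f" by blast
    obtain d1 where d1: "0 < d1" "\<And>\<delta>. \<delta> \<noteq> 0 \<Longrightarrow> \<bar>\<delta>\<bar> < d1 \<Longrightarrow> n0 \<le> (if 0 < \<delta> then jn else jp)
      \<and> has_index E (\<lambda>x. q \<delta> x + c / (2 * s) * (norm (rot \<delta> x - x))\<^sup>2) ((if 0 < \<delta> then jn else jp) - n0)"
      using loc[OF Cc] by blast
    obtain d2 where d2: "0 < d2" "\<And>\<delta>. \<delta> \<noteq> 0 \<Longrightarrow> \<bar>\<delta>\<bar> < d2 \<Longrightarrow> n0 \<le> (if 0 < \<delta> then jn else jp)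
      \<and> has_index E (\<lambda>x. q \<delta> x + \<kappa> * c / (2 * s) * (norm (rot \<delta> x - x))\<^sup>2) ((if 0 < \<delta> then jn else jp) - n0)"
      using loc[OF Ck] by blast
    define d0 where "d0 = min d1 (min d2 d3)"
    have "0 < d0" using d1(1) d2(1) d3(1) by (simp add: d0_def)
    moreover have "N + n0 = (if 0 < \<delta> then jn else jp)"
      if d: "\<delta> \<noteq> 0" "\<bar>\<delta>\<bar> < d0" and N: "has_index UNIV (\<lambda>u. c * (norm (W \<delta> u))\<^sup>2 + 2 * s * q \<delta> u) N" for \<delta> N
    proof -
      define i where "i = (if 0 < \<delta> then jn else jp)"
      have dd: "\<bar>\<delta>\<bar> < d1" "\<bar>\<delta>\<bar> < d2" "\<bar>\<delta>\<bar> < d3" using d(2) by (auto simp: d0_def)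
      have ni: "n0 \<le> i" and h1: "has_index E (\<lambda>x. q \<delta> x + c / (2 * s) * (norm (W \<delta> x))\<^sup>2) (i - n0)"
        and h2: "has_index E (\<lambda>x. q \<delta> x + \<kappa> * c / (2 * s) * (norm (W \<delta> x))\<^sup>2) (i - n0)"
        using d1(2)[OF d(1) dd(1)] d2(2)[OF d(1) dd(2)] unfolding W_def i_def by blast+
      have e1: "2 * s * (q \<delta> x + c / (2 * s) * (norm (W \<delta> x))\<^sup>2) = c * (norm (W \<delta> x))\<^sup>2 + 2 * s * q \<delta> x" for x
        using s by (simp add: field_simps)
      have e2: "2 * s * (q \<delta> x + \<kappa> * c / (2 * s) * (norm (W \<delta> x))\<^sup>2) = \<kappa> * c * (norm (W \<delta> x))\<^sup>2 + 2 * s * q \<delta> x" for x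
        using s by (simp add: field_simps)
      have s2: "0 < 2 * s" using s by simp
      have h1': "has_index E (\<lambda>x. c * (norm (W \<delta> x))\<^sup>2 + 2 * s * q \<delta> x) (i - n0)"
        using has_index_scale[OF h1 s2] unfolding e1 .
      have h2': "has_index E (\<lambda>x. \<kappa> * c * (norm (W \<delta> x))\<^sup>2 + 2 * s * q \<delta> x) (i - n0)"
        using has_index_scale[OF h2 s2] unfolding e2 .
      have "i - n0 \<le> N" by (rule has_index_mono[OF h1' N]) auto
      define p where "p x = \<kappa> * c * (norm (W \<delta> x))\<^sup>2 + 2 * s * q \<delta> x" for x
      have p0: "p 0 = 0" by (simp add: p_def clin_zero[OF W_clin] q_def clin_zero[OF J])
      have pF: "0 \<le> p f" if f: "f \<in> F" for f
        using d3(2)[OF dd(3) f] unfolding p_def W_def .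
      \<comment> \<open>For this decoupled form a negative subspace can be taken inside E, and the
        nonnegative part of E extended by all of F is the set of u with pr u in P2.\<close>
      define q' where "q' u = p (pr u) + p (u - pr u)" for u
      have "has_index UNIV q' (i - n0)"
      proof -
        obtain B P2 where B: "finite B" "cvs.independent B" "card B = i - n0" "cvs.span B \<subseteq> E"
          "cvs.subspace P2" "P2 \<subseteq> E" "\<And>x. x \<in> E \<Longrightarrow> \<exists>a\<in>cvs.span B. x - a \<in> P2"
          "\<And>x. x \<in> cvs.span B \<Longrightarrow> x \<noteq> 0 \<Longrightarrow> p x < 0" "\<And>x. x \<in> P2 \<Longrightarrow> 0 \<le> p x"
          by (rule has_indexE[OF h2'[folded p_def]]) (rule that)
        show ?thesis unfolding has_index_def
        proof (rule exI[of _ B], rule exI[of _ "{u. pr u \<in> P2}"], intro conjI ballI impI)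
          show "cvs.subspace {u. pr u \<in> P2}"
            using module_hom.subspace_vimage[OF clin_module_hom[OF pr(1)] B(5)] by (simp add: vimage_def)
          show "\<exists>a\<in>cvs.span B. x - a \<in> {u. pr u \<in> P2}" for x
          proof -
            obtain a where a: "a \<in> cvs.span B" "pr x - a \<in> P2" using B(7)[OF pr(2)] by blast
            have "a \<in> E" using a(1) B(4) by blast
            then have "pr (x - a) = pr x - a" by (simp add: clin_diff[OF pr(1)] pr_E)
            then have "x - a \<in> {u. pr u \<in> P2}" using a(2) by simp
            then show ?thesis using a(1) by (rule bexI)
          qed
          show "q' x < 0" if "x \<in> cvs.span B" "x \<noteq> 0" for x
          proof -
            have "pr x = x" using that(1) B(4) pr_E by blast
            then show ?thesis using B(8)[OF that] by (simp add: q'_def p0)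
          qed
          show "0 \<le> q' x" if "x \<in> {u. pr u \<in> P2}" for x
            using that B(9) pF[OF pr(3)] by (auto simp: q'_def intro: add_nonneg_nonneg)
        qed (use B(1-3) in auto)
      qed
      moreover have "q' u \<le> c * (norm (W \<delta> u))\<^sup>2 + 2 * s * q \<delta> u" for u
      proof -
        have "q \<delta> u = q \<delta> (pr u) + q \<delta> (u - pr u)" using q_add[OF pr(2) pr(3), of \<delta> u u] by simp
        moreover have "c * (\<kappa> * ((norm (W \<delta> (pr u)))\<^sup>2 + (norm (W \<delta> (u - pr u)))\<^sup>2)) \<le> c * (norm (W \<delta> u))\<^sup>2"
          using W_split c by (intro mult_left_mono) auto
        ultimately show ?thesis by (simp add: q'_def p_def algebra_simps)
      qed
      ultimately have "N \<le> i - n0" using has_index_mono[OF N, of UNIV q' "i - n0"] by simp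
      then show ?thesis using \<open>i - n0 \<le> N\<close> ni by (simp add: i_def[symmetric])
    qed
    ultimately show ?thesis by blast
  qed
  show ?thesis
  proof (rule exI[of _ n0], rule exI[of _ r], rule conjI[OF r0], intro allI impI, elim conjE)
    fix c s assume "0 < c" "0 < s" "s \<le> r * c"
    then show "\<exists>\<delta>0>0. \<forall>\<delta> N. \<delta> \<noteq> 0 \<and> \<bar>\<delta>\<bar> < \<delta>0
      \<and> has_index UNIV (\<lambda>u. c * (norm (rot \<delta> u - u))\<^sup>2 + 2 * s * q \<delta> u) N
      \<longrightarrow> N + n0 = (if 0 < \<delta> then jn else jp)"
      by (rule main[unfolded W_def])
  qed
qed

end

section \<open>The Riesz projection\<close>

lemma kspan_span: "kspan S = cvs.span (S :: ('h::chilbert \<times> 'h) set)"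
proof
  show "kspan S \<subseteq> cvs.span S"
  proof
    fix x assume "x \<in> kspan S"
    then obtain vs :: "('h \<times> 'h) list" and cs where v: "set vs \<subseteq> S"
      "x = (\<Sum>i<length vs. kscale (cs ! i) (vs ! i))" unfolding kspan_def by blast
    have "vs ! i \<in> cvs.span S" if "i < length vs" for i
      using v(1) nth_mem[OF that] by (intro cvs.span_base) blast
    then show "x \<in> cvs.span S" unfolding v(2) kscale_scaleC
      by (intro cvs.span_sum cvs.span_scale) simp
  qed
  show "cvs.span S \<subseteq> kspan S"
  proof
    fix x assume "x \<in> cvs.span S"
    then show "x \<in> kspan S"
    proof (induction rule: cvs.span_induct_alt)
      case base
      show ?case unfolding kspan_def mem_Collect_eq by (rule exI[of _ "[]"], rule exI[of _ "[]"]) simp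
    next
      case (step c x y)
      then obtain vs :: "('h \<times> 'h) list" and cs where v: "length cs = length vs" "set vs \<subseteq> S"
        "y = (\<Sum>i<length vs. kscale (cs ! i) (vs ! i))" unfolding kspan_def by blast
      show ?case unfolding kspan_def mem_Collect_eq
        by (rule exI[of _ "x # vs"], rule exI[of _ "c # cs"])
          (use v step in \<open>simp add: sum.lessThan_Suc_shift kscale_scaleC del: sum.lessThan_Suc\<close>)
    qed
  qed
qed

lemma kfinite_dim_fin_dim: "kfinite_dim V \<Longrightarrow> fin_dim V"
  unfolding kfinite_dim_def kspan_span fin_dim_def by blast

lemma kbounded_clin: "kbounded T \<Longrightarrow> clin T"
  unfolding kbounded_def clin_def kscale_scaleC by blast

lemma kbounded_bound:
  assumes "kbounded T"
  obtains C where "0 < C" "\<And>x. norm (T x) \<le> C * norm x"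
proof -
  obtain C where C: "\<And>x. norm (T x) \<le> C * norm x" using assms unfolding kbounded_def by blast
  have "norm (T x) \<le> (\<bar>C\<bar> + 1) * norm x" for x
  proof -
    have "C * norm x \<le> (\<bar>C\<bar> + 1) * norm x" by (rule mult_right_mono) auto
    then show ?thesis using C[of x] by linarith
  qed
  then show ?thesis using that[of "\<bar>C\<bar> + 1"] by simp
qed

lemma clin_bounded_linear:
  assumes "clin f" "\<And>x. norm (f x) \<le> C * norm x"
  shows "bounded_linear f"
  by (rule bounded_linear_intro[where K = C])
    (use assms in \<open>simp_all add: clin_add scaleR_scaleC clin_scale mult.commute\<close>)

text \<open>Passage from local to uniform bounds, for the norm of the resolvent along the circle: a
  sequence violating the bounds 0, 1, 2, ... would accumulate at a point without a local
  bound.\<close>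

lemma locally_bounded_compact:
  fixes K :: "'b::metric_space set"
  assumes K: "compact K" and mono: "\<And>x c d. P x c \<Longrightarrow> c \<le> d \<Longrightarrow> P x d"
    and loc: "\<And>x. x \<in> K \<Longrightarrow> \<exists>e>0. \<exists>c. \<forall>y\<in>K. dist y x < e \<longrightarrow> P y (c::real)"
  shows "\<exists>c. \<forall>x\<in>K. P x c"
proof (rule ccontr)
  assume "\<not> (\<exists>c. \<forall>x\<in>K. P x c)"
  then have "\<forall>n. \<exists>x\<in>K. \<not> P x (real n)" by blast
  then obtain x where x: "\<And>n. x n \<in> K" "\<And>n. \<not> P (x n) (real n)" by metis
  obtain l s where l: "l \<in> K" "strict_mono s" "(x \<circ> s) \<longlonglongrightarrow> l"
    using K x(1) unfolding compact_def by metis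
  obtain e c where e: "0 < e" "\<And>y. y \<in> K \<Longrightarrow> dist y l < e \<Longrightarrow> P y c" using loc[OF l(1)] by blast
  obtain n0 where n0: "\<And>n. n \<ge> n0 \<Longrightarrow> dist ((x \<circ> s) n) l < e" using l(3) e(1) unfolding lim_sequentially by blast
  obtain n1 where n1: "c \<le> real n1" using real_arch_simple by blast
  define n where "n = max n0 n1"
  have "P (x (s n)) c" using n0[of n] x(1) by (intro e(2)) (auto simp: n_def)
  moreover have "n \<le> s n" by (rule seq_suble[OF l(2)])
  then have "c \<le> real (s n)" using n1 by (auto simp: n_def)
  ultimately show False using mono x(2) by blast
qed

text \<open>\<open>kspec\<close> speaks of T - \<zeta> while \<open>kres\<close> inverts \<zeta> -
  T, hence the sign in the identification of \<open>kres\<close> with - S.\<close>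

lemma kres_properties:
  assumes T: "kbounded T" and \<zeta>: "\<zeta> \<notin> kspec T"
  shows "kres T \<zeta> (scaleC \<zeta> x - T x) = x" "scaleC \<zeta> (kres T \<zeta> x) - T (kres T \<zeta> x) = x"
    "clin (kres T \<zeta>)" "\<exists>C>0. \<forall>x. norm (kres T \<zeta> x) \<le> C * norm x"
proof -
  define B where "B x = scaleC \<zeta> x - T x" for x
  have cT: "clin T" by (rule kbounded_clin[OF T])
  have "kinvertible (\<lambda>x. T x - scaleC \<zeta> x)" using \<zeta> by (simp add: kspec_def kscale_scaleC)
  then obtain S where S: "kbounded S" "\<And>x. S (T x - scaleC \<zeta> x) = x" "\<And>x. T (S x) - scaleC \<zeta> (S x) = x"
    unfolding kinvertible_def by blast
  have cS: "clin S" by (rule kbounded_clin[OF S(1)])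
  have "inj B"
  proof (rule injI)
    fix x y assume "B x = B y"
    then have "S (- B x) = S (- B y)" by simp
    then show "x = y" using S(2) by (simp add: B_def)
  qed
  have BS: "B (- S x) = x" for x using S(3)[of x] by (simp add: B_def clin_neg[OF cT])
  have "surj B" by (rule surjI[of _ "\<lambda>x. - S x"]) (rule BS)
  have k: "kres T \<zeta> = inv_into UNIV B" unfolding kres_def B_def kscale_scaleC ..
  have kS: "kres T \<zeta> x = - S x" for x
    unfolding k using inv_f_f[OF \<open>inj B\<close>, of "- S x"] BS by simp
  show "kres T \<zeta> (scaleC \<zeta> x - T x) = x" using inv_f_f[OF \<open>inj B\<close>, of x] by (simp add: k B_def)
  show "scaleC \<zeta> (kres T \<zeta> x) - T (kres T \<zeta> x) = x"
    using surj_f_inv_f[OF \<open>surj B\<close>, of x] by (simp add: k B_def)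
  show "clin (kres T \<zeta>)" unfolding clin_def kS by (simp add: clin_add[OF cS] clin_scale[OF cS])
  obtain C where "0 < C" "\<And>x. norm (S x) \<le> C * norm x" using kbounded_bound[OF S(1)] by blast
  then show "\<exists>C>0. \<forall>x. norm (kres T \<zeta> x) \<le> C * norm x" unfolding kS by auto
qed

text \<open>The resolvent identity w = (\<zeta> - \<omega>) R(\<zeta>) w + R(\<zeta>) y for w =
  R(\<omega>) y; the smallness condition lets half of |w| be absorbed on the left. This gives local
  boundedness and continuity of the resolvent.\<close>

lemma kres_local_bound:
  assumes T: "kbounded T" and \<zeta>: "\<zeta> \<notin> kspec T" "\<omega> \<notin> kspec T"
    and C: "0 < C" "\<And>x. norm (kres T \<zeta> x) \<le> C * norm x" and d: "cmod (\<omega> - \<zeta>) * C \<le> 1 / 2"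
  shows "norm (kres T \<omega> y) \<le> 2 * C * norm y"
    and "norm (kres T \<omega> y - kres T \<zeta> y) \<le> cmod (\<omega> - \<zeta>) * (2 * C\<^sup>2 * norm y)"
proof -
  define w where "w = kres T \<omega> y"
  have "scaleC \<omega> w - T w = y" unfolding w_def by (rule kres_properties(2)[OF T \<zeta>(2)])
  then have "y = scaleC \<omega> w - T w" by (rule sym)
  then have "scaleC \<zeta> w - T w = scaleC (\<zeta> - \<omega>) w + y" by (simp add: cvs.scale_left_diff_distrib)
  then have "kres T \<zeta> (scaleC (\<zeta> - \<omega>) w + y) = w" using kres_properties(1)[OF T \<zeta>(1), of w] by simp
  then have w: "w = scaleC (\<zeta> - \<omega>) (kres T \<zeta> w) + kres T \<zeta> y"
    by (simp add: clin_add[OF kres_properties(3)[OF T \<zeta>(1)]] clin_scale[OF kres_properties(3)[OF T \<zeta>(1)]])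
  have n: "norm (scaleC (\<zeta> - \<omega>) (kres T \<zeta> w)) \<le> cmod (\<omega> - \<zeta>) * (C * norm w)"
    unfolding norm_scaleC norm_minus_commute[of \<zeta> \<omega>] by (intro mult_left_mono C) simp
  have "cmod (\<omega> - \<zeta>) * (C * norm w) \<le> 1 / 2 * norm w"
    using mult_right_mono[OF d, of "norm w"] by (simp add: mult.assoc)
  then have "norm w \<le> 1 / 2 * norm w + C * norm y"
    using n C(2)[of y] norm_triangle_ineq[of "scaleC (\<zeta> - \<omega>) (kres T \<zeta> w)" "kres T \<zeta> y"] w by simp
  then have nw: "norm w \<le> 2 * C * norm y" by simp
  then show "norm (kres T \<omega> y) \<le> 2 * C * norm y" by (simp add: w_def)
  have "norm (w - kres T \<zeta> y) \<le> cmod (\<omega> - \<zeta>) * (C * norm w)"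
    using n w by (metis add_diff_cancel_right')
  also have "\<dots> \<le> cmod (\<omega> - \<zeta>) * (C * (2 * C * norm y))" using nw C(1) by (intro mult_left_mono) auto
  finally show "norm (kres T \<omega> y - kres T \<zeta> y) \<le> cmod (\<omega> - \<zeta>) * (2 * C\<^sup>2 * norm y)"
    by (simp add: w_def power2_eq_square mult_ac)
qed

text \<open>$S$ is the mean of the resolvent over the circle,
  $(2\pi i)^{-1}\oint(\zeta - z)^{-1}(\zeta - T)^{-1}d\zeta$, as a vector-valued integral.\<close>
lemma riesz_parametrix:
  fixes T :: "'h::chilbert \<times> 'h \<Rightarrow> 'h \<times> 'h"
  assumes T: "kbounded T" and rf: "riesz_finite T z"
  obtains S P L where "clin S" "\<And>x. norm (S x) \<le> L * norm x" "clin P" "fin_dim (range P)"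
    "\<And>x. S (scaleC z x - T x) = x - P x" "\<And>x. scaleC z (S x) - T (S x) = x - P x"
proof -
  obtain r P where r: "0 < r" "cball z r \<inter> kspec T = {z}" and P: "kbounded P" "kfinite_dim (range P)"
    and Pint: "\<And>x y. kinner x (P y) =
       contour_integral (circlepath z r) (\<lambda>\<zeta>. kinner x (kres T \<zeta> y)) / (2 * of_real pi * \<i>)"
    using rf unfolding riesz_finite_def by blast
  define g where "g = circlepath z r"
  have g: "g t - z = of_real r * exp (2 * of_real pi * \<i> * of_real t)" for t
    by (simp add: g_def circlepath)
  have gd: "cmod (g t - z) = r" for t using r(1) by (simp add: g norm_mult)
  have gspec: "g t \<notin> kspec T" for t
  proof
    assume "g t \<in> kspec T"
    moreover have "g t \<in> cball z r" using gd[of t] by (simp add: dist_norm norm_minus_commute)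
    ultimately have "g t = z" using r(2) by blast
    then show False using gd[of t] r(1) by simp
  qed
  have gcont: "continuous_on {0..1} g" unfolding g_def using path_circlepath path_def by blast
  define R where "R t = kres T (g t)" for t
  note kp = kres_properties[OF T gspec]
  have R1: "R t (scaleC (g t) x - T x) = x" and R2: "scaleC (g t) (R t x) - T (R t x) = x" and R3: "clin (R t)" for t x
    unfolding R_def by (rule kp)+
  have cT: "clin T" by (rule kbounded_clin[OF T])
  have cont_R: "continuous_on {0..1} (\<lambda>t. R t y)" for y
    unfolding continuous_on_iff
  proof (intro ballI allI impI)
    fix t e :: real assume t: "t \<in> {0..1}" and e: "0 < e"
    obtain C where C: "0 < C" "\<And>x. norm (kres T (g t) x) \<le> C * norm x" using kp(4) by blast
    define b where "b = min (1 / (2 * C)) (e / (2 * C\<^sup>2 * norm y + 1))"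
    have "0 < b" using C(1) e by (simp add: b_def add_nonneg_pos)
    then obtain d where d: "0 < d" "\<And>t'. t' \<in> {0..1} \<Longrightarrow> dist t' t < d \<Longrightarrow> dist (g t') (g t) < b"
      using gcont t unfolding continuous_on_iff by blast
    have "dist (R t' y) (R t y) < e" if "t' \<in> {0..1}" "dist t' t < d" for t'
    proof -
      have b: "cmod (g t' - g t) < b" using d(2)[OF that] by (simp add: dist_norm)
      then have "cmod (g t' - g t) < 1 / (2 * C)" by (simp add: b_def)
      then have "cmod (g t' - g t) * C \<le> 1 / 2" using C(1) by (simp add: field_simps)
      from kres_local_bound(2)[OF T gspec gspec C this, of y]
      have "norm (R t' y - R t y) \<le> cmod (g t' - g t) * (2 * C\<^sup>2 * norm y)" by (simp add: R_def)
      also have "\<dots> \<le> cmod (g t' - g t) * (2 * C\<^sup>2 * norm y + 1)" by (intro mult_left_mono) auto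
      also have "\<dots> < e"
      proof -
        have "cmod (g t' - g t) < e / (2 * C\<^sup>2 * norm y + 1)" using b by (simp add: b_def)
        moreover have "0 < 2 * C\<^sup>2 * norm y + 1" by (simp add: add_nonneg_pos)
        ultimately show ?thesis by (simp add: pos_less_divide_eq)
      qed
      finally show ?thesis by (simp add: dist_norm)
    qed
    then show "\<exists>d>0. \<forall>t'\<in>{0..1}. dist t' t < d \<longrightarrow> dist (R t' y) (R t y) < e" using d(1) by blast
  qed
  have int_R: "(\<lambda>t. R t y) integrable_on {0..1}" for y by (rule integrable_continuous_real[OF cont_R])
  have "\<exists>L. \<forall>t\<in>{0..1}. \<forall>y. norm (R t y) \<le> L * norm y"
  proof (rule locally_bounded_compact[where P = "\<lambda>t L. \<forall>y. norm (R t y) \<le> L * norm y"])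
    fix t c d assume "\<forall>y. norm (R t y) \<le> c * norm y" "c \<le> d"
    then show "\<forall>y. norm (R t y) \<le> d * norm y" by (meson mult_right_mono norm_ge_zero order_trans)
  next
    fix t :: real assume t: "t \<in> {0..1}"
    obtain C where C: "0 < C" "\<And>x. norm (kres T (g t) x) \<le> C * norm x" using kp(4) by blast
    have "0 < 1 / (2 * C)" using C(1) by simp
    then obtain d where d: "0 < d" "\<And>t'. t' \<in> {0..1} \<Longrightarrow> dist t' t < d \<Longrightarrow> dist (g t') (g t) < 1 / (2 * C)"
      using gcont t unfolding continuous_on_iff by blast
    have "norm (R t' y) \<le> 2 * C * norm y" if "t' \<in> {0..1}" "dist t' t < d" for t' y
    proof -
      have "cmod (g t' - g t) * C \<le> 1 / 2" using d(2)[OF that] C(1) by (simp add: dist_norm field_simps)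
      from kres_local_bound(1)[OF T gspec gspec C this] show ?thesis by (simp add: R_def)
    qed
    then show "\<exists>e>0. \<exists>c. \<forall>t'\<in>{0..1}. dist t' t < e \<longrightarrow> (\<forall>y. norm (R t' y) \<le> c * norm y)" using d(1) by blast
  qed simp
  then obtain L where L: "\<And>t y. t \<in> {0..1} \<Longrightarrow> norm (R t y) \<le> L * norm y" by blast
  define S where "S y = integral {0..1} (\<lambda>t. R t y)" for y
  have bl_scale: "bounded_linear (scaleC c :: 'h \<times> 'h \<Rightarrow> 'h \<times> 'h)" for c
    by (rule bounded_bilinear.bounded_linear_right[OF bounded_bilinear_scaleC])
  have S_clin: "clin S"
    unfolding clin_def S_def
  proof (intro conjI allI)
    fix x y show "integral {0..1} (\<lambda>t. R t (x + y)) = integral {0..1} (\<lambda>t. R t x) + integral {0..1} (\<lambda>t. R t y)"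
      unfolding clin_add[OF R3] by (rule integral_add[OF int_R int_R])
  next
    fix c x show "integral {0..1} (\<lambda>t. R t (scaleC c x)) = scaleC c (integral {0..1} (\<lambda>t. R t x))"
      unfolding clin_scale[OF R3] using integral_linear[OF int_R bl_scale, of c x] by (simp add: o_def)
  qed
  have S_bound: "norm (S y) \<le> L * norm y" for y
    using integral_bound[of 0 1 "\<lambda>t. R t y" "L * norm y"] cont_R L by (simp add: S_def)
  define e where "e t = g t - z" for t
  have e_cont: "continuous_on {0..1} e" unfolding e_def by (intro continuous_on_diff gcont continuous_on_const)
  have int_eR: "(\<lambda>t. scaleC (e t) (R t y)) integrable_on {0..1}" for y
    by (intro integrable_continuous_real bounded_bilinear.continuous_on[OF bounded_bilinear_scaleC] e_cont cont_R)
  \<comment> \<open>On the circle d\<zeta> = 2 pi i (\<zeta> - z) dt, so the weakly given contour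
    integral becomes an honest vector integral over [0, 1], tested against all x.\<close>
  have Peq: "P y = integral {0..1} (\<lambda>t. scaleC (e t) (R t y))" (is "_ = ?Q") for y
  proof -
    have bl: "bounded_linear (cinner x)" for x :: "'h \<times> 'h"
      by (rule bounded_bilinear.bounded_linear_right[OF bounded_bilinear_cinner])
    have "cinner x (P y) = cinner x ?Q" for x
    proof -
      have "cinner x (P y) = integral {0..1} (\<lambda>t. cinner x (R t y) * vector_derivative g (at t)) / (2 * of_real pi * \<i>)"
        using Pint[of x y] unfolding kinner_cinner contour_integral_integral g_def[symmetric] R_def .
      also have "integral {0..1} (\<lambda>t. cinner x (R t y) * vector_derivative g (at t))
          = integral {0..1} (\<lambda>t. 2 * of_real pi * \<i> * cinner x (scaleC (e t) (R t y)))"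
      proof (rule integral_cong)
        fix t :: real assume t: "t \<in> {0..1}"
        have "vector_derivative g (at t) = 2 * of_real pi * \<i> * e t"
          using vector_derivative_circlepath[of z r t] by (simp add: g_def[symmetric] e_def g mult_ac)
        then show "cinner x (R t y) * vector_derivative g (at t) = 2 * of_real pi * \<i> * cinner x (scaleC (e t) (R t y))"
          by (simp add: cinner_scaleC_right)
      qed
      also have "\<dots> = 2 * of_real pi * \<i> * integral {0..1} (\<lambda>t. cinner x (scaleC (e t) (R t y)))"
        by (rule integral_mult_right)
      also have "integral {0..1} (\<lambda>t. cinner x (scaleC (e t) (R t y))) = cinner x ?Q"
        using integral_linear[OF int_eR bl, of x y] by (simp add: o_def)
      finally show ?thesis by simp
    qed
    then have "cinner (P y - ?Q) (P y - ?Q) = 0" by (simp add: cinner_diff_right)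
    then have "P y - ?Q = 0" by (rule cinner_self_zero)
    then show ?thesis by simp
  qed
  \<comment> \<open>Since z - T = (\<zeta> - T) - (\<zeta> - z), multiplying the resolvent by z - T
    on either side gives 1 - (\<zeta> - z) R(\<zeta>), and the mean of this is 1 - P.\<close>
  have key: "integral {0..1} (\<lambda>t. y - scaleC (e t) (R t y)) = y - P y" for y
    unfolding Peq using integral_diff[OF integrable_const_ivl[of y 0 1] int_eR[of y]] by simp
  have SA: "S (scaleC z y - T y) = y - P y" for y
  proof -
    have "R t (scaleC z y - T y) = y - scaleC (e t) (R t y)" for t
    proof -
      have "scaleC z y - T y = (scaleC (g t) y - T y) - scaleC (e t) y" by (simp add: e_def cvs.scale_left_diff_distrib)
      then show ?thesis by (simp only: clin_diff[OF R3, of _ "scaleC (g t) y - T y"] R1 clin_scale[OF R3])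
    qed
    then show ?thesis unfolding S_def by (simp add: key)
  qed
  obtain C where C: "0 < C" "\<And>x. norm (T x) \<le> C * norm x" using kbounded_bound[OF T] by blast
  have AS: "scaleC z (S y) - T (S y) = y - P y" for y
  proof -
    have bl: "bounded_linear (\<lambda>x. scaleC z x - T x)"
      by (intro bounded_linear_sub bl_scale clin_bounded_linear[OF cT C(2)])
    have "scaleC z (S y) - T (S y) = integral {0..1} (\<lambda>t. scaleC z (R t y) - T (R t y))"
      unfolding S_def using integral_linear[OF int_R bl, of y] by (simp add: o_def)
    also have "\<dots> = integral {0..1} (\<lambda>t. y - scaleC (e t) (R t y))"
    proof (rule integral_cong)
      fix t
      show "scaleC z (R t y) - T (R t y) = y - scaleC (e t) (R t y)"
        using R2[of t y] by (simp add: e_def cvs.scale_left_diff_distrib algebra_simps)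
    qed
    finally show ?thesis by (simp add: key)
  qed
  show ?thesis
    by (rule that[OF S_clin S_bound kbounded_clin[OF P(1)] kfinite_dim_fin_dim[OF P(2)] SA AS])
qed

section \<open>Sums of subspaces, dimension, and a surjectivity criterion\<close>

lemma span_Union_family:
  assumes A: "\<And>i. i \<in> I \<Longrightarrow> cvs.subspace (A i)" and x: "x \<in> cvs.span (\<Union>i\<in>I. A i)"
  shows "\<exists>J f. finite J \<and> J \<subseteq> I \<and> (\<forall>i\<in>J. f i \<in> A i) \<and> x = (\<Sum>i\<in>J. f i)"
  using x
proof (induction rule: cvs.span_induct_alt)
  case base
  show ?case by (rule exI[of _ "{}"], rule exI[of _ "\<lambda>_. 0"]) simp
next
  case (step c a y)
  obtain i where i: "i \<in> I" "a \<in> A i" using step(1) by blast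
  obtain J f where J: "finite J" "J \<subseteq> I" "\<forall>i\<in>J. f i \<in> A i" "y = (\<Sum>i\<in>J. f i)" using step(2) by blast
  define g where "g j = (if j = i then scaleC c a else 0) + (if j \<in> J then f j else 0)" for j
  have "finite (insert i J)" "insert i J \<subseteq> I" using J i by auto
  moreover have "\<forall>j\<in>insert i J. g j \<in> A j"
  proof
    fix j assume j: "j \<in> insert i J"
    then have sub: "cvs.subspace (A j)" using A J(2) i(1) by blast
    have 1: "(if j = i then scaleC c a else 0) \<in> A j"
      using cvs.subspace_0[OF sub] cvs.subspace_scale[OF sub, of a c] i(2) by auto
    have 2: "(if j \<in> J then f j else 0) \<in> A j" using cvs.subspace_0[OF sub] J(3) by auto
    show "g j \<in> A j" unfolding g_def by (rule cvs.subspace_add[OF sub 1 2])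
  qed
  moreover have "scaleC c a + y = (\<Sum>j\<in>insert i J. g j)"
  proof -
    have "(\<Sum>j\<in>insert i J. if j = i then scaleC c a else 0) = scaleC c a" using J(1) by simp
    moreover have "(\<Sum>j\<in>insert i J. if j \<in> J then f j else 0) = y"
      unfolding J(4) using J(1) by (intro sum.mono_neutral_cong_right) auto
    ultimately show ?thesis unfolding g_def sum.distrib by simp
  qed
  ultimately show ?case by blast
qed

lemma orthogonal_family_cinner:
  assumes "finite J" "\<And>i j. i \<in> J \<Longrightarrow> j \<in> J \<Longrightarrow> i \<noteq> j \<Longrightarrow> cinner (f i) (f j) = 0"
  shows "cinner (\<Sum>i\<in>J. f i) (\<Sum>i\<in>J. scaleC (c i) (f i)) = (\<Sum>i\<in>J. c i * of_real ((norm (f i))\<^sup>2))"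
proof -
  have "cinner (f i) (\<Sum>j\<in>J. scaleC (c j) (f j)) = c i * of_real ((norm (f i))\<^sup>2)" if i: "i \<in> J" for i
  proof -
    have "cinner (f i) (\<Sum>j\<in>J. scaleC (c j) (f j)) = (\<Sum>j\<in>J. if j = i then c i * of_real ((norm (f i))\<^sup>2) else 0)"
      unfolding cinner_sum_right using assms(2)[OF i] by (intro sum.cong) (auto simp: cinner_scaleC_right cinner_self)
    then show ?thesis using i assms(1) by simp
  qed
  then show ?thesis unfolding cinner_sum_left by simp
qed

lemma kdim_eq_card:
  assumes "finite B" "cvs.independent B" "cvs.span B = (V :: ('h::chilbert \<times> 'h) set)"
  shows "kdim V = card B"
  unfolding kdim_def
proof (rule Least_equality)
  obtain vs where vs: "set vs = B" "distinct vs" using finite_distinct_list[OF assms(1)] by blast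
  have "B \<subseteq> V" using assms(3) cvs.span_superset by blast
  then show "\<exists>vs. length vs = card B \<and> set vs \<subseteq> V \<and> V \<subseteq> kspan (set vs)"
    using vs assms(3) distinct_card[OF vs(2)] by (intro exI[of _ vs]) (auto simp: kspan_span)
next
  fix n assume "\<exists>vs. length vs = n \<and> set vs \<subseteq> V \<and> V \<subseteq> kspan (set vs)"
  then obtain vs where vs: "length vs = n" "V \<subseteq> cvs.span (set vs)" unfolding kspan_span by blast
  have "B \<subseteq> cvs.span (set vs)" using vs(2) assms(3) cvs.span_superset by blast
  then have "card B \<le> card (set vs)" using cvs.independent_span_bound[OF _ assms(2)] by blast
  then show "card B \<le> n" using card_length[of vs] vs(1) by linarith
qed

text \<open>A fixed point of x - s (A x - y) solves A x = y. The squared contraction factor is at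
  most 1 - 2 s c + s^2 K^2, which is smallest at s = c / K^2 with value 1 - c^2 / K^2; adding c to
  |C| in K keeps this value nonnegative.\<close>

lemma lax_milgram:
  fixes A :: "'a::chilbert \<Rightarrow> 'a"
  assumes A: "clin A" and bd: "\<And>x. norm (A x) \<le> C * norm x"
    and coer: "\<And>x. c * (norm x)\<^sup>2 \<le> Re (cinner (A x) x)" and c: "0 < c"
  shows "surj A"
proof (rule surjI)
  fix y
  define K where "K = \<bar>C\<bar> + c"
  have K: "0 < K" "c \<le> K" using c by (auto simp: K_def)
  have bK: "norm (A x) \<le> K * norm x" for x
  proof -
    have "C * norm x \<le> K * norm x" using c by (intro mult_right_mono) (auto simp: K_def)
    then show ?thesis using bd[of x] by linarith
  qed
  define s where "s = c / K\<^sup>2"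
  define k where "k = 1 - c\<^sup>2 / K\<^sup>2"
  define f where "f x = x - scaleC (of_real s) (A x - y)" for x
  have "c\<^sup>2 / K\<^sup>2 \<le> 1" using K c by (simp add: divide_le_eq power_mono)
  then have k: "0 \<le> k" "k < 1" using c K by (auto simp: k_def)
  have contr: "dist (f x) (f x') \<le> sqrt k * dist x x'" for x x'
  proof -
    define d where "d = x - x'"
    have fd: "f x - f x' = d - scaleC (of_real s) (A d)"
      by (simp add: f_def d_def clin_diff[OF A] cvs.scale_right_diff_distrib)
    have "(norm (d - scaleC (of_real s) (A d)))\<^sup>2 = (norm d)\<^sup>2 - 2 * s * Re (cinner (A d) d) + s\<^sup>2 * (norm (A d))\<^sup>2"
    proof -
      have "Re (cinner d (A d)) = Re (cinner (A d) d)" using cinner_commute[of "A d" d] by simp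
      then show ?thesis
        unfolding Re_cinner_self[symmetric]
        by (simp add: cinner_diff_left cinner_diff_right cinner_scaleC_left cinner_scaleC_right power2_eq_square algebra_simps)
    qed
    also have "\<dots> \<le> (norm d)\<^sup>2 - 2 * s * (c * (norm d)\<^sup>2) + s\<^sup>2 * (K * norm d)\<^sup>2"
      using coer[of d] bK[of d] c K
      by (intro add_mono diff_mono mult_left_mono power_mono order_refl) (auto simp: s_def)
    also have "\<dots> = k * (norm d)\<^sup>2"
    proof -
      have "2 * s * c = 2 * (c\<^sup>2 / K\<^sup>2)" by (simp add: s_def power2_eq_square)
      moreover have "s\<^sup>2 * K\<^sup>2 = c\<^sup>2 / K\<^sup>2" using K by (simp add: s_def power2_eq_square)
      moreover have "(norm d)\<^sup>2 - 2 * s * (c * (norm d)\<^sup>2) + s\<^sup>2 * (K * norm d)\<^sup>2 = (1 - 2 * s * c + s\<^sup>2 * K\<^sup>2) * (norm d)\<^sup>2"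
        by (simp add: power_mult_distrib algebra_simps)
      ultimately show ?thesis by (simp add: k_def)
    qed
    finally have "(norm (f x - f x'))\<^sup>2 \<le> (sqrt k * norm d)\<^sup>2" using k by (simp add: fd power_mult_distrib)
    then have "norm (f x - f x') \<le> sqrt k * norm d" by (rule power2_le_imp_le) (use k in simp)
    then show ?thesis by (simp add: dist_norm d_def)
  qed
  have "\<exists>!x. f x = x"
    by (rule banach_fix_type[of "sqrt k"]) (use k contr in auto)
  then obtain x where "f x = x" by blast
  then have "scaleC (of_real s) (A x - y) = 0" by (simp add: f_def)
  moreover have "s \<noteq> 0" using c K by (simp add: s_def)
  ultimately have "A x = y" by simp
  then show "A (SOME x. A x = y) = y" by (rule someI)
qed

section \<open>Counting eigenvalues of a unitary on an arc\<close>

locale isometry =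
  fixes V :: "'k::chilbert \<Rightarrow> 'k"
  assumes V: "clin V" and iso: "\<And>x y. cinner (V x) (V y) = cinner x y"
begin

lemma norm_V: "norm (V x) = norm x"
proof -
  have "(norm (V x))\<^sup>2 = (norm x)\<^sup>2" unfolding Re_cinner_self[symmetric] by (simp add: iso)
  then show ?thesis by (simp add: power2_eq_imp_eq)
qed

lemma eigenspace_subspace: "cvs.subspace {x. V x = scaleC z x}"
  by (rule cvs.subspaceI)
    (simp_all add: clin_zero[OF V] clin_add[OF V] clin_scale[OF V] scaleC_add_right mult.commute)

lemma eigenvectors_orthogonal:
  assumes "V x = scaleC z x" "V y = scaleC w y" "cnj z * w \<noteq> 1"
  shows "cinner x y = 0"
proof -
  have "cnj z * w * cinner x y = cinner x y" using iso[of x y] unfolding assms(1,2) cinner_scaleC_scaleC .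
  then show ?thesis using assms(3) by simp
qed

text \<open>An isometry has no Jordan blocks on the unit circle: by induction y = V x - z x is an
  eigenvector, and isometry makes it orthogonal to itself.\<close>

lemma generalized_eigenvector:
  assumes z: "cmod z = 1"
  shows "((\<lambda>v. V v - scaleC z v) ^^ n) x = 0 \<Longrightarrow> n \<noteq> 0 \<Longrightarrow> V x = scaleC z x"
proof (induction n arbitrary: x)
  case (Suc n)
  define y where "y = V x - scaleC z x"
  show ?case
  proof (cases "n = 0")
    case True
    then show ?thesis using Suc.prems by simp
  next
    case False
    have "((\<lambda>v. V v - scaleC z v) ^^ n) y = 0"
      using Suc.prems(1) unfolding funpow_Suc_right o_apply y_def .
    then have Vy: "V y = scaleC z y" using False by (rule Suc.IH)
    have "cnj z * cinner y (V x) = cinner y x" using iso[of y x] unfolding Vy by (simp add: cinner_scaleC_left)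
    then have "z * cnj z * cinner y (V x) = z * cinner y x" by (simp add: mult.assoc)
    moreover have "z * cnj z = 1" using complex_norm_square[of z] z by simp
    ultimately have "cinner y (V x) = z * cinner y x" by simp
    then have "cinner y y = 0" by (simp add: y_def cinner_diff_right[of _ "V x"] cinner_scaleC_right)
    then have "y = 0" by (rule cinner_self_zero)
    then show ?thesis by (simp add: y_def)
  qed
qed simp

text \<open>The form of cos \<eta> - Re (e^{-i \<eta>} V). On an eigenvector for e^{i \<theta>} it
  is (cos \<eta> - cos (\<theta> - \<eta>)) |v|^2; for 0 < \<theta> < 2 pi and 0 < \<eta> < pi this
  is negative exactly when \<theta> < 2 \<eta>.\<close>

definition arc_form :: "real \<Rightarrow> 'k \<Rightarrow> 'k \<Rightarrow> complex" where
  "arc_form \<eta> v w = of_real (cos \<eta>) * cinner v w - (cis (- \<eta>) * cinner v (V w) + cis \<eta> * cinner (V v) w) / 2"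

lemma herm_arc_form: "herm X (arc_form \<eta>)"
proof (rule hermI)
  fix x y
  have "cinner y x = cnj (cinner x y)" "cinner y (V x) = cnj (cinner (V x) y)" "cinner (V y) x = cnj (cinner x (V y))"
    by (rule cinner_commute)+
  then show "arc_form \<eta> y x = cnj (arc_form \<eta> x y)" by (simp add: arc_form_def cis_cnj)
qed (simp_all add: arc_form_def clin_add[OF V] clin_scale[OF V] cinner_add_right cinner_scaleC_right algebra_simps add_divide_distrib)

lemma arc_form_bounded: "herm_bounded UNIV (arc_form \<eta>) 2"
  unfolding herm_bounded_def
proof (intro ballI)
  fix x y :: 'k
  have 1: "cmod (of_real (cos \<eta>) * cinner x y) \<le> 1 * (norm x * norm y)"
    unfolding norm_mult using abs_cos_le_one cinner_cauchy_schwarz by (intro mult_mono) auto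
  have 2: "cmod (cis (- \<eta>) * cinner x (V y)) \<le> norm x * norm y"
    using cinner_cauchy_schwarz[of x "V y"] by (simp add: norm_mult norm_V)
  have 3: "cmod (cis \<eta> * cinner (V x) y) \<le> norm x * norm y"
    using cinner_cauchy_schwarz[of "V x" y] by (simp add: norm_mult norm_V)
  have 4: "cmod ((cis (- \<eta>) * cinner x (V y) + cis \<eta> * cinner (V x) y) / 2) \<le> norm x * norm y"
    using norm_triangle_ineq[of "cis (- \<eta>) * cinner x (V y)" "cis \<eta> * cinner (V x) y"] 2 3 by (simp add: norm_divide)
  have "cmod (arc_form \<eta> x y) \<le> cmod (of_real (cos \<eta>) * cinner x y)
      + cmod ((cis (- \<eta>) * cinner x (V y) + cis \<eta> * cinner (V x) y) / 2)"
    unfolding arc_form_def by (rule norm_triangle_ineq4)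
  then show "cmod (arc_form \<eta> x y) \<le> 2 * norm x * norm y" using 1 4 unfolding mult.assoc by linarith
qed

lemma arc_form_self: "Re (arc_form \<eta> v v) = cos \<eta> * (norm v)\<^sup>2 - Re (cis (- \<eta>) * cinner v (V v))"
proof -
  define p where "p = cis (- \<eta>) * cinner v (V v)"
  define p' where "p' = cis \<eta> * cinner (V v) v"
  have "p' = cnj p" using cinner_commute[of v "V v"] by (simp add: p_def p'_def cis_cnj)
  then have "Re p' = Re p" by simp
  then show ?thesis unfolding arc_form_def p_def[symmetric] p'_def[symmetric] by (simp add: cinner_self)
qed

definition arc :: "real \<Rightarrow> 'k set" where
  "arc \<eta> = cvs.span (\<Union>\<theta>\<in>{0<..<2 * \<eta>}. {x. V x = scaleC (cis \<theta>) x})"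

lemma arc_form_negative:
  assumes eta: "\<eta> \<le> pi / 2" and x: "x \<in> arc \<eta>" "x \<noteq> 0"
  shows "Re (arc_form \<eta> x x) < 0"
proof -
  obtain J f where J: "finite J" "J \<subseteq> {0<..<2 * \<eta>}" "\<forall>\<theta>\<in>J. f \<theta> \<in> {x. V x = scaleC (cis \<theta>) x}" "x = (\<Sum>\<theta>\<in>J. f \<theta>)"
    using span_Union_family[where A = "\<lambda>\<theta>. {x. V x = scaleC (cis \<theta>) x}", OF eigenspace_subspace x(1)[unfolded arc_def]]
    by blast
  have Vf: "V (f \<theta>) = scaleC (cis \<theta>) (f \<theta>)" if "\<theta> \<in> J" for \<theta> using J(3) that by blast
  have orth: "cinner (f i) (f j) = 0" if "i \<in> J" "j \<in> J" "i \<noteq> j" for i j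
  proof (rule eigenvectors_orthogonal[OF Vf[OF that(1)] Vf[OF that(2)]])
    \<comment> \<open>The bound 2 \<eta> \<le> pi keeps all angles in (0, pi), where the cosine
      alone distinguishes them.\<close>
    have b: "0 < i" "i < pi" "0 < j" "j < pi" using that J(2) eta by auto
    show "cnj (cis i) * cis j \<noteq> 1"
    proof
      assume "cnj (cis i) * cis j = 1"
      moreover have "cis j = cis i * (cnj (cis i) * cis j)" by (simp add: cis_cnj cis_mult)
      ultimately have "cis i = cis j" by simp
      then have "cos i = cos j" by (simp add: complex_eq_iff)
      then show False using cos_inj_pi[of i j] b that(3) by auto
    qed
  qed
  have n: "(norm x)\<^sup>2 = (\<Sum>\<theta>\<in>J. (norm (f \<theta>))\<^sup>2)"
  proof -
    have "cinner x x = (\<Sum>\<theta>\<in>J. of_real ((norm (f \<theta>))\<^sup>2))"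
      using orthogonal_family_cinner[where f = f and c = "\<lambda>_. 1", OF J(1) orth] by (simp add: J(4))
    then show ?thesis by (simp only: cinner_self of_real_sum[symmetric] of_real_eq_iff)
  qed
  have "cinner x (V x) = (\<Sum>\<theta>\<in>J. cis \<theta> * of_real ((norm (f \<theta>))\<^sup>2))"
    using orthogonal_family_cinner[where f = f and c = cis, OF J(1) orth] Vf by (simp add: J(4) clin_sum[OF V])
  then have "cis (- \<eta>) * cinner x (V x) = (\<Sum>\<theta>\<in>J. cis (\<theta> - \<eta>) * of_real ((norm (f \<theta>))\<^sup>2))"
    by (simp add: sum_distrib_left mult.assoc[symmetric] cis_mult)
  then have "Re (arc_form \<eta> x x) = (\<Sum>\<theta>\<in>J. (cos \<eta> - cos (\<theta> - \<eta>)) * (norm (f \<theta>))\<^sup>2)"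
    unfolding arc_form_self n by (simp add: sum_distrib_left sum_subtractf left_diff_distrib del: of_real_power)
  also have "\<dots> < (\<Sum>\<theta>\<in>J. 0)"
  proof (rule sum_strict_mono_ex1[OF J(1)])
    have lt: "cos \<eta> < cos (\<theta> - \<eta>)" if "\<theta> \<in> J" for \<theta>
    proof -
      have "0 < \<theta> \<and> \<theta> < 2 * \<eta>" using subsetD[OF J(2) that] by simp
      then have "\<bar>\<theta> - \<eta>\<bar> < \<eta>" by (simp add: abs_less_iff)
      then have "cos \<eta> < cos \<bar>\<theta> - \<eta>\<bar>" using eta pi_gt_zero by (intro cos_monotone_0_pi) auto
      then show ?thesis by simp
    qed
    show "\<forall>\<theta>\<in>J. (cos \<eta> - cos (\<theta> - \<eta>)) * (norm (f \<theta>))\<^sup>2 \<le> 0"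
    proof
      fix \<theta> assume "\<theta> \<in> J"
      then have "cos \<eta> - cos (\<theta> - \<eta>) \<le> 0" using lt[of \<theta>] by simp
      then show "(cos \<eta> - cos (\<theta> - \<eta>)) * (norm (f \<theta>))\<^sup>2 \<le> 0" by (rule mult_nonpos_nonneg) simp
    qed
    have "\<exists>\<theta>\<in>J. f \<theta> \<noteq> 0"
    proof (rule ccontr)
      assume "\<not> (\<exists>\<theta>\<in>J. f \<theta> \<noteq> 0)"
      then show False using x(2) J(4) by simp
    qed
    then obtain \<theta> where t: "\<theta> \<in> J" "f \<theta> \<noteq> 0" by blast
    then have "(cos \<eta> - cos (\<theta> - \<eta>)) * (norm (f \<theta>))\<^sup>2 < 0" using lt[OF t(1)] by (simp add: mult_neg_pos)
    then show "\<exists>\<theta>\<in>J. (cos \<eta> - cos (\<theta> - \<eta>)) * (norm (f \<theta>))\<^sup>2 < 0" using t(1) by blast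
  qed
  finally show ?thesis by simp
qed

text \<open>For W = e^{-i \<eta>} V the eigenvector equation says that the real part of W acts on b
  as k = cos \<eta> - \<mu>. So b is annihilated by (W - e^{i \<phi>}) (W - e^{-i \<phi>}) with cos
  \<phi> = k, and k > cos \<eta> means \<phi> < \<eta>. Hence b is a combination of eigenvectors of
  V on the arc.\<close>

lemma arc_eigenvector:
  assumes eta: "0 < \<eta>" "\<eta> \<le> pi / 2" and b: "norm b = 1" and mu: "\<mu> < 0"
    and eig: "\<And>v. arc_form \<eta> b v = of_real \<mu> * cinner b v"
  shows "b \<in> arc \<eta>"
proof -
  define W where "W x = scaleC (cis (- \<eta>)) (V x)" for x
  have W: "clin W" unfolding W_def by (rule clin_scaled[OF V])
  have Wiso: "cinner (W x) (W y) = cinner x y" for x y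
    by (simp add: W_def cinner_scaleC_scaleC iso cis_cnj cis_mult)
  define k where "k = cos \<eta> - \<mu>"
  have id: "cinner b (W v) + cinner (W b) v = 2 * of_real k * cinner b v" for v
  proof -
    have "cinner b (W v) + cinner (W b) v = cis (- \<eta>) * cinner b (V v) + cis \<eta> * cinner (V b) v"
      by (simp add: W_def cinner_scaleC_right cinner_scaleC_left cis_cnj)
    also have "\<dots> = 2 * (of_real (cos \<eta>) * cinner b v - arc_form \<eta> b v)" by (simp add: arc_form_def)
    also have "\<dots> = 2 * of_real k * cinner b v" unfolding eig by (simp add: k_def algebra_simps)
    finally show ?thesis .
  qed
  \<comment> \<open>z is orthogonal to the range of W and to b, and it is built from W (W b), W b
    and b; so it is orthogonal to itself. Its vanishing is the quadratic equation for W on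
    b.\<close>
  define z where "z = W (W b) - scaleC (2 * of_real k) (W b) + b"
  have zW: "cinner z (W v) = 0" for v
  proof -
    have "cinner z (W v) = cinner (W b) v - 2 * of_real k * cinner b v + cinner b (W v)"
      by (simp add: z_def cinner_add_left cinner_diff_left cinner_scaleC_left Wiso)
    then show ?thesis using id[of v] by (simp add: algebra_simps)
  qed
  have "cinner z b = 0"
  proof -
    have "cinner b (W (W b)) + cinner b b = 2 * of_real k * cinner b (W b)" using id[of "W b"] by (simp add: Wiso)
    then have "cinner b z = 0" by (simp add: z_def cinner_add_right cinner_diff_right cinner_scaleC_right algebra_simps)
    then show ?thesis using cinner_commute[of b z] by simp
  qed
  then have "cinner z z = 0"
    using zW[of "W b"] zW[of b] by (simp add: z_def cinner_add_right cinner_diff_right cinner_scaleC_right)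
  then have z0: "z = 0" by (rule cinner_self_zero)
  have "\<bar>2 * k\<bar> \<le> 2"
  proof -
    have "cinner b b = 1" using b by (simp add: cinner_self)
    then have "2 * of_real k = cinner b (W b) + cinner (W b) b" using id[of b] by simp
    moreover have "cmod (cinner b (W b)) \<le> 1" "cmod (cinner (W b) b) \<le> 1"
      using cinner_cauchy_schwarz[of b "W b"] cinner_cauchy_schwarz[of "W b" b] b by (simp_all add: W_def norm_scaleC norm_V)
    ultimately have "cmod (2 * of_real k) \<le> 2" using norm_triangle_ineq[of "cinner b (W b)" "cinner (W b) b"] by simp
    then show ?thesis by (simp add: norm_mult)
  qed
  then have k1: "- 1 \<le> k" "k \<le> 1" by auto
  define \<phi> where "\<phi> = arccos k"
  have cphi: "cos \<phi> = k" using k1 by (simp add: \<phi>_def)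
  have phi0: "0 \<le> \<phi>" "\<phi> \<le> pi" using k1 by (auto simp: \<phi>_def arccos_lbound arccos_ubound)
  have "cos \<eta> < cos \<phi>" using mu by (simp add: cphi k_def)
  then have phi: "\<phi> < \<eta>"
    using cos_monotone_0_pi_le[of \<eta> \<phi>] phi0 eta by (cases "\<phi> < \<eta>") auto
  have arcI: "x \<in> arc \<eta>" if "W x = scaleC (cis a) x" "\<bar>a\<bar> < \<eta>" for x a
  proof -
    have "scaleC (cis \<eta>) (W x) = V x" by (simp add: W_def cis_mult)
    then have "V x = scaleC (cis (\<eta> + a)) x" unfolding that(1) by (simp add: cis_mult)
    moreover have "\<eta> + a \<in> {0<..<2 * \<eta>}" using that(2) by auto
    ultimately show ?thesis unfolding arc_def by (intro cvs.span_base) blast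
  qed
  have sum2: "cis \<phi> + cis (- \<phi>) = 2 * of_real k" by (simp add: complex_eq_iff cphi)
  have fac: "W (W b) = scaleC (2 * of_real k) (W b) - b" using z0 unfolding z_def by (simp add: algebra_simps)
  have eigW: "W (W b - scaleC (cis (- a)) b) = scaleC (cis a) (W b - scaleC (cis (- a)) b)"
    if a: "cis a + cis (- a) = 2 * of_real k" for a
  proof -
    have "W (W b - scaleC (cis (- a)) b) = scaleC (2 * of_real k - cis (- a)) (W b) - b"
      by (simp add: clin_diff[OF W] clin_scale[OF W] fac cvs.scale_left_diff_distrib)
    also have "2 * of_real k - cis (- a) = cis a" using a by (simp add: algebra_simps)
    finally show ?thesis by (simp add: cvs.scale_right_diff_distrib cis_mult)
  qed
  define v1 where "v1 = W b - scaleC (cis (- \<phi>)) b"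
  define v2 where "v2 = W b - scaleC (cis \<phi>) b"
  have v1: "v1 \<in> arc \<eta>" unfolding v1_def by (rule arcI[OF eigW[OF sum2]]) (use phi phi0 in auto)
  have v2: "v2 \<in> arc \<eta>" unfolding v2_def using arcI[OF eigW[of "- \<phi>"]] sum2 phi phi0 by (simp add: add.commute)
  have "v1 - v2 = scaleC (cis \<phi> - cis (- \<phi>)) b" by (simp add: v1_def v2_def cvs.scale_left_diff_distrib)
  moreover have "v1 - v2 \<in> arc \<eta>" using v1 v2 unfolding arc_def by (rule cvs.span_diff)
  ultimately have s: "scaleC (cis \<phi> - cis (- \<phi>)) b \<in> arc \<eta>" by simp
  \<comment> \<open>The two eigenvectors differ by a multiple of b that is zero only for \<phi> = 0.
    Then k = 1 and |W b - b|^2 = 2 - 2 k = 0, so b itself is an eigenvector for the midpoint of the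
    arc.\<close>
  show ?thesis
  proof (cases "cis \<phi> - cis (- \<phi>) = 0")
    case False
    have "scaleC (1 / (cis \<phi> - cis (- \<phi>))) (scaleC (cis \<phi> - cis (- \<phi>)) b) \<in> arc \<eta>"
      using s unfolding arc_def by (rule cvs.span_scale)
    then show ?thesis using False by simp
  next
    case True
    then have "sin \<phi> = 0" by (simp add: complex_eq_iff)
    then have "\<phi> = 0" using sin_gt_zero[of \<phi>] phi phi0 eta pi_gt_zero by (cases "\<phi> = 0") auto
    then have "k = 1" using cphi by simp
    have "cinner b b = 1" using b by (simp add: cinner_self)
    then have "cinner (W b - b) (W b - b) = 2 - (cinner b (W b) + cinner (W b) b)"
      by (simp add: cinner_diff_left cinner_diff_right Wiso)
    then have "cinner (W b - b) (W b - b) = 0"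
      using id[of b] \<open>k = 1\<close> \<open>cinner b b = 1\<close> by simp
    then have "W b - b = 0" by (rule cinner_self_zero)
    then show ?thesis using arcI[of b 0] eta by simp
  qed
qed

text \<open>The splitting into E and F certifies that the negative part of the arc form is
  finite-dimensional. Its negative eigenvectors lie in the arc, and they span it because the form is
  negative on the arc but nonnegative orthogonally to them.\<close>

lemma arc_index:
  assumes eta: "0 < \<eta>" "\<eta> \<le> pi / 2"
    and E: "cvs.subspace E" "fin_dim E" and F: "cvs.subspace F"
    and dec: "\<And>x. \<exists>e\<in>E. \<exists>f\<in>F. x = e + f \<and> norm e \<le> C * norm x"
    and pos: "\<And>f. f \<in> F \<Longrightarrow> 0 \<le> Re (arc_form \<eta> f f)"
  shows "\<exists>B. finite B \<and> cvs.independent B \<and> cvs.span B = arc \<eta> \<and> has_index UNIV (\<lambda>x. Re (arc_form \<eta> x x)) (card B)"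
proof -
  have "\<exists>B. finite B \<and> orthonormal B \<and> B \<subseteq> UNIV \<and> (\<forall>b\<in>B. Re (arc_form \<eta> b b) < 0)
     \<and> (\<forall>b\<in>B. \<forall>v\<in>UNIV. arc_form \<eta> b v = of_real (Re (arc_form \<eta> b b)) * cinner b v)
     \<and> (\<forall>x\<in>UNIV. (\<forall>b\<in>B. cinner b x = 0) \<longrightarrow> 0 \<le> Re (arc_form \<eta> x x))"
    by (rule negative_spectral_basis[OF herm_arc_form cvs.subspace_UNIV arc_form_bounded closed_UNIV E(1) subset_UNIV
        E(2) F subset_UNIV dec pos])
  then obtain B where "finite B" "orthonormal B" "\<forall>b\<in>B. Re (arc_form \<eta> b b) < 0"
     "\<forall>b\<in>B. \<forall>v\<in>UNIV. arc_form \<eta> b v = of_real (Re (arc_form \<eta> b b)) * cinner b v"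
     "\<forall>x\<in>UNIV. (\<forall>b\<in>B. cinner b x = 0) \<longrightarrow> 0 \<le> Re (arc_form \<eta> x x)"
    by (elim exE conjE) (rule that)
  note B = this(1,2) this(3)[THEN bspec] this(4)[THEN bspec, THEN bspec, OF _ UNIV_I]
    this(5)[THEN bspec, OF UNIV_I, THEN mp]
  have ind: "cvs.independent B" by (rule orthonormal_independent[OF B(2,1)])
  have "b \<in> arc \<eta>" if b: "b \<in> B" for b
  proof (rule arc_eigenvector[OF eta _ B(3)[OF b] B(4)[OF b]])
    have "cinner b b = 1" using B(2) b by (simp add: orthonormal_def)
    then show "norm b = 1" by (simp add: norm_cinner)
  qed
  then have sub: "cvs.span B \<subseteq> arc \<eta>" unfolding arc_def by (intro cvs.span_minimal) auto
  define p where "p x = (\<Sum>b\<in>B. scaleC (cinner b x) b)" for x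
  have pB: "p x \<in> cvs.span B" for x unfolding p_def by (auto intro: cvs.span_sum cvs.span_scale cvs.span_base)
  have po: "\<forall>b\<in>B. cinner b (x - p x) = 0" for x
    using orthonormal_coeff[OF B(2,1)] by (simp add: cinner_diff_right p_def)
  have "arc \<eta> \<subseteq> cvs.span B"
  proof
    fix x assume x: "x \<in> arc \<eta>"
    have "x - p x \<in> arc \<eta>" using x subsetD[OF sub pB] unfolding arc_def by (rule cvs.span_diff)
    then have "x - p x = 0" using arc_form_negative[OF eta(2)] B(5)[OF po[of x]] by force
    then show "x \<in> cvs.span B" using pB[of x] by simp
  qed
  then have sp: "cvs.span B = arc \<eta>" using sub by blast
  have "has_index UNIV (\<lambda>x. Re (arc_form \<eta> x x)) (card B)"
    unfolding has_index_def
  proof (rule exI[of _ B], rule exI[of _ "{x. \<forall>b\<in>B. cinner b x = 0}"], intro conjI ballI impI)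
    show "cvs.subspace {x. \<forall>b\<in>B. cinner b x = 0}"
      by (rule cvs.subspaceI) (auto simp: cinner_add_right cinner_scaleC_right)
    show "\<exists>a\<in>cvs.span B. x - a \<in> {x. \<forall>b\<in>B. cinner b x = 0}" for x
      using po[of x] by (intro bexI[OF _ pB]) simp
    show "Re (arc_form \<eta> x x) < 0" if "x \<in> cvs.span B" "x \<noteq> 0" for x
      using arc_form_negative[OF eta(2)] that sp by simp
    show "0 \<le> Re (arc_form \<eta> x x)" if "x \<in> {x. \<forall>b\<in>B. cinner b x = 0}" for x using that B(5) by simp
  qed (simp_all add: B(1) ind)
  then show ?thesis by (intro exI[of _ B] conjI B(1) ind sp)
qed

end

section \<open>The unitary associated with a J-unitary\<close>

locale krein_blocks = krein_unitary Jop T S M for T S :: "'h::chilbert \<times> 'h \<Rightarrow> 'h \<times> 'h" and M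
begin

abbreviation a where "a \<equiv> blk_a T"
abbreviation b where "b \<equiv> blk_b T"
abbreviation c where "c \<equiv> blk_c T"
abbreviation d where "d \<equiv> blk_d T"

lemma T_blocks: "T (x, y) = (a x + b y, c x + d y)"
  using clin_add[OF U, of "(x, 0)" "(0, y)"]
  by (simp add: blk_a_def blk_b_def blk_c_def blk_d_def prod_eq_iff)

lemma cinner_Jop: "cinner p (Jop p') = cinner (fst p) (fst p') - cinner (snd p) (snd p')"
  by (simp add: cinner_prod_def Jop_def cinner_minus_right)

lemma norm_prod_sq: "(norm (p :: 'h \<times> 'h))\<^sup>2 = (norm (fst p))\<^sup>2 + (norm (snd p))\<^sup>2"
  by (simp add: norm_prod_def)

lemma blocks_clin: "clin a" "clin b" "clin c" "clin d"
  using clin_add[OF U] clin_scale[OF U]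
  by (auto simp: clin_def blk_a_def blk_b_def blk_c_def blk_d_def scaleC_prod_def
      simp flip: fst_add snd_add) (metis (no_types, lifting) add_Pair add.right_neutral fst_add snd_add
        scaleC_prod_def fst_conv snd_conv cvs.scale_zero_right)+

lemma norm_fst_le_norm: "norm (fst p) \<le> norm (p :: 'h \<times> 'h)" and norm_snd_le_norm: "norm (snd p) \<le> norm p"
  by (metis norm_fst_le prod.collapse, metis norm_snd_le prod.collapse)

lemma norm_c: "norm (c x) \<le> M * norm x"
  using order_trans[OF norm_snd_le_norm U_bound[of "(x, 0)"]] by (simp add: blk_c_def norm_Pair)

text \<open>J-unitarity on (0, y) reads |d y|^2 = |y|^2 + |b y|^2.\<close>

lemma d_lower: "norm y \<le> norm (d y)"
proof -
  have "Re (cinner (T (0, y)) (Jop (T (0, y)))) = Re (cinner (0, y) (Jop (0, y)))" by (simp only: JU)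
  then have "(norm (b y))\<^sup>2 - (norm (d y))\<^sup>2 = - (norm y)\<^sup>2"
    by (simp add: cinner_Jop Re_cinner_self blk_b_def blk_d_def)
  then have "(norm y)\<^sup>2 \<le> (norm (d y))\<^sup>2" using zero_le_power2[of "norm (b y)"] by linarith
  then show ?thesis by (rule power2_le_imp_le) simp
qed

lemma SJ: "cinner (S x) (Jop (S y)) = cinner x (Jop y)"
  using JU[of "S x" "S y"] by (simp add: US)

lemma d_adjoint: "cinner (blk_d S x) y = cinner x (d y)"
  using J_adjoint[of "(0, x)" "(0, y)"] by (simp add: cinner_Jop blk_d_def)

lemma a_adjoint: "cinner (blk_a S x) y = cinner x (a y)"
  using J_adjoint[of "(x, 0)" "(y, 0)"] by (simp add: cinner_Jop blk_a_def)

lemma dS_lower: "norm y \<le> norm (blk_d S y)"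
proof -
  have "Re (cinner (S (0, y)) (Jop (S (0, y)))) = Re (cinner (0, y) (Jop (0, y)))" by (simp only: SJ)
  then have "(norm (blk_b S y))\<^sup>2 - (norm (blk_d S y))\<^sup>2 = - (norm y)\<^sup>2"
    by (simp add: cinner_Jop Re_cinner_self blk_b_def blk_d_def)
  then have "(norm y)\<^sup>2 \<le> (norm (blk_d S y))\<^sup>2" using zero_le_power2[of "norm (blk_b S y)"] by linarith
  then show ?thesis by (rule power2_le_imp_le) simp
qed

lemma aS_lower: "norm x \<le> norm (blk_a S x)"
proof -
  have "Re (cinner (S (x, 0)) (Jop (S (x, 0)))) = Re (cinner (x, 0) (Jop (x, 0)))" by (simp only: SJ)
  then have "(norm (blk_a S x))\<^sup>2 - (norm (blk_c S x))\<^sup>2 = (norm x)\<^sup>2"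
    by (simp add: cinner_Jop Re_cinner_self blk_a_def blk_c_def)
  then have "(norm x)\<^sup>2 \<le> (norm (blk_a S x))\<^sup>2" using zero_le_power2[of "norm (blk_c S x)"] by linarith
  then show ?thesis by (rule power2_le_imp_le) simp
qed

text \<open>As $T^{-1} = J T^* J$, the adjoint of the corner $a$ is the corner of $T^{-1}$.\<close>
lemma hadj_a: "hadj a = blk_a S"
  unfolding hadj_def
proof (rule the_equality)
  show "\<forall>x y. cinner (blk_a S x) y = cinner x (a y)" using a_adjoint by blast
  fix s assume s: "\<forall>x y. cinner (s x) y = cinner x (a y)"
  show "s = blk_a S"
  proof
    fix x
    have "cinner (s x - blk_a S x) (s x - blk_a S x) = 0"
      by (simp add: cinner_diff_left[of "s x"] s a_adjoint)
    then have "s x - blk_a S x = 0" by (rule cinner_self_zero)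
    then show "s x = blk_a S x" by simp
  qed
qed

lemma clin_fst_snd: "clin f \<Longrightarrow> clin (\<lambda>x. fst (f x))" "clin f \<Longrightarrow> clin (\<lambda>x. snd (f x))"
  for f :: "'k::chilbert \<Rightarrow> 'h \<times> 'h"
  by (simp_all add: clin_def scaleC_prod_def)

lemma dS_clin: "clin (blk_d S)"
proof -
  have "clin (\<lambda>y. (0, y) :: 'h \<times> 'h)" by (simp add: clin_def scaleC_prod_def)
  then have "clin (\<lambda>y. S (0, y))" using S unfolding clin_def by metis
  then have "clin (\<lambda>y. snd (S (0, y)))" by (rule clin_fst_snd)
  then show ?thesis unfolding blk_d_def[abs_def] .
qed

text \<open>The corner of S is the adjoint of d, and it is bounded below by 1 as well. So d composed
  with its adjoint is coercive, hence onto by \<open>lax_milgram\<close>.\<close>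

lemma d_bij: "inj d" "surj d"
proof -
  show "inj d"
  proof (rule injI)
    fix x y assume "d x = d y"
    then have "d (x - y) = 0" by (simp add: clin_diff[OF blocks_clin(4)])
    then have "norm (x - y) = 0" using d_lower[of "x - y"] by simp
    then show "x = y" by simp
  qed
  have nd: "norm (d y) \<le> M * norm y" for y
    using order_trans[OF norm_snd_le_norm U_bound[of "(0, y)"]] by (simp add: blk_d_def norm_Pair)
  have ndS: "norm (blk_d S x) \<le> M * norm x" for x
  proof -
    have e: "cinner x (d (blk_d S x)) = of_real ((norm (blk_d S x))\<^sup>2)"
      using d_adjoint[of x "blk_d S x"] unfolding cinner_self by (rule sym)
    have "(norm (blk_d S x))\<^sup>2 = cmod (cinner x (d (blk_d S x)))"
      unfolding e norm_of_real by simp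
    also have "\<dots> \<le> norm x * (M * norm (blk_d S x))"
      using order_trans[OF cinner_cauchy_schwarz mult_left_mono[OF nd]] by simp
    finally have "norm (blk_d S x) * norm (blk_d S x) \<le> (M * norm x) * norm (blk_d S x)"
      by (simp add: power2_eq_square mult_ac)
    then show ?thesis using M_pos by (cases "norm (blk_d S x) = 0") (auto simp: mult_le_cancel_right)
  qed
  have "surj (\<lambda>x. d (blk_d S x))"
  proof (rule lax_milgram[where c = 1])
    show "clin (\<lambda>x. d (blk_d S x))"
      by (simp add: clin_def clin_add[OF dS_clin] clin_scale[OF dS_clin] clin_add[OF blocks_clin(4)] clin_scale[OF blocks_clin(4)])
    show "norm (d (blk_d S x)) \<le> M * M * norm x" for x
    proof -
      have "norm (d (blk_d S x)) \<le> M * norm (blk_d S x)" by (rule nd)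
      also have "\<dots> \<le> M * (M * norm x)" using ndS M_pos by (intro mult_left_mono) auto
      finally show ?thesis by (simp add: mult.assoc)
    qed
    show "1 * (norm x)\<^sup>2 \<le> Re (cinner (d (blk_d S x)) x)" for x
    proof -
      have "cinner (d (blk_d S x)) x = cnj (cinner (blk_d S x) (blk_d S x))"
        using d_adjoint[of x "blk_d S x"] cinner_commute[of x "d (blk_d S x)"] by simp
      then have "Re (cinner (d (blk_d S x)) x) = (norm (blk_d S x))\<^sup>2" by (simp add: Re_cinner_self)
      then show ?thesis using power_mono[OF dS_lower norm_ge_zero, of x 2] by simp
    qed
  qed simp
  note sj = this
  show "surj d"
  proof (rule UNIV_eq_I[symmetric])
    fix y
    have "y \<in> range (\<lambda>x. d (blk_d S x))" unfolding sj by (rule UNIV_I)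
    then show "y \<in> range d" by (elim imageE) (simp only: rangeI)
  qed
qed

definition D where "D = inv_into UNIV d"

lemma D: "d (D x) = x" "D (d x) = x"
  unfolding D_def using d_bij by (simp_all add: surj_f_inv_f)

lemma D_clin: "clin D"
proof -
  have "D (x + y) = D x + D y" for x y
    using D(2)[of "D x + D y"] by (simp add: clin_add[OF blocks_clin(4)] D(1))
  moreover have "D (scaleC z x) = scaleC z (D x)" for z x
    using D(2)[of "scaleC z (D x)"] by (simp add: clin_scale[OF blocks_clin(4)] D(1))
  ultimately show ?thesis by (simp add: clin_def)
qed

section \<open>The change of variables between T_t and V_t\<close>

definition Tt where "Tt t u = scaleC (cis (- t)) (T u)"
text \<open>\<open>inp\<close> and \<open>out\<close> exchange the second components of u and T_t u,
  as in the Potapov-Ginzburg transform; this turns the indefinite J-isometry into a Hilbert space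
  isometry.\<close>

definition inp where "inp t u = (fst u, snd (Tt t u))"
definition out where "out t u = (fst (Tt t u), snd u)"

lemma Tt_clin: "clin (Tt t)"
  unfolding Tt_def by (rule clin_scaled[OF U])

lemma inp_clin: "clin (inp t)" and out_clin: "clin (out t)"
proof -
  have s: "fst (scaleC z p) = scaleC z (fst p)" "snd (scaleC z p) = scaleC z (snd p)"
    "(scaleC z x, scaleC z y) = scaleC z (x, y)" for z and p :: "'h \<times> 'h" and x y :: 'h
    by (simp_all add: scaleC_prod_def)
  show "clin (inp t)" unfolding clin_def inp_def
    by (simp only: clin_add[OF Tt_clin] clin_scale[OF Tt_clin] s fst_add snd_add add_Pair) simp
  show "clin (out t)" unfolding clin_def out_def
    by (simp only: clin_add[OF Tt_clin] clin_scale[OF Tt_clin] s fst_add snd_add add_Pair) simp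
qed

lemma norm_Tt: "norm (Tt t u) \<le> M * norm u"
  using U_bound by (simp add: Tt_def norm_scaleC)

lemma Tt_J: "cinner (Tt t x) (Jop (Tt t y)) = cinner x (Jop y)"
proof -
  have "cnj (cis (- t)) * cis (- t) = 1" by (simp add: cis_cnj cis_mult)
  then show ?thesis by (simp add: Tt_def clin_scale[OF J] cinner_scaleC_scaleC JU)
qed

text \<open>Solving y' = e^{-i t} (c x + d y) for y gives the second row of V. The first row needs
  that the inverse adjoint of a is the Schur complement a - b d^{-1} c, which is read off from T (x,
  - d^{-1} c x) = (a x - b d^{-1} c x, 0).\<close>

lemma Vpath_inp: "Vpath T t (inp t u) = out t u"
proof -
  obtain x y where u: "u = (x, y)" by (cases u)
  define y' where "y' = snd (Tt t u)"
  have y': "scaleC (cis t) y' = c x + d y" by (simp add: y'_def Tt_def u T_blocks scaleC_prod_def cis_mult)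
  have Dy': "scaleC (cis t) (D y') = D (c x) + y"
    using arg_cong[OF y', of D] by (simp add: clin_scale[OF D_clin] clin_add[OF D_clin] D(2))
  have Dy'': "D y' = scaleC (cis (- t)) (D (c x) + y)"
    using arg_cong[OF Dy', of "scaleC (cis (- t))"] by (simp add: cis_mult)
  have ainv: "inv_into UNIV (blk_a S) x = a x - b (D (c x))"
  proof -
    have "inj (blk_a S)"
    proof (rule injI)
      fix p q assume "blk_a S p = blk_a S q"
      moreover have "blk_a S (p - q) = blk_a S p - blk_a S q"
        using clin_diff[OF S, of "(p, 0)" "(q, 0)"] by (simp add: blk_a_def)
      ultimately have "norm (p - q) = 0" using aS_lower[of "p - q"] by simp
      then show "p = q" by simp
    qed
    moreover have "blk_a S (a x - b (D (c x))) = x"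
    proof -
      have "T (x, - D (c x)) = (a x - b (D (c x)), 0)"
        by (simp add: T_blocks clin_neg[OF blocks_clin(2)] clin_neg[OF blocks_clin(4)] D(1))
      then have "S (a x - b (D (c x)), 0) = (x, - D (c x))" by (metis SU)
      then show ?thesis by (simp add: blk_a_def)
    qed
    ultimately show ?thesis using inv_f_f by metis
  qed
  have e: "exp (- \<i> * of_real t) = cis (- t)" "exp (\<i> * of_real t) = cis t" by (simp_all add: cis_conv_exp)
  have 1: "scaleC (cis (- t)) (a x - b (D (c x))) + b (D y') = fst (Tt t u)"
    unfolding Dy'' clin_scale[OF blocks_clin(2)] clin_add[OF blocks_clin(2)]
    by (simp add: Tt_def u T_blocks scaleC_prod_def cvs.scale_right_diff_distrib scaleC_add_right)
  have 2: "- D (c x) + scaleC (cis t) (D y') = y" unfolding Dy' by simp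
  show ?thesis
    unfolding Vpath_def e hadj_a D_def[symmetric] inp_def y'_def[symmetric] out_def
    using 1 2 ainv by (simp add: u)
qed

definition inp_inv where "inp_inv t v = (fst v, D (scaleC (cis t) (snd v) - c (fst v)))"

lemma inp_inv: "inp t (inp_inv t v) = v" "inp_inv t (inp t u) = u"
  by (simp_all add: inp_def inp_inv_def Tt_def T_blocks[of "fst _"] T_blocks D scaleC_prod_def cis_mult
      cvs.scale_right_diff_distrib prod_eq_iff) (metis D(2) T_blocks add_diff_cancel_left' prod.collapse snd_conv)

lemma inp_inv_clin: "clin (inp_inv t)"
proof -
  have "inp_inv t (x + y) = inp_inv t x + inp_inv t y" for x y
    using inp_inv(2)[of t "inp_inv t x + inp_inv t y"] by (simp add: clin_add[OF inp_clin] inp_inv(1))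
  moreover have "inp_inv t (scaleC z x) = scaleC z (inp_inv t x)" for z x
    using inp_inv(2)[of t "scaleC z (inp_inv t x)"] by (simp add: clin_scale[OF inp_clin] inp_inv(1))
  ultimately show ?thesis by (simp add: clin_def)
qed

lemma norm_inp_inv: "norm (inp_inv t v) \<le> (2 + M) * norm v"
proof -
  have nD: "norm (D x) \<le> norm x" for x using d_lower[of "D x"] by (simp add: D(1))
  have "norm (inp_inv t v) \<le> norm (fst v) + norm (D (scaleC (cis t) (snd v) - c (fst v)))"
    unfolding inp_inv_def by (rule norm_Pair_le)
  also have "\<dots> \<le> norm (fst v) + (norm (snd v) + M * norm (fst v))"
    using order_trans[OF nD norm_triangle_ineq4[of "scaleC (cis t) (snd v)" "c (fst v)"]] norm_c[of "fst v"]
    by (simp add: norm_scaleC)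
  also have "\<dots> \<le> norm v + (norm v + M * norm v)"
    using norm_fst_le_norm norm_snd_le_norm M_pos by (intro add_mono mult_left_mono) auto
  finally show ?thesis by (simp add: algebra_simps)
qed

lemma norm_inp: "norm (inp t u) \<le> (1 + M) * norm u"
proof -
  have "norm (inp t u) \<le> norm (fst u) + norm (snd (Tt t u))" unfolding inp_def by (rule norm_Pair_le)
  also have "\<dots> \<le> norm u + M * norm u"
    using norm_fst_le_norm[of u] order_trans[OF norm_snd_le_norm norm_Tt] by (intro add_mono) auto
  finally show ?thesis by (simp add: algebra_simps)
qed

text \<open>J-unitarity of T_t, with the two second-component products moved to the opposite sides
  of the equation.\<close>

lemma Vpath_isometry: "isometry (Vpath T t)"
proof
  have V: "Vpath T t v = out t (inp_inv t v)" for v using Vpath_inp[of t "inp_inv t v"] by (simp add: inp_inv(1))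
  show "clin (Vpath T t)"
    by (simp add: clin_def V clin_add[OF inp_inv_clin] clin_scale[OF inp_inv_clin] clin_add[OF out_clin] clin_scale[OF out_clin])
  fix v w
  define u where "u = inp_inv t v"
  define u' where "u' = inp_inv t w"
  have vw: "v = inp t u" "w = inp t u'" by (simp_all add: u_def u'_def inp_inv(1))
  show "cinner (Vpath T t v) (Vpath T t w) = cinner v w"
    using Tt_J[of t u u'] unfolding vw Vpath_inp
    by (simp add: inp_def out_def cinner_prod_def Jop_def cinner_minus_right algebra_simps)
qed

text \<open>\<open>inp\<close> and \<open>out\<close> agree at u exactly when both components of T_t
  u and u agree, and \<open>inp\<close> is bijective.\<close>

lemma fixed_point_iff: "(\<exists>v. v \<noteq> 0 \<and> Vpath T t v = v) \<longleftrightarrow> (\<exists>u. u \<noteq> 0 \<and> T u = scaleC (cis t) u)"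
proof -
  have eq: "Vpath T t (inp t u) = inp t u \<longleftrightarrow> Tt t u = u" for u
    unfolding Vpath_inp by (auto simp: inp_def out_def prod_eq_iff)
  have Tt: "Tt t u = u \<longleftrightarrow> T u = scaleC (cis t) u" for u
  proof
    assume "Tt t u = u"
    then have "scaleC (cis t) (Tt t u) = scaleC (cis t) u" by simp
    then show "T u = scaleC (cis t) u" by (simp add: Tt_def cis_mult)
  qed (simp add: Tt_def cis_mult)
  have nz: "inp t u = 0 \<longleftrightarrow> u = 0" for u
    using inp_inv(2)[of t u] clin_zero[OF inp_clin, of t] clin_zero[OF inp_inv_clin, of t] by metis
  show ?thesis
  proof
    assume "\<exists>v. v \<noteq> 0 \<and> Vpath T t v = v"
    then obtain v where v: "v \<noteq> 0" "Vpath T t v = v" by blast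
    then have "inp t (inp_inv t v) \<noteq> 0" "Vpath T t (inp t (inp_inv t v)) = inp t (inp_inv t v)" by (simp_all add: inp_inv(1))
    then show "\<exists>u. u \<noteq> 0 \<and> T u = scaleC (cis t) u" using eq Tt nz by blast
  next
    assume "\<exists>u. u \<noteq> 0 \<and> T u = scaleC (cis t) u"
    then show "\<exists>v. v \<noteq> 0 \<and> Vpath T t v = v" using eq Tt nz by blast
  qed
qed

lemma arc_form_inp:
  "2 * Re (isometry.arc_form (Vpath T t) \<eta> (inp t u) (inp t u))
    = cos \<eta> * (norm (Tt t u - u))\<^sup>2 + 2 * sin \<eta> * Im (cinner (Tt t u) (Jop u))"
proof -
  define x y x' y' where "x = fst u" and "y = snd u" and "x' = fst (Tt t u)" and "y' = snd (Tt t u)"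
  \<comment> \<open>This balance turns 2 |\<open>inp\<close>|^2 into the sum of all four squared
    norms, which together with the cross terms forms |T_t u - u|^2.\<close>
  have J0: "(norm x')\<^sup>2 - (norm y')\<^sup>2 = (norm x)\<^sup>2 - (norm y)\<^sup>2"
  proof -
    have "Re (cinner (Tt t u) (Jop (Tt t u))) = Re (cinner u (Jop u))" by (simp only: Tt_J)
    then show ?thesis by (simp add: cinner_Jop Re_cinner_self x_def y_def x'_def y'_def)
  qed
  have n1: "(norm (inp t u))\<^sup>2 = (norm x)\<^sup>2 + (norm y')\<^sup>2"
    unfolding norm_prod_sq by (simp add: inp_def x_def y'_def)
  have dsq: "(norm (p - r))\<^sup>2 = (norm p)\<^sup>2 + (norm r)\<^sup>2 - 2 * Re (cinner r p)" for p r :: 'h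
  proof -
    have "Re (cinner p r) = Re (cinner r p)" using cinner_commute[of p r] by simp
    then show ?thesis unfolding Re_cinner_self[symmetric] by (simp add: cinner_diff_left cinner_diff_right)
  qed
  have n2: "(norm (Tt t u - u))\<^sup>2 = (norm x')\<^sup>2 + (norm x)\<^sup>2 - 2 * Re (cinner x x') + ((norm y')\<^sup>2 + (norm y)\<^sup>2 - 2 * Re (cinner y y'))"
    unfolding norm_prod_sq by (simp add: dsq x_def y_def x'_def y'_def)
  define z where "z = cinner x x' + cinner y' y"
  have c1: "cinner (inp t u) (out t u) = z"
    by (simp add: z_def cinner_prod_def inp_def out_def x_def y_def x'_def y'_def)
  have c2: "Re z = Re (cinner x x') + Re (cinner y y')"
    using cinner_commute[of y y'] by (simp add: z_def)
  have c3: "Im (cinner (Tt t u) (Jop u)) = - Im z"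
    using cinner_commute[of x x'] by (simp add: z_def cinner_Jop x_def y_def x'_def y'_def)
  have "Re (cis (- \<eta>) * z) = cos \<eta> * Re z + sin \<eta> * Im z" by simp
  then have "2 * Re (isometry.arc_form (Vpath T t) \<eta> (inp t u) (inp t u))
      = cos \<eta> * (2 * ((norm x)\<^sup>2 + (norm y')\<^sup>2)) - 2 * (cos \<eta> * Re z + sin \<eta> * Im z)"
    unfolding isometry.arc_form_self[OF Vpath_isometry] Vpath_inp c1 n1 by (simp add: algebra_simps)
  also have "2 * ((norm x)\<^sup>2 + (norm y')\<^sup>2) = (norm x')\<^sup>2 + (norm x)\<^sup>2 + ((norm y')\<^sup>2 + (norm y)\<^sup>2)"
    using J0 by simp
  finally show ?thesis unfolding n2 c3 c2 by (simp add: algebra_simps)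
qed

lemma arc_count_eq:
  assumes "finite B" "cvs.independent B" "cvs.span B = isometry.arc (Vpath T t) \<eta>"
  shows "arc_count T t (2 * \<eta>) = card B"
proof -
  interpret V: isometry "Vpath T t" by (rule Vpath_isometry)
  have "gen_eigenspace (Vpath T t) (exp (\<i> * of_real \<theta>)) = {x. Vpath T t x = scaleC (cis \<theta>) x}" for \<theta>
  proof -
    have e: "exp (\<i> * of_real \<theta>) = cis \<theta>" by (simp add: cis_conv_exp)
    show ?thesis unfolding gen_eigenspace_def e kscale_scaleC
    proof (intro Set.set_eqI iffI)
      fix x assume "x \<in> {x. \<exists>n. ((\<lambda>v. Vpath T t v - scaleC (cis \<theta>) v) ^^ n) x = 0}"
      then obtain n where n: "((\<lambda>v. Vpath T t v - scaleC (cis \<theta>) v) ^^ n) x = 0" by blast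
      show "x \<in> {x. Vpath T t x = scaleC (cis \<theta>) x}"
      proof (cases "n = 0")
        case True
        then show ?thesis using n clin_zero[OF V.V] by simp
      next
        case False
        then show ?thesis using V.generalized_eigenvector[of "cis \<theta>", OF _ n] by simp
      qed
    next
      fix x assume "x \<in> {x. Vpath T t x = scaleC (cis \<theta>) x}"
      then have "((\<lambda>v. Vpath T t v - scaleC (cis \<theta>) v) ^^ 1) x = 0" by simp
      then show "x \<in> {x. \<exists>n. ((\<lambda>v. Vpath T t v - scaleC (cis \<theta>) v) ^^ n) x = 0}" by blast
    qed
  qed
  then have "kspan (\<Union>\<theta>\<in>{0<..<2 * \<eta>}. gen_eigenspace (Vpath T t) (exp (\<i> * of_real \<theta>))) = cvs.span B"
    unfolding assms(3) V.arc_def kspan_span by simp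
  then show ?thesis unfolding arc_count_def using kdim_eq_card[OF assms(1,2) refl] by simp
qed

text \<open>Everything is carried through the bounded isomorphism \<open>inp\<close>: the form in u
  is twice the arc form at \<open>inp t u\<close>, and the splitting E, F is mapped along with its
  norm bound.\<close>

lemma arc_count_index:
  assumes eta: "0 < \<eta>" "\<eta> \<le> pi / 2"
    and E: "cvs.subspace E" "fin_dim E" and F: "cvs.subspace F"
    and dec: "\<And>x. \<exists>e\<in>E. \<exists>f\<in>F. x = e + f \<and> norm e \<le> C * norm x"
    and pos: "\<And>f. f \<in> F \<Longrightarrow> 0 \<le> cos \<eta> * (norm (Tt t f - f))\<^sup>2 + 2 * sin \<eta> * Im (cinner (Tt t f) (Jop f))"
  shows "has_index UNIV (\<lambda>u. cos \<eta> * (norm (Tt t u - u))\<^sup>2 + 2 * sin \<eta> * Im (cinner (Tt t u) (Jop u))) (arc_count T t (2 * \<eta>))"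
proof -
  interpret V: isometry "Vpath T t" by (rule Vpath_isometry)
  note hom = clin_module_hom[OF inp_clin[of t]]
  have "\<exists>B. finite B \<and> cvs.independent B \<and> cvs.span B = V.arc \<eta> \<and> has_index UNIV (\<lambda>x. Re (V.arc_form \<eta> x x)) (card B)"
  proof (rule V.arc_index[OF eta])
    show "cvs.subspace (inp t ` E)" by (rule module_hom.subspace_image[OF hom E(1)])
    show "cvs.subspace (inp t ` F)" by (rule module_hom.subspace_image[OF hom F])
    show "fin_dim (inp t ` E)"
    proof -
      obtain S where "finite S" "E \<subseteq> cvs.span S" using E(2) unfolding fin_dim_def by blast
      then have "finite (inp t ` S)" "inp t ` E \<subseteq> cvs.span (inp t ` S)"
        using module_hom.span_image[OF hom, of S] by auto
      then show ?thesis unfolding fin_dim_def by blast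
    qed
    show "0 \<le> Re (V.arc_form \<eta> f f)" if "f \<in> inp t ` F" for f
    proof -
      obtain u where u: "u \<in> F" "f = inp t u" using \<open>f \<in> inp t ` F\<close> by blast
      show ?thesis using pos[OF u(1)] arc_form_inp[of t \<eta> u] unfolding u(2) by linarith
    qed
    show "\<exists>e\<in>inp t ` E. \<exists>f\<in>inp t ` F. x = e + f \<and> norm e \<le> ((1 + M) * (\<bar>C\<bar> * (2 + M))) * norm x" for x
    proof -
      obtain e f where ef: "e \<in> E" "f \<in> F" "inp_inv t x = e + f" "norm e \<le> C * norm (inp_inv t x)"
        using dec[of "inp_inv t x"] by blast
      have "x = inp t e + inp t f" using ef(3) inp_inv(1)[of t x] clin_add[OF inp_clin, of t e f] by simp
      moreover have "norm (inp t e) \<le> ((1 + M) * (\<bar>C\<bar> * (2 + M))) * norm x"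
      proof -
        have "C * norm (inp_inv t x) \<le> \<bar>C\<bar> * ((2 + M) * norm x)"
          using norm_inp_inv[of t x] by (intro mult_mono) auto
        then have "norm e \<le> \<bar>C\<bar> * ((2 + M) * norm x)" using ef(4) by linarith
        then have "(1 + M) * norm e \<le> (1 + M) * (\<bar>C\<bar> * ((2 + M) * norm x))" using M_pos by (intro mult_left_mono) auto
        then show ?thesis using norm_inp[of t e] by (simp only: mult.assoc)
      qed
      ultimately show ?thesis using ef(1,2) by blast
    qed
  qed
  then obtain B where B: "finite B" "cvs.independent B" "cvs.span B = V.arc \<eta>"
    "has_index UNIV (\<lambda>x. Re (V.arc_form \<eta> x x)) (card B)" by (elim exE conjE) (rule that)
  have "has_index UNIV (\<lambda>x. 2 * Re (V.arc_form \<eta> x x)) (card B)" by (rule has_index_scale[OF B(4)]) simp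
  moreover have "2 * Re (V.arc_form \<eta> x x) = cos \<eta> * (norm (Tt t (inp_inv t x) - inp_inv t x))\<^sup>2
      + 2 * sin \<eta> * Im (cinner (Tt t (inp_inv t x)) (Jop (inp_inv t x)))" for x
    using arc_form_inp[of t \<eta> "inp_inv t x"] by (simp add: inp_inv(1))
  ultimately have "has_index UNIV (\<lambda>x. cos \<eta> * (norm (Tt t (inp_inv t x) - inp_inv t x))\<^sup>2
      + 2 * sin \<eta> * Im (cinner (Tt t (inp_inv t x)) (Jop (inp_inv t x)))) (card B)" by simp
  moreover have "inj (inp_inv t)"
  proof (rule injI)
    fix x y assume "inp_inv t x = inp_inv t y"
    then have "inp t (inp_inv t x) = inp t (inp_inv t y)" by simp
    then show "x = y" by (simp only: inp_inv(1))
  qed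
  ultimately have "has_index (range (inp_inv t)) (\<lambda>u. cos \<eta> * (norm (Tt t u - u))\<^sup>2 + 2 * sin \<eta> * Im (cinner (Tt t u) (Jop u))) (card B)"
    by (intro has_index_image[OF inp_inv_clin])
  moreover have "range (inp_inv t) = UNIV" by (rule surjI) (rule inp_inv(2))
  ultimately show ?thesis using arc_count_eq[OF B(1-3)] by simp
qed

end

section \<open>Crossings and the signature\<close>

text \<open>Two Krein structures side by side: U = e^{-i t_0} T with inverse S for the analysis at
  the eigenvalue 1, and T with inverse S' for the path V_t. The norm bound M serves both.\<close>

locale crossing = krein_fredholm Jop U S M R P M' L
  for U S R P :: "'h::chilbert \<times> 'h \<Rightarrow> 'h \<times> 'h" and M M' L +
  fixes T S' :: "'h \<times> 'h \<Rightarrow> 'h \<times> 'h" and t0 :: real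
  assumes blocks: "krein_blocks T S' M" and U_eq: "\<And>u. U u = scaleC (cis (- t0)) (T u)"
begin

interpretation B: krein_blocks T S' M by (rule blocks)

lemma rot_Tt: "rot \<delta> u = B.Tt (t0 + \<delta>) u"
  by (simp only: rot_def B.Tt_def U_eq scaleC_scaleC cis_mult minus_add_distrib add.commute)

text \<open>Each count plus n0 equals jn after t_0 and jp before it, so n0 cancels in the
  difference. An arc of length \<epsilon> corresponds to \<eta> = \<epsilon> / 2.\<close>

lemma arc_count_difference:
  assumes jn: "has_index E (\<lambda>x. Re (cinner x (Jop x))) jn" and jp: "has_index E (\<lambda>x. - Re (cinner x (Jop x))) jp"
  shows "eventually (\<lambda>\<epsilon>. eventually (\<lambda>\<delta>.
       int (arc_count T (t0 + \<delta>) \<epsilon>) - int (arc_count T (t0 - \<delta>) \<epsilon>) = int jn - int jp) (at_right 0)) (at_right 0)"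
proof -
  from global_index[OF jn jp] obtain n0 r where G: "0 < r \<and> (\<forall>c s. 0 < c \<and> 0 < s \<and> s \<le> r * c \<longrightarrow> (\<exists>\<delta>0>0. \<forall>\<delta> N. \<delta> \<noteq> 0 \<and> \<bar>\<delta>\<bar> < \<delta>0
      \<and> has_index UNIV (\<lambda>u. c * (norm (rot \<delta> u - u))\<^sup>2 + 2 * s * q \<delta> u) N
      \<longrightarrow> N + n0 = (if 0 < \<delta> then jn else jp)))" by (elim exE) (rule that)
  from F_nonnegative obtain \<rho> where rho: "0 < \<rho> \<and> (\<forall>c s. 0 < c \<and> 0 < s \<and> s \<le> \<rho> * c \<longrightarrow> (\<exists>\<delta>0>0. \<forall>\<delta> f. \<bar>\<delta>\<bar> < \<delta>0 \<and> f \<in> F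
      \<longrightarrow> 0 \<le> c * (norm (rot \<delta> f - f))\<^sup>2 + 2 * s * q \<delta> f))" by (elim exE) (rule that)
  obtain pr C1 where pr: "clin pr" "\<And>x. pr x \<in> E" "\<And>x. x - pr x \<in> F" "\<And>x. norm (pr x) \<le> C1 * norm x" "0 \<le> C1"
    by (rule projection_exists) (rule that)
  \<comment> \<open>For small \<epsilon> the ratio of sin \<eta> to cos \<eta> is below r', which
    puts the arc into the range of both \<open>global_index\<close> and
    \<open>F_nonnegative\<close>.\<close>
  define r' where "r' = min r \<rho>"
  have r': "0 < r'" "r' \<le> r" "r' \<le> \<rho>" using G rho by (auto simp: r'_def)
  have "((\<lambda>\<epsilon>. r' * cos (\<epsilon> / 2) - sin (\<epsilon> / 2)) \<longlongrightarrow> r' * cos (0 / 2) - sin (0 / 2)) (at_right 0)"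
    by (intro tendsto_intros) auto
  then have "eventually (\<lambda>\<epsilon>. 0 < r' * cos (\<epsilon> / 2) - sin (\<epsilon> / 2)) (at_right 0)"
    by (rule order_tendstoD) (use r' in simp)
  moreover have "eventually (\<lambda>\<epsilon>::real. \<epsilon> \<in> {0<..<pi}) (at_right 0)" by (rule eventually_at_right_real) simp
  ultimately show ?thesis
  proof eventually_elim
    case (elim \<epsilon>)
    define \<eta> where "\<eta> = \<epsilon> / 2"
    have eta: "0 < \<eta>" "\<eta> < pi / 2" using elim(2) by (auto simp: \<eta>_def)
    have cs: "0 < cos \<eta>" "0 < sin \<eta>" using eta by (auto intro!: cos_gt_zero sin_gt_zero)
    have s1: "sin \<eta> \<le> r * cos \<eta>" "sin \<eta> \<le> \<rho> * cos \<eta>"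
      using elim(1) mult_right_mono[OF r'(2), of "cos \<eta>"] mult_right_mono[OF r'(3), of "cos \<eta>"] cs
      unfolding \<eta>_def[symmetric] by linarith+
    obtain d1 where d1: "0 < d1" "\<And>\<delta> N. \<delta> \<noteq> 0 \<and> \<bar>\<delta>\<bar> < d1
      \<and> has_index UNIV (\<lambda>u. cos \<eta> * (norm (rot \<delta> u - u))\<^sup>2 + 2 * sin \<eta> * q \<delta> u) N
      \<Longrightarrow> N + n0 = (if 0 < \<delta> then jn else jp)"
      using G[THEN conjunct2, THEN spec, THEN spec, THEN mp, OF conjI[OF cs(1) conjI[OF cs(2) s1(1)]]] by blast
    obtain d2 where d2: "0 < d2" "\<And>\<delta> f. \<bar>\<delta>\<bar> < d2 \<and> f \<in> F \<Longrightarrow> 0 \<le> cos \<eta> * (norm (rot \<delta> f - f))\<^sup>2 + 2 * sin \<eta> * q \<delta> f"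
      using rho[THEN conjunct2, THEN spec, THEN spec, THEN mp, OF conjI[OF cs(1) conjI[OF cs(2) s1(2)]]] by blast
    have count: "arc_count T (t0 + \<delta>) \<epsilon> + n0 = (if 0 < \<delta> then jn else jp)"
      if d: "\<delta> \<noteq> 0" "\<bar>\<delta>\<bar> < min d1 d2" for \<delta>
    proof -
      have "has_index UNIV (\<lambda>u. cos \<eta> * (norm (B.Tt (t0 + \<delta>) u - u))\<^sup>2 + 2 * sin \<eta> * Im (cinner (B.Tt (t0 + \<delta>) u) (Jop u)))
          (arc_count T (t0 + \<delta>) (2 * \<eta>))"
      proof (rule B.arc_count_index[OF eta(1) less_imp_le[OF eta(2)] E_subspace E_fin_dim F_subspace])
        show "\<exists>e\<in>E. \<exists>f\<in>F. x = e + f \<and> norm e \<le> C1 * norm x" for x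
          by (rule bexI[OF _ pr(2)[of x]], rule bexI[OF _ pr(3)[of x]]) (simp add: pr(4))
        show "0 \<le> cos \<eta> * (norm (B.Tt (t0 + \<delta>) f - f))\<^sup>2 + 2 * sin \<eta> * Im (cinner (B.Tt (t0 + \<delta>) f) (Jop f))"
          if "f \<in> F" for f
          using d2(2)[of \<delta> f] d that unfolding q_def rot_Tt by simp
      qed
      then have "has_index UNIV (\<lambda>u. cos \<eta> * (norm (rot \<delta> u - u))\<^sup>2 + 2 * sin \<eta> * q \<delta> u) (arc_count T (t0 + \<delta>) \<epsilon>)"
        unfolding q_def rot_Tt \<eta>_def by simp
      then show ?thesis using d by (intro d1(2)) simp
    qed
    have "eventually (\<lambda>\<delta>. \<delta> \<in> {0<..<min d1 d2}) (at_right 0)"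
      by (rule eventually_at_right_real) (use d1 d2 in simp)
    then show ?case
    proof eventually_elim
      case (elim \<delta>)
      have "arc_count T (t0 + \<delta>) \<epsilon> + n0 = jn" "arc_count T (t0 + - \<delta>) \<epsilon> + n0 = jp"
        using count[of \<delta>] count[of "- \<delta>"] elim by auto
      then show ?case by simp
    qed
  qed
qed

lemma crossing_index_eq:
  assumes "has_index E (\<lambda>x. Re (cinner x (Jop x))) jn" "has_index E (\<lambda>x. - Re (cinner x (Jop x))) jp"
  shows "crossing_index T t0 = int jn - int jp"
  unfolding crossing_index_def
proof (rule the_equality, rule arc_count_difference[OF assms])
  fix k
  assume "eventually (\<lambda>\<epsilon>. eventually (\<lambda>\<delta>.
       int (arc_count T (t0 + \<delta>) \<epsilon>) - int (arc_count T (t0 - \<delta>) \<epsilon>) = k) (at_right 0)) (at_right (0::real))"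
  from eventually_conj[OF this arc_count_difference[OF assms]]
  obtain \<epsilon> where "eventually (\<lambda>\<delta>. int (arc_count T (t0 + \<delta>) \<epsilon>) - int (arc_count T (t0 - \<delta>) \<epsilon>) = k) (at_right 0)"
    "eventually (\<lambda>\<delta>. int (arc_count T (t0 + \<delta>) \<epsilon>) - int (arc_count T (t0 - \<delta>) \<epsilon>) = int jn - int jp) (at_right 0)"
    using eventually_happens[of _ "at_right (0::real)"] trivial_limit_at_right_real by blast
  from eventually_conj[OF this] show "k = int jn - int jp"
    using eventually_happens[of _ "at_right (0::real)"] trivial_limit_at_right_real by fastforce
qed

end

section \<open>Generalized eigenspaces of T and their J-products\<close>

lemma Jop_clin: "clin Jop" and Jop_Jop: "Jop (Jop x) = x"
  and Jop_self: "cinner (Jop x) y = cinner x (Jop y)"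
  by (simp_all add: clin_def Jop_def scaleC_prod_def cinner_prod_def cinner_minus_left cinner_minus_right)

lemma J_unitary_krein:
  assumes "J_unitary T"
  obtains S M where "krein_blocks T S M"
proof -
  have T: "kbounded T" and JU: "\<And>x y. cinner (T x) (Jop (T y)) = cinner x (Jop y)"
    and "kinvertible T" using assms unfolding J_unitary_def kinvertible_def kinner_cinner by blast+
  then obtain S where S: "kbounded S" "\<And>x. S (T x) = x" "\<And>x. T (S x) = x" unfolding kinvertible_def by blast
  obtain M where M: "0 < M" "\<And>x. norm (T x) \<le> M * norm x" by (rule kbounded_bound[OF T]) (rule that)
  have "krein_blocks T S M"
    by unfold_locales
      (rule Jop_clin Jop_Jop Jop_self kbounded_clin[OF T] M kbounded_clin[OF S(1)] S(2,3) JU)+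
  then show ?thesis by (rule that)
qed

lemma gen_eigenspace_scaleC: "gen_eigenspace T z = {x. \<exists>n. ((\<lambda>v. T v - scaleC z v) ^^ n) x = 0}"
  unfolding gen_eigenspace_def kscale_scaleC ..

text \<open>U - 1 is - e^{-i t_0} (e^{i t_0} - T), so the Riesz parametrix is multiplied by - e^{i
  t_0}. These unimodular factors change neither the norm bounds nor the generalised
  eigenspace.\<close>

lemma crossing_at_eigenvalue:
  assumes JT: "J_unitary T" and rf: "riesz_finite T (cis t0)"
  obtains U S R P M M' L S' where "crossing U S R P M M' L T S' t0"
    "parametrix.E (\<lambda>x. U x - x) = gen_eigenspace T (cis t0)"
proof -
  obtain S' M where kb: "krein_blocks T S' M" by (rule J_unitary_krein[OF JT]) (rule that)
  interpret B: krein_blocks T S' M by (rule kb)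
  have T: "kbounded T" using JT unfolding J_unitary_def kinvertible_def by blast
  obtain S0 P L where S0: "clin S0" "\<And>x. norm (S0 x) \<le> L * norm x" "clin P" "fin_dim (range P)"
    "\<And>x. S0 (scaleC (cis t0) x - T x) = x - P x" "\<And>x. scaleC (cis t0) (S0 x) - T (S0 x) = x - P x"
    by (rule riesz_parametrix[OF T rf]) (rule that)
  define U where "U u = scaleC (cis (- t0)) (T u)" for u
  define S where "S u = S' (scaleC (cis t0) u)" for u
  define R where "R u = scaleC (- cis t0) (S0 u)" for u
  have A: "U x - x = scaleC (- cis (- t0)) (scaleC (cis t0) x - T x)" for x
    by (simp add: U_def cvs.scale_right_diff_distrib cis_mult)
  have "crossing U S R P M (M + 1) L T S' t0"
  proof
    show "clin U" unfolding U_def by (rule clin_scaled[OF B.U])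
    show nU: "norm (U x) \<le> M * norm x" for x using B.U_bound by (simp add: U_def norm_scaleC)
    show "clin S" unfolding clin_def S_def
      by (intro conjI allI;
          simp only: scaleC_add_right clin_add[OF B.S] clin_scale[OF B.S] scaleC_scaleC mult.commute)
    show "S (U x) = x" for x by (simp add: S_def U_def cis_mult B.SU)
    show "U (S x) = x" for x by (simp add: S_def U_def B.US cis_mult)
    show "cinner (U x) (Jop (U y)) = cinner x (Jop y)" for x y
      using B.Tt_J[of t0 x y] by (simp add: U_def B.Tt_def)
    show "clin (\<lambda>x. U x - x)"
      by (simp add: clin_def U_def clin_add[OF B.U] clin_scale[OF B.U] scaleC_add_right cvs.scale_right_diff_distrib mult.commute)
    show "norm (U x - x) \<le> (M + 1) * norm x" for x
      using norm_triangle_ineq4[of "U x" x] nU[of x] by (simp add: algebra_simps)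
    show "clin R" unfolding R_def by (rule clin_scaled[OF S0(1)])
    show "norm (R x) \<le> L * norm x" for x using S0(2) by (simp add: R_def norm_scaleC del: cvs.scale_minus_left)
    show "R (U x - x) = x - P x" for x
      unfolding A R_def by (simp add: clin_scale[OF S0(1)] clin_neg[OF S0(1)] S0(5) cis_mult)
    show "U (R x) - R x = x - P x" for x
    proof -
      have "scaleC (cis t0) (R x) - T (R x) = scaleC (- cis t0) (scaleC (cis t0) (S0 x) - T (S0 x))"
        by (simp add: R_def clin_scale[OF B.U] clin_neg[OF B.U] cvs.scale_right_diff_distrib)
      then show ?thesis unfolding A S0(6) by (simp add: cis_mult)
    qed
  qed (use B.J B.JJ B.J_self B.M_pos S0(3,4) kb in \<open>simp_all add: U_def\<close>)
  moreover have "parametrix.E (\<lambda>x. U x - x) = gen_eigenspace T (cis t0)"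
  proof -
    interpret C: crossing U S R P M "M + 1" L T S' t0 by fact
    define N where "N v = T v - scaleC (cis t0) v" for v
    have AN: "U x - x = scaleC (cis (- t0)) (N x)" for x by (simp add: U_def N_def cvs.scale_right_diff_distrib cis_mult)
    have Ncl: "N (scaleC z x) = scaleC z (N x)" for z x
      by (simp add: N_def clin_scale[OF B.U] cvs.scale_right_diff_distrib mult.commute)
    have "((\<lambda>x. U x - x) ^^ n) x = scaleC (cis (- t0) ^ n) ((N ^^ n) x)" for n x
      by (induction n) (simp_all add: AN Ncl)
    then have "((\<lambda>x. U x - x) ^^ n) x = 0 \<longleftrightarrow> (N ^^ n) x = 0" for n x by simp
    then show ?thesis unfolding C.E_def gen_eigenspace_scaleC N_def by simp
  qed
  ultimately show ?thesis by (rule that)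
qed

lemma crossing_index_gen_eigenspace:
  assumes "J_unitary T" "riesz_finite T (cis t0)"
    and "has_index (gen_eigenspace T (cis t0)) (\<lambda>x. Re (cinner x (Jop x))) jn"
    and "has_index (gen_eigenspace T (cis t0)) (\<lambda>x. - Re (cinner x (Jop x))) jp"
  shows "crossing_index T t0 = int jn - int jp"
proof -
  obtain U S R P M M' L S' where C: "crossing U S R P M M' L T S' t0"
    "parametrix.E (\<lambda>x. U x - x) = gen_eigenspace T (cis t0)"
    by (rule crossing_at_eigenvalue[OF assms(1,2)]) (rule that)
  show ?thesis using crossing.crossing_index_eq[OF C(1)] assms(3,4) unfolding C(2) by blast
qed

lemma gen_eigenspace_unit_circle:
  assumes "J_unitary T" "riesz_finite T (cis t0)"
  shows "cvs.subspace (gen_eigenspace T (cis t0))"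
    and "x \<in> gen_eigenspace T (cis t0) \<Longrightarrow> (\<And>y. y \<in> gen_eigenspace T (cis t0) \<Longrightarrow> cinner x (Jop y) = 0) \<Longrightarrow> x = 0"
proof -
  obtain U S R P M M' L S' where C: "crossing U S R P M M' L T S' t0"
    and E: "parametrix.E (\<lambda>x. U x - x) = gen_eigenspace T (cis t0)"
    by (rule crossing_at_eigenvalue[OF assms(1,2)]) (rule that)
  interpret C: crossing U S R P M M' L T S' t0 by (rule C)
  show "cvs.subspace (gen_eigenspace T (cis t0))" unfolding E[symmetric] by (rule C.E_subspace)
  show "x \<in> gen_eigenspace T (cis t0) \<Longrightarrow> (\<And>y. y \<in> gen_eigenspace T (cis t0) \<Longrightarrow> cinner x (Jop y) = 0) \<Longrightarrow> x = 0"
    unfolding E[symmetric] by (rule C.J_nondegenerate)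
qed

text \<open>Induction on the sum of the nilpotency orders. With T x = z x + x' and T y = w y + y'
  the terms containing x' or y' vanish, and J-unitarity leaves <x, J y> = conj z w <x, J y>.\<close>

lemma gen_eigenspaces_J_orthogonal:
  fixes T :: "'h::chilbert \<times> 'h \<Rightarrow> 'h \<times> 'h"
  assumes JU: "\<And>x y. cinner (T x) (Jop (T y)) = cinner x (Jop y)" and ne: "cnj z * w \<noteq> 1"
    and "x \<in> gen_eigenspace T z" "y \<in> gen_eigenspace T w"
  shows "cinner x (Jop y) = 0"
proof -
  define A where "A u v = T v - scaleC u v" for u v
  have main: "(A z ^^ m) x = 0 \<Longrightarrow> (A w ^^ n) y = 0 \<Longrightarrow> cinner x (Jop y) = 0" for m n x y
  proof (induction "m + n" arbitrary: m n x y rule: less_induct)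
    case less
    show ?case
    proof (cases m)
      case 0
      then show ?thesis using less.prems by simp
    next
      case m: (Suc m')
      show ?thesis
      proof (cases n)
        case 0
        then have "y = 0" using less.prems(2) by simp
        then show ?thesis by (simp add: cinner_prod_def Jop_def)
      next
        case n: (Suc n')
        define x' where "x' = A z x"
        define y' where "y' = A w y"
        have x': "(A z ^^ m') x' = 0" using less.prems(1) unfolding m funpow_Suc_right o_apply x'_def .
        have y': "(A w ^^ n') y' = 0" using less.prems(2) unfolding n funpow_Suc_right o_apply y'_def .
        have 1: "cinner x' (Jop y) = 0" by (rule less.hyps[OF _ x' less.prems(2)]) (simp add: m)
        have 2: "cinner x (Jop y') = 0" by (rule less.hyps[OF _ less.prems(1) y']) (simp add: n)
        have 3: "cinner x' (Jop y') = 0" by (rule less.hyps[OF _ x' y']) (simp add: m n)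
        have Tx: "T x = scaleC z x + x'" "T y = scaleC w y + y'" by (simp_all add: x'_def y'_def A_def)
        have "cinner x (Jop y) = cinner (scaleC z x + x') (Jop (scaleC w y + y'))"
          using JU[of x y] unfolding Tx by simp
        also have "\<dots> = cnj z * w * cinner x (Jop y)"
          by (simp add: clin_add[OF Jop_clin] clin_scale[OF Jop_clin] cinner_add_left cinner_add_right
              cinner_scaleC_left cinner_scaleC_right 1 2 3)
        finally show ?thesis using ne by simp
      qed
    qed
  qed
  then show ?thesis using assms(3,4) unfolding gen_eigenspace_scaleC A_def by blast
qed

lemma J_orthogonal_span:
  assumes "\<And>x y. x \<in> X \<Longrightarrow> y \<in> Y \<Longrightarrow> cinner x (Jop y) = 0" "x \<in> cvs.span X" "y \<in> cvs.span Y"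
  shows "cinner x (Jop y) = 0"
proof -
  have 1: "cinner x' (Jop y) = 0" if x': "x' \<in> X" for x'
  proof -
    have "cvs.subspace {y. cinner x' (Jop y) = 0}"
      by (rule cvs.subspaceI)
        (simp_all add: clin_zero[OF Jop_clin] clin_add[OF Jop_clin] clin_scale[OF Jop_clin] cinner_add_right cinner_scaleC_right)
    moreover have "Y \<subseteq> {y. cinner x' (Jop y) = 0}" using assms(1)[OF x'] by blast
    ultimately have "cvs.span Y \<subseteq> {y. cinner x' (Jop y) = 0}" by (intro cvs.span_minimal)
    then show ?thesis using assms(3) by blast
  qed
  have "cvs.subspace {x. cinner x (Jop y) = 0}"
    by (rule cvs.subspaceI) (simp_all add: cinner_add_left cinner_scaleC_left)
  moreover have "X \<subseteq> {x. cinner x (Jop y) = 0}" using 1 by blast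
  ultimately have "cvs.span X \<subseteq> {x. cinner x (Jop y) = 0}" by (intro cvs.span_minimal)
  then show ?thesis using assms(2) by blast
qed

text \<open>The factor \<sigma> lets one induction serve the negative index (\<sigma> = 1) and the
  positive index (\<sigma> = -1) of J.\<close>

lemma has_index_finite_sum:
  fixes X :: "'z \<Rightarrow> ('h::chilbert \<times> 'h) set"
  assumes L: "finite L" and s: "\<And>z. z \<in> L \<Longrightarrow> cvs.subspace (X z)"
    and orth: "\<And>z w x y. z \<in> L \<Longrightarrow> w \<in> L \<Longrightarrow> z \<noteq> w \<Longrightarrow> x \<in> X z \<Longrightarrow> y \<in> X w \<Longrightarrow> cinner x (Jop y) = 0"
    and h: "herm (UNIV :: ('h \<times> 'h) set) (\<lambda>x y. \<sigma> * cinner x (Jop y))"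
    and i: "\<And>z. z \<in> L \<Longrightarrow> has_index (X z) (\<lambda>x. Re (\<sigma> * cinner x (Jop x))) (n z)"
  shows "has_index (cvs.span (\<Union>z\<in>L. X z)) (\<lambda>x. Re (\<sigma> * cinner x (Jop x))) (\<Sum>z\<in>L. n z)"
  using L s orth i
proof (induction L)
  case empty
  show ?case using has_index_trivial[of "\<lambda>x. Re (\<sigma> * cinner x (Jop x))"] by simp
next
  case (insert z L)
  have ih: "has_index (cvs.span (\<Union>z\<in>L. X z)) (\<lambda>x. Re (\<sigma> * cinner x (Jop x))) (\<Sum>z\<in>L. n z)"
  proof (rule insert.IH)
    show "cvs.subspace (X w)" if "w \<in> L" for w using insert.prems(1)[of w] that by simp
    show "cinner x (Jop y) = 0" if "u \<in> L" "w \<in> L" "u \<noteq> w" "x \<in> X u" "y \<in> X w" for u w x y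
      by (rule insert.prems(2)[OF _ _ that(3-5)]) (simp_all add: that(1,2))
    show "has_index (X w) (\<lambda>x. Re (\<sigma> * cinner x (Jop x))) (n w)" if "w \<in> L" for w
      using insert.prems(3)[of w] that by blast
  qed
  have Xz: "cvs.subspace (X z)" using insert.prems(1) by simp
  then have spz: "cvs.span (X z) = X z" by simp
  have "cvs.span (\<Union>z\<in>insert z L. X z) = {x + y |x y. x \<in> X z \<and> y \<in> cvs.span (\<Union>z\<in>L. X z)}"
    using cvs.span_Un[of "X z" "\<Union>z\<in>L. X z"] by (simp add: spz)
  moreover have "has_index {x + y |x y. x \<in> X z \<and> y \<in> cvs.span (\<Union>z\<in>L. X z)}
      (\<lambda>x. Re (\<sigma> * cinner x (Jop x))) (n z + (\<Sum>z\<in>L. n z))"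
  proof (rule has_index_orthogonal_sum[OF h cvs.subspace_UNIV])
    show "\<sigma> * cinner x (Jop y) = 0" if "x \<in> X z" "y \<in> cvs.span (\<Union>z\<in>L. X z)" for x y
    proof -
      have "cinner x (Jop y) = 0"
      proof (rule J_orthogonal_span[where X = "X z" and Y = "\<Union>z\<in>L. X z"])
        show "x \<in> cvs.span (X z)" using that(1) by (rule cvs.span_base)
        show "y \<in> cvs.span (\<Union>z\<in>L. X z)" by (rule that(2))
        fix x' y' assume x': "x' \<in> X z" and "y' \<in> (\<Union>z\<in>L. X z)"
        then obtain w where w: "w \<in> L" "y' \<in> X w" by blast
        have "z \<noteq> w" using w(1) insert.hyps(2) by blast
        then show "cinner x' (Jop y') = 0" using insert.prems(2)[of z w x' y'] w x' by simp
      qed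
      then show ?thesis by simp
    qed
    show "has_index (X z) (\<lambda>x. Re (\<sigma> * cinner x (Jop x))) (n z)" by (rule insert.prems(3)) simp
    show "has_index (cvs.span (\<Union>z\<in>L. X z)) (\<lambda>x. Re (\<sigma> * cinner x (Jop x))) (\<Sum>z\<in>L. n z)" by (rule ih)
  qed (simp_all add: Xz)
  ultimately have "has_index (cvs.span (\<Union>z\<in>insert z L. X z)) (\<lambda>x. Re (\<sigma> * cinner x (Jop x))) (n z + (\<Sum>z\<in>L. n z))"
    by simp
  then show ?case using insert.hyps by simp
qed

lemma Sig_has_index:
  assumes "orthonormal_basis_of E es" "cvs.subspace E"
  shows "onb (set es) E" "has_index E (\<lambda>x. Re (cinner x (Jop x))) (nu_neg (gram_J es))"
    "has_index E (\<lambda>x. - Re (cinner x (Jop x))) (nu_pos (gram_J es))"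
proof -
  have es: "\<And>i j. i < length es \<Longrightarrow> j < length es \<Longrightarrow> cinner (es ! i) (es ! j) = (if i = j then 1 else 0)"
    "set es \<subseteq> E" "E \<subseteq> cvs.span (set es)"
    using assms(1) unfolding orthonormal_basis_of_def kspan_span kinner_cinner by blast+
  have dist: "distinct es"
    unfolding distinct_conv_nth
  proof (intro allI impI notI)
    fix i j assume ij: "i < length es" "j < length es" "i \<noteq> j" "es ! i = es ! j"
    then show False using es(1)[OF ij(1,2)] es(1)[OF ij(2,2)] by simp
  qed
  have "orthonormal (set es)"
    unfolding orthonormal_def
  proof (intro ballI)
    fix x y assume "x \<in> set es" "y \<in> set es"
    then obtain i j where ij: "i < length es" "x = es ! i" "j < length es" "y = es ! j" by (metis in_set_conv_nth)
    then show "cinner x y = (if x = y then 1 else 0)" using es(1)[OF ij(1,3)] dist by (simp add: nth_eq_iff_index_eq)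
  qed
  moreover have "cvs.span (set es) = E" by (rule cvs.span_subspace[OF es(2,3) assms(2)])
  ultimately show onb: "onb (set es) E" unfolding onb_def by simp
  have h: "herm E (\<lambda>x y. cinner x (Jop y))"
  proof (rule hermI)
    fix x y :: "'a \<times> 'a"
    show "cinner y (Jop x) = cnj (cinner x (Jop y))" by (metis Jop_self cinner_commute)
  qed (simp_all add: clin_add[OF Jop_clin] clin_scale[OF Jop_clin] cinner_add_right cinner_scaleC_right)
  have g: "gram_J es = mat (length es) (length es) (\<lambda>(i, j). cinner (es ! i) (Jop (es ! j)))"
    unfolding gram_J_def kinner_cinner ..
  show "has_index E (\<lambda>x. Re (cinner x (Jop x))) (nu_neg (gram_J es))"
    "has_index E (\<lambda>x. - Re (cinner x (Jop x))) (nu_pos (gram_J es))"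
    unfolding g by (rule hermitian_matrix_signature[OF h assms(2) onb dist])+
qed

lemma eigenvalue_in_kspec: "u \<noteq> 0 \<Longrightarrow> T u = scaleC z u \<Longrightarrow> clin T \<Longrightarrow> z \<in> kspec T"
proof -
  assume u: "u \<noteq> 0" "T u = scaleC z u" "clin T"
  have "\<not> kinvertible (\<lambda>x. T x - scaleC z x)"
  proof
    assume "kinvertible (\<lambda>x. T x - scaleC z x)"
    then obtain S where "\<And>x. S (T x - scaleC z x) = x" unfolding kinvertible_def by blast
    then have "S 0 = u" "S 0 = 0" using u clin_zero[OF u(3)] by (metis cancel_comm_monoid_add_class.diff_cancel, metis diff_self cvs.scale_zero_right)
    then show False using u(1) by simp
  qed
  then show "z \<in> kspec T" unfolding kspec_def kscale_scaleC by simp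
qed

theorem theorem5p11:
  fixes T :: "'h::chilbert \<times> 'h \<Rightarrow> 'h \<times> 'h"
    and h :: real
    and es :: "('h \<times> 'h) list"
  assumes "separable_H TYPE('h)"
    and "J_unitary T"
    and "ess_S1_gapped T"
    and "sig_radius T h"
    and "orthonormal_basis_of (E_eq T h) es"
  shows "Sig_of es = - SF T"
proof -
  obtain S' M where kb: "krein_blocks T S' M" by (rule J_unitary_krein[OF assms(2)]) (rule that)
  interpret B: krein_blocks T S' M by (rule kb)
  define G where "G = gen_eigenspace T"
  define Ann where "Ann = kspec T \<inter> annulus h"
  define L where "L = {z \<in> kspec T. cmod z = 1}"
  have h0: "0 < h" using assms(4) unfolding sig_radius_def by blast
  have L_Ann: "L \<subseteq> Ann" using h0 by (auto simp: L_def Ann_def annulus_def)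
  have Leig: "\<exists>x. x \<noteq> 0 \<and> T x = scaleC z x" and Lriesz: "riesz_finite T z" if "z \<in> L" for z
    using assms(3) that unfolding ess_S1_gapped_def L_def discrete_eigenvalue_def kscale_scaleC by blast+
  have cisz: "\<exists>t. 0 \<le> t \<and> t < 2 * pi \<and> z = cis t" if "cmod z = 1" for z
  proof -
    have "(Re z)\<^sup>2 + (Im z)\<^sup>2 = 1" using that by (simp add: cmod_def)
    then obtain t where "0 \<le> t" "t < 2 * pi" "Re z = cos t" "Im z = sin t" using sincos_total_2pi by metis
    then show ?thesis by (intro exI[of _ t]) (simp add: complex_eq_iff)
  qed
  have Eeq: "E_eq T h = cvs.span (\<Union>z\<in>Ann. G z)" unfolding E_eq_def kspan_span Ann_def G_def ..
  have Eeq_sub: "cvs.subspace (E_eq T h)" unfolding Eeq by simp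
  note sig = Sig_has_index[OF assms(5) Eeq_sub]
  have Efin: "fin_dim (E_eq T h)" by (rule onb_fin_dim[OF sig(1)])
  have GE: "G z \<subseteq> E_eq T h" if "z \<in> Ann" for z
    unfolding Eeq using that cvs.span_superset[of "\<Union>z\<in>Ann. G z"] by blast
  have Gsub: "cvs.subspace (G z)"
    and Gnd: "\<And>x. x \<in> G z \<Longrightarrow> (\<And>y. y \<in> G z \<Longrightarrow> cinner x (Jop y) = 0) \<Longrightarrow> x = 0" if z: "z \<in> L" for z
  proof -
    obtain t where t: "z = cis t" using cisz z by (auto simp: L_def)
    have rf: "riesz_finite T (cis t)" using Lriesz[OF z] t by simp
    show "cvs.subspace (G z)" unfolding G_def t by (rule gen_eigenspace_unit_circle(1)[OF assms(2) rf])
    show "\<And>x. x \<in> G z \<Longrightarrow> (\<And>y. y \<in> G z \<Longrightarrow> cinner x (Jop y) = 0) \<Longrightarrow> x = 0"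
      unfolding G_def t by (rule gen_eigenspace_unit_circle(2)[OF assms(2) rf])
  qed
  have Gorth: "cinner x (Jop y) = 0" if "cnj z * w \<noteq> 1" "x \<in> G z" "y \<in> G w" for x y z w
    using gen_eigenspaces_J_orthogonal[OF B.JU that(1)] that(2,3) unfolding G_def .
  have Lorth: "cinner x (Jop y) = 0" if zw: "z \<in> L" "w \<in> Ann" "z \<noteq> w" "x \<in> G z" "y \<in> G w" for x y z w
  proof (rule Gorth[OF _ zw(4,5)])
    \<comment> \<open>On the circle conj z is 1 / z, so conj z w = 1 would mean w = z.\<close>
    have "z * cnj z = 1" using complex_norm_square[of z] zw(1) by (simp add: L_def)
    then show "cnj z * w \<noteq> 1" using zw(3) by (metis mult.assoc mult.commute mult.left_neutral)
  qed
  \<comment> \<open>The basis es makes \<open>E_eq T h\<close> finite-dimensional. One eigenvector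
    for each of too many points of L would be too many independent vectors: pairing a relation with
    some J y, y in the generalised eigenspace at z, isolates the coefficient at z.\<close>
  have "finite L"
  proof (rule ccontr)
    assume "infinite L"
    then obtain K where K: "K \<subseteq> L" "finite K" "card K = Suc (card (set es))"
      using infinite_arbitrarily_large by blast
    have "\<forall>z\<in>K. \<exists>x. x \<noteq> 0 \<and> T x = scaleC z x" using Leig K(1) by blast
    then obtain v where v: "\<And>z. z \<in> K \<Longrightarrow> v z \<noteq> 0" "\<And>z. z \<in> K \<Longrightarrow> T (v z) = scaleC z (v z)" by metis
    have vG: "v z \<in> G z" if "z \<in> K" for z
    proof -
      have "((\<lambda>x. T x - scaleC z x) ^^ 1) (v z) = 0" using v(2)[OF that] by simp
      then show ?thesis unfolding G_def gen_eigenspace_scaleC by blast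
    qed
    have key: "\<forall>z\<in>K. c z = 0" if s: "(\<Sum>z\<in>K. scaleC (c z) (v z)) = 0" for c
    proof
      fix z assume z: "z \<in> K"
      then have zL: "z \<in> L" using K(1) by blast
      have "\<exists>y\<in>G z. cinner (v z) (Jop y) \<noteq> 0" using Gnd[OF zL vG[OF z]] v(1)[OF z] by blast
      then obtain y where y: "y \<in> G z" "cinner (v z) (Jop y) \<noteq> 0" by blast
      have "0 = cinner (\<Sum>w\<in>K. scaleC (c w) (v w)) (Jop y)" using s by simp
      also have "\<dots> = (\<Sum>w\<in>K. if w = z then cnj (c z) * cinner (v z) (Jop y) else 0)"
        unfolding cinner_sum_left cinner_scaleC_left
      proof (rule sum.cong[OF refl])
        fix w assume w: "w \<in> K"
        have "cinner (v w) (Jop y) = 0" if "w \<noteq> z"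
          using Lorth[OF _ _ that vG[OF w] y(1)] w K(1) zL L_Ann by blast
        then show "cnj (c w) * cinner (v w) (Jop y) = (if w = z then cnj (c z) * cinner (v z) (Jop y) else 0)" by simp
      qed
      also have "\<dots> = cnj (c z) * cinner (v z) (Jop y)" using z K(2) by simp
      finally show "c z = 0" using y(2) by simp
    qed
    have "inj_on v K" "cvs.independent (v ` K)"
      by (rule independent_familyI[OF K(2)], rule key, assumption)+
    moreover have "v ` K \<subseteq> cvs.span (set es)"
    proof -
      have "v z \<in> E_eq T h" if "z \<in> K" for z using vG[OF that] GE[of z] that K(1) L_Ann by blast
      then show ?thesis using sig(1) unfolding onb_def by blast
    qed
    ultimately have "card (v ` K) \<le> card (set es)" "card (v ` K) = card K"
      using cvs.independent_span_bound[of "set es" "v ` K"] by (simp_all add: card_image)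
    then show False using K(3) by simp
  qed
  define O1 where "O1 = cvs.span (\<Union>z\<in>{z \<in> Ann. 1 < cmod z}. G z)"
  define O2 where "O2 = cvs.span (\<Union>z\<in>{z \<in> Ann. cmod z < 1}. G z)"
  define O' where "O' = {x + y |x y. x \<in> O1 \<and> y \<in> O2}"
  have O_span: "O' = cvs.span ((\<Union>z\<in>{z \<in> Ann. 1 < cmod z}. G z) \<union> (\<Union>z\<in>{z \<in> Ann. cmod z < 1}. G z))"
    unfolding cvs.span_Un O'_def O1_def O2_def ..
  define C where "C = cvs.span (\<Union>z\<in>L. G z)"
  have Ann_split: "(\<Union>z\<in>Ann. G z) = (\<Union>z\<in>L. G z) \<union> ((\<Union>z\<in>{z \<in> Ann. 1 < cmod z}. G z) \<union> (\<Union>z\<in>{z \<in> Ann. cmod z < 1}. G z))"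
  proof -
    have "Ann = L \<union> ({z \<in> Ann. 1 < cmod z} \<union> {z \<in> Ann. cmod z < 1})"
      using L_Ann by (auto simp: L_def Ann_def)
    then show ?thesis by blast
  qed
  have E_split: "E_eq T h = {x + y |x y. x \<in> C \<and> y \<in> O'}"
    unfolding Eeq Ann_split C_def O_span by (rule cvs.span_Un)
  have O_sub: "cvs.subspace O'" unfolding O_span by simp
  have C_sub: "cvs.subspace C" unfolding C_def by simp
  have "O' \<subseteq> E_eq T h" unfolding Eeq Ann_split O_span by (rule cvs.span_mono) blast
  then have O_fin: "fin_dim O'" by (rule fin_dim_subset[OF Efin])
  have CO: "cinner x (Jop y) = 0" if "x \<in> C" "y \<in> O'" for x y
  proof (rule J_orthogonal_span[OF _ that[unfolded C_def O_span]])
    fix x y assume "x \<in> (\<Union>z\<in>L. G z)"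
      and "y \<in> (\<Union>z\<in>{z \<in> Ann. 1 < cmod z}. G z) \<union> (\<Union>z\<in>{z \<in> Ann. cmod z < 1}. G z)"
    then obtain z w where "z \<in> L" "x \<in> G z" "w \<in> Ann" "cmod w \<noteq> 1" "y \<in> G w" by fastforce
    then show "cinner x (Jop y) = 0" using Lorth[of z w x y] by (auto simp: L_def)
  qed
  \<comment> \<open>Outside the circle |conj z w| > 1 for all pairs, z = w included, so O1 is
    J-isotropic; inside, the modulus is below 1 and O2 is isotropic too.\<close>
  have iso1: "cinner x (Jop y) = 0" if "x \<in> O1" "y \<in> O1" for x y
  proof (rule J_orthogonal_span[OF _ that[unfolded O1_def]])
    fix x y assume "x \<in> (\<Union>z\<in>{z \<in> Ann. 1 < cmod z}. G z)" "y \<in> (\<Union>z\<in>{z \<in> Ann. 1 < cmod z}. G z)"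
    then obtain z w where zw: "1 < cmod z" "x \<in> G z" "1 < cmod w" "y \<in> G w" by blast
    have "1 < cmod z * cmod w" using zw(1,3) by (rule less_1_mult)
    then have "cnj z * w \<noteq> 1" by (metis complex_mod_cnj less_irrefl norm_mult norm_one)
    then show "cinner x (Jop y) = 0" using Gorth zw by blast
  qed
  have iso2: "cinner x (Jop y) = 0" if "x \<in> O2" "y \<in> O2" for x y
  proof (rule J_orthogonal_span[OF _ that[unfolded O2_def]])
    fix x y assume "x \<in> (\<Union>z\<in>{z \<in> Ann. cmod z < 1}. G z)" "y \<in> (\<Union>z\<in>{z \<in> Ann. cmod z < 1}. G z)"
    then obtain z w where zw: "cmod z < 1" "x \<in> G z" "cmod w < 1" "y \<in> G w" by blast
    have "cmod z * cmod w < 1" using mult_strict_mono'[OF zw(1,3)] by simp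
    then have "cnj z * w \<noteq> 1" by (metis complex_mod_cnj less_irrefl norm_mult norm_one)
    then show "cinner x (Jop y) = 0" using Gorth zw by blast
  qed
  have hJ: "herm X (\<lambda>x y. cinner x (Jop y))" for X :: "('h \<times> 'h) set" by (rule B.herm_J)
  have hJ': "herm X (\<lambda>x y. - cinner x (Jop y))" for X :: "('h \<times> 'h) set" by (rule herm_uminus[OF hJ])
  obtain o1 where o1: "has_index O' (\<lambda>x. Re (cinner x (Jop x))) o1"
    using has_index_exists[OF hJ O_sub O_fin] by blast
  have "\<exists>n. has_index O' (\<lambda>x. - Re (cinner x (Jop x))) n"
    using has_index_exists[OF hJ' O_sub O_fin] by simp
  then obtain o2 where o2: "has_index O' (\<lambda>x. - Re (cinner x (Jop x))) o2" by blast
  have o12: "o1 = o2"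
    by (rule isotropic_index_eq[OF hJ cvs.subspace_UNIV _ subset_UNIV _ subset_UNIV iso1 iso2 O'_def o1 o2])
      (simp_all add: O1_def O2_def)
  have Gfin: "fin_dim (G z)" if "z \<in> L" for z
    using fin_dim_subset[OF Efin GE[of z]] that L_Ann by blast
  have "\<exists>n. has_index (G z) (\<lambda>x. Re (cinner x (Jop x))) n" if "z \<in> L" for z
    using has_index_exists[OF hJ Gsub[OF that] Gfin[OF that]] by blast
  then obtain jn where jn: "\<And>z. z \<in> L \<Longrightarrow> has_index (G z) (\<lambda>x. Re (cinner x (Jop x))) (jn z)" by metis
  have "\<exists>n. has_index (G z) (\<lambda>x. - Re (cinner x (Jop x))) n" if "z \<in> L" for z
    using has_index_exists[OF hJ' Gsub[OF that] Gfin[OF that]] by simp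
  then obtain jp where jp: "\<And>z. z \<in> L \<Longrightarrow> has_index (G z) (\<lambda>x. - Re (cinner x (Jop x))) (jp z)" by metis
  have Lorth': "cinner x (Jop y) = 0" if "z \<in> L" "w \<in> L" "z \<noteq> w" "x \<in> G z" "y \<in> G w" for x y z w
    using Lorth[of z w x y] that L_Ann by blast
  have C1: "has_index C (\<lambda>x. Re (cinner x (Jop x))) (\<Sum>z\<in>L. jn z)"
  proof -
    have "has_index C (\<lambda>x. Re (1 * cinner x (Jop x))) (\<Sum>z\<in>L. jn z)"
      unfolding C_def
    proof (rule has_index_finite_sum[OF \<open>finite L\<close> Gsub])
      show "cinner x (Jop y) = 0" if "z \<in> L" "w \<in> L" "z \<noteq> w" "x \<in> G z" "y \<in> G w" for z w x y
        by (rule Lorth'[OF that])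
    qed (simp_all add: hJ jn)
    then show ?thesis by simp
  qed
  have C2: "has_index C (\<lambda>x. - Re (cinner x (Jop x))) (\<Sum>z\<in>L. jp z)"
  proof -
    have "has_index C (\<lambda>x. Re (- 1 * cinner x (Jop x))) (\<Sum>z\<in>L. jp z)"
      unfolding C_def
    proof (rule has_index_finite_sum[OF \<open>finite L\<close> Gsub])
      show "cinner x (Jop y) = 0" if "z \<in> L" "w \<in> L" "z \<noteq> w" "x \<in> G z" "y \<in> G w" for z w x y
        by (rule Lorth'[OF that])
    qed (simp_all add: hJ' jp)
    then show ?thesis by simp
  qed
  have "has_index (E_eq T h) (\<lambda>x. Re (cinner x (Jop x))) ((\<Sum>z\<in>L. jn z) + o1)"
    unfolding E_split
    by (rule has_index_orthogonal_sum[OF hJ cvs.subspace_UNIV subset_UNIV subset_UNIV CO C1 o1 C_sub O_sub])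
  then have neg: "nu_neg (gram_J es) = (\<Sum>z\<in>L. jn z) + o1" by (rule has_index_unique[OF sig(2)])
  have "has_index (E_eq T h) (\<lambda>x. Re (- cinner x (Jop x))) ((\<Sum>z\<in>L. jp z) + o2)"
    unfolding E_split
    by (rule has_index_orthogonal_sum[OF hJ' cvs.subspace_UNIV subset_UNIV subset_UNIV _ _ _ C_sub O_sub])
      (use CO C2 o2 in simp_all)
  then have pos: "nu_pos (gram_J es) = (\<Sum>z\<in>L. jp z) + o2" using has_index_unique[OF sig(3)] by simp
  define I where "I = {t. 0 \<le> t \<and> t < 2 * pi \<and> (\<exists>x. x \<noteq> 0 \<and> Vpath T t x = x)}"
  have cross: "crossing_index T t = int (jn (cis t)) - int (jp (cis t))" if "cis t \<in> L" for t
    by (rule crossing_index_gen_eigenspace[OF assms(2) Lriesz[OF that]])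
      (use jn[OF that] jp[OF that] in \<open>simp_all add: G_def\<close>)
  have I_L: "cis t \<in> L" if "t \<in> I" for t
  proof -
    have "\<exists>v. v \<noteq> 0 \<and> Vpath T t v = v" using that by (simp add: I_def)
    then obtain u where u: "u \<noteq> 0" "T u = scaleC (cis t) u" unfolding B.fixed_point_iff by (elim exE conjE) (rule that)
    have "cis t \<in> kspec T" by (rule eigenvalue_in_kspec[OF u B.U])
    then show ?thesis by (simp add: L_def)
  qed
  \<comment> \<open>The half-open interval [0, 2 pi) meets each point of the circle once, so a
    crossing at t = 0 is counted and its copy at 2 pi is not.\<close>
  have "bij_betw cis I L"
    unfolding bij_betw_def
  proof
    show "inj_on cis I"
    proof (rule inj_onI)
      fix s t assume st: "s \<in> I" "t \<in> I" "cis s = cis t"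
      then have "sin s = sin t \<and> cos s = cos t" by (simp add: complex_eq_iff)
      then obtain n :: int where n: "s = t + 2 * pi * n" using sin_cos_eq_iff[of s t] by blast
      have "\<bar>2 * pi * of_int n\<bar> < 2 * pi" using st(1,2) n by (auto simp: I_def)
      then have "\<bar>of_int n\<bar> < (1::real)" by (simp add: abs_mult)
      then have "n = 0" by linarith
      then show "s = t" using n by simp
    qed
    show "cis ` I = L"
    proof
      show "cis ` I \<subseteq> L" using I_L by blast
      show "L \<subseteq> cis ` I"
      proof
        fix z assume z: "z \<in> L"
        then obtain t where t: "0 \<le> t" "t < 2 * pi" "z = cis t" using cisz by (auto simp: L_def)
        have "\<exists>v. v \<noteq> 0 \<and> Vpath T t v = v" using Leig[OF z] B.fixed_point_iff[of t] unfolding t(3) by blast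
        then have "t \<in> I" using t by (simp add: I_def)
        then show "z \<in> cis ` I" using t(3) by blast
      qed
    qed
  qed
  then have "(\<Sum>t\<in>I. int (jn (cis t)) - int (jp (cis t))) = (\<Sum>z\<in>L. int (jn z) - int (jp z))"
    by (rule sum.reindex_bij_betw)
  moreover have "SF T = (\<Sum>t\<in>I. int (jn (cis t)) - int (jp (cis t)))"
    unfolding SF_def I_def[symmetric] using cross I_L by (intro sum.cong) auto
  ultimately have "SF T = (\<Sum>z\<in>L. int (jn z)) - (\<Sum>z\<in>L. int (jp z))" by (simp add: sum_subtractf)
  \<comment> \<open>The crossing index is negative minus positive index while the signature is
    positive minus negative, which is the minus sign; the off-circle contributions o1 = o2
    cancel.\<close>
  then show ?thesis unfolding Sig_of_def neg pos o12 by simp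
qed

end
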